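(* Let $\mathcal C$ be a unital $A_\infty$-category whose unit elements $\mathbf i_0^{\mathcal C}$ satisfy the equations $$(1\otimes\mathbf i^{\mathcal C}_0)b_2=1,\qquad(\mathbf i^{\mathcal C}_0\otimes1)b_2=-1,$$ $$(1^{\otimes n}\otimes\mathbf i^{\mathcal C}_0)b_{n+1}=0,\qquad(\mathbf i^{\mathcal C}_0\otimes1^{\otimes n})b_{n+1}=0\quad\text{for }n>1.$$ Let $\mathcal B\subset\mathcal C$ be a full $A_\infty$-subcategory. Then the $A_\infty$-category $\mathcal D=\mathsf Q(\mathcal C|\mathcal B)$ is unital.
   Context: Conventions. $k$ is a commutative associative unital ring. Gradings are by $\mathbb Z$, differentials have degree $+1$. Maps are written on the right: $fg$ means first $f$, then $g$; Koszul rule $(x\otimes y)(f\otimes g)=(-1)^{\deg y\,\deg f}xf\otimes yg$. A graded quiver $C$ is a set $\mathrm{Ob}\,C$ with graded $k$-modules $C(X,Y)$. $sC=C[1]$, $(sC)^d=C^{d+1}$. $(sC)^{\otimes n}(X,Y)=\bigoplus_{X=X_0,\dots,X_n=Y}sC(X_0,X_1)\otimes\dots\otimes sC(X_{n-1},X_n)$. An $A_\infty$-category is a graded quiver $C$ with maps $b_n:(sC)^{\otimes n}\to sC$ of degree $1$, $n\ge1$, with $\sum_{r+n+t=m}(1^{\otimes r}\otimes b_n\otimes1^{\otimes t})b_{r+1+t}=0$ for all $m\ge1$. It is unital if each object $X$ has a $b_1$-cycle ${}_X\mathbf i_0\in sC(X,X)$ of degree $-1$ (unit element) such that $(1\otimes{}_Y\mathbf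 i_0)b_2$ and $-({}_X\mathbf i_0\otimes1)b_2:sC(X,Y)\to sC(X,Y)$ are homotopic to the identity map for all objects $X,Y$. Construction of $\mathsf Q(\mathcal C|\mathcal B)$. Define a graded quiver $\mathcal E$, $\mathrm{Ob}\,\mathcal E=\mathrm{Ob}\,\mathcal C$, as freely generated by $s\mathcal C$ under operations $b_n$ of degree $1$, $n\ge2$, and $H$ of degree $-1$, where $H$ may be applied to a morphism $X\to Y$ only if $X\in\mathrm{Ob}\,\mathcal B$ or $Y\in\mathrm{Ob}\,\mathcal B$, and $H$ is never applied to a result of $H$. That is, $s\mathcal E(X,Y)=P(X,Y)\oplus P(X,Y)H$ if $X$ or $Y$ is in $\mathrm{Ob}\,\mathcal B$, and $s\mathcal E(X,Y)=P(X,Y)$ otherwise, where $P=s\mathcal C\oplus\bigoplus_{n\ge2}b_n((s\mathcal E)^{\otimes n})$, and $b_n:(s\mathcal E)^{\otimes n}\to P$, $H:P(X,Y)\to P(X,Y)H$ are isomorphisms onto their images (equivalently, $s\mathcal E$ is a direct sum of shifted tensor products of copies of $s\mathcal C$ indexed by suitable plane rooted trees). The differential $b_1$ on $s\mathcal E$ extends that of $s\mathcal C$ by $b_nb_1=-\sum_{a+p+c=n,\,a+c>0}(1^{\otimes a}\otimes b_p\otimes1^{\otimes c})b_{a+1+c}$ for $n\ge2$ and $Hb_1=1-b_1H$ (on $P$). This makes $\mathcal E$ an $A_\infty$-category. Let $R_{\mathcal C}=\sum_{n\ge2}\mathrm{Im}(b_n^{\mathcal E}-b_n^{\mathcal C}:(s\mathcal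 C)^{\otimes n}\to s\mathcal E)$ and let $(R_{\mathcal C})_+$ be the smallest graded subquiver of $s\mathcal E$ containing $R_{\mathcal C}$, closed under $b_n$, $n\ge2$, with one argument in it and the others in $s\mathcal E$, and closed under $H$ where $H$ is defined. It is stable under $b_1$, and $\mathsf Q(\mathcal C|\mathcal B)=\mathcal E/s^{-1}(R_{\mathcal C})_+$ is the quotient $A_\infty$-category, with $s\mathsf Q(\mathcal C|\mathcal B)=s\mathcal E/(R_{\mathcal C})_+$. *)

theory Defs
  imports "HOL-Algebra.Module" "HOL-Algebra.AbelCoset"
begin

section \<open>\<open>A\<^sub>\<infinity>\<close>-categories over a commutative ring\<close>

text \<open>
  A graded quiver is a set \<open>Ob C\<close> with \<open>k\<close>-modules \<open>Hom C X Y d\<close>, the degree \<open>d\<close> component of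
  \<open>C(X,Y)\<close>. Only objects in \<open>Ob C\<close> and elements of the carriers are meaningful. The operations
  \<open>b\<^sub>n\<close>, which are linear maps out of direct sums of tensor products, are given as families of
  multilinear maps: a homogeneous element of some \<open>sC(X,Y)\<close> is packed together with its source,
  target and degree, and \<open>bop C [x\<^sub>1,\<dots>,x\<^sub>n]\<close> is \<open>(x\<^sub>1 \<otimes> \<dots> \<otimes> x\<^sub>n) b\<^sub>n\<close>. All degrees in arrows are
  degrees in the suspension \<open>sC\<close>.
\<close>

datatype ('o, 'm) arrow = Arrow (src: 'o) (tgt: 'o) (deg: int) (el: 'm)

record ('o, 'k, 'm) ainf =
  Ob :: "'o set"
  Hom :: "'o \<Rightarrow> 'o \<Rightarrow> int \<Rightarrow> ('k, 'm) module"
  bop :: "('o, 'm) arrow list \<Rightarrow> 'm"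

definition sHom :: "('o, 'k, 'm) ainf \<Rightarrow> 'o \<Rightarrow> 'o \<Rightarrow> int \<Rightarrow> ('k, 'm) module" where
  "sHom C X Y d = Hom C X Y (d + 1)"

definition arrows :: "('o, 'k, 'm) ainf \<Rightarrow> ('o, 'm) arrow set" where
  "arrows C = {x. src x \<in> Ob C \<and> tgt x \<in> Ob C \<and> el x \<in> carrier (sHom C (src x) (tgt x) (deg x))}"

definition composable :: "('o, 'k, 'm) ainf \<Rightarrow> ('o, 'm) arrow list \<Rightarrow> bool" where
  "composable C xs \<longleftrightarrow>
     xs \<noteq> [] \<and> set xs \<subseteq> arrows C \<and> successively (\<lambda>x y. tgt x = src y) xs"

definition total_deg :: "('o, 'm) arrow list \<Rightarrow> int" where
  "total_deg xs = sum_list (map deg xs)"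

definition barrow :: "('o, 'k, 'm) ainf \<Rightarrow> ('o, 'm) arrow list \<Rightarrow> ('o, 'm) arrow" where
  "barrow C xs = Arrow (src (hd xs)) (tgt (last xs)) (total_deg xs + 1) (bop C xs)"

definition ksign :: "('k, 'm) module \<Rightarrow> int \<Rightarrow> 'm \<Rightarrow> 'm" where
  "ksign M e x = (if even e then x else \<ominus>\<^bsub>M\<^esub> x)"

text \<open>
  Maps are written on the right, so applying \<open>1\<^bsup>\<otimes>r\<^esup> \<otimes> b\<^sub>n \<otimes> 1\<^bsup>\<otimes>t\<^esup>\<close> to a tensor moves \<open>b\<^sub>n\<close> (of degree 1)
  past the last \<open>t\<close> factors; this is the sign below. The index \<open>t\<close> is \<open>length xs - r - n\<close>.
\<close>

locale ainf_category =
  fixes K :: "'k ring" and C :: "('o, 'k, 'm) ainf"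
  assumes base_ring: "cring K"
    and Hom_module: "\<lbrakk>X \<in> Ob C; Y \<in> Ob C\<rbrakk> \<Longrightarrow> module K (Hom C X Y d)"
    and bop_closed: "composable C xs \<Longrightarrow>
      bop C xs \<in> carrier (sHom C (src (hd xs)) (tgt (last xs)) (total_deg xs + 1))"
    and bop_add:
      "\<lbrakk>zs = us @ Arrow X Y d (x \<oplus>\<^bsub>sHom C X Y d\<^esub> y) # vs;
        composable C (us @ Arrow X Y d x # vs); composable C (us @ Arrow X Y d y # vs)\<rbrakk> \<Longrightarrow>
       bop C zs = bop C (us @ Arrow X Y d x # vs)
         \<oplus>\<^bsub>sHom C (src (hd zs)) (tgt (last zs)) (total_deg zs + 1)\<^esub> bop C (us @ Arrow X Y d y # vs)"
    and bop_smult: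
      "\<lbrakk>zs = us @ Arrow X Y d (r \<odot>\<^bsub>sHom C X Y d\<^esub> x) # vs;
        r \<in> carrier K; composable C (us @ Arrow X Y d x # vs)\<rbrakk> \<Longrightarrow>
       bop C zs = r \<odot>\<^bsub>sHom C (src (hd zs)) (tgt (last zs)) (total_deg zs + 1)\<^esub>
         bop C (us @ Arrow X Y d x # vs)"
    and ainf_relation:
      "\<lbrakk>composable C xs; M = sHom C (src (hd xs)) (tgt (last xs)) (total_deg xs + 2)\<rbrakk> \<Longrightarrow>
       finsum M
         (\<lambda>(r, n). ksign M (total_deg (drop (r + n) xs))
           (bop C (take r xs @ barrow C (take n (drop r xs)) # drop (r + n) xs)))
         {(r, n). 1 \<le> n \<and> r + n \<le> length xs} = \<zero>\<^bsub>M\<^esub>"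

definition linear_map :: "'k ring \<Rightarrow> ('k, 'm) module \<Rightarrow> ('k, 'm) module \<Rightarrow> ('m \<Rightarrow> 'm) \<Rightarrow> bool" where
  "linear_map K M N f \<longleftrightarrow>
     f \<in> carrier M \<rightarrow> carrier N \<and>
     (\<forall>x\<in>carrier M. \<forall>y\<in>carrier M. f (x \<oplus>\<^bsub>M\<^esub> y) = f x \<oplus>\<^bsub>N\<^esub> f y) \<and>
     (\<forall>r\<in>carrier K. \<forall>x\<in>carrier M. f (r \<odot>\<^bsub>M\<^esub> x) = r \<odot>\<^bsub>N\<^esub> f x)"

text \<open>
  Degree 0 maps \<open>f, g : sC(X,Y) \<rightarrow> sC(X,Y)\<close>, given by their components, are homotopic if
  \<open>f = g + h b\<^sub>1 + b\<^sub>1 h\<close> for some linear \<open>h\<close> of degree \<open>-1\<close>.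
\<close>

definition homotopic_maps ::
  "'k ring \<Rightarrow> ('o, 'k, 'm) ainf \<Rightarrow> 'o \<Rightarrow> 'o \<Rightarrow> (int \<Rightarrow> 'm \<Rightarrow> 'm) \<Rightarrow> (int \<Rightarrow> 'm \<Rightarrow> 'm) \<Rightarrow> bool" where
  "homotopic_maps K C X Y f g \<longleftrightarrow>
     (\<exists>h :: int \<Rightarrow> 'm \<Rightarrow> 'm.
        (\<forall>d. linear_map K (sHom C X Y d) (sHom C X Y (d - 1)) (h d)) \<and>
        (\<forall>d. \<forall>x\<in>carrier (sHom C X Y d).
           f d x = g d x
             \<oplus>\<^bsub>sHom C X Y d\<^esub> bop C [Arrow X Y (d - 1) (h d x)]
             \<oplus>\<^bsub>sHom C X Y d\<^esub> h (d + 1) (bop C [Arrow X Y d x])))"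

text \<open>
  \<open>right_unit_op C i\<close> and \<open>left_unit_op C i\<close> are \<open>(1\<^bsup>\<otimes>n\<^esup> \<otimes> i) b\<^bsub>n+1\<^esub>\<close> and \<open>(i \<otimes> 1\<^bsup>\<otimes>n\<^esup>) b\<^bsub>n+1\<^esub>\<close>. In the
  second one \<open>i\<close>, of degree \<open>-1\<close>, moves past all arguments.
\<close>

definition right_unit_op ::
  "('o, 'k, 'm) ainf \<Rightarrow> ('o \<Rightarrow> 'm) \<Rightarrow> ('o, 'm) arrow list \<Rightarrow> 'm" where
  "right_unit_op C i xs =
     (let Y = tgt (last xs) in bop C (xs @ [Arrow Y Y (-1) (i Y)]))"

definition left_unit_op ::
  "('o, 'k, 'm) ainf \<Rightarrow> ('o \<Rightarrow> 'm) \<Rightarrow> ('o, 'm) arrow list \<Rightarrow> 'm" where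
  "left_unit_op C i xs =
     (let X = src (hd xs) in
      ksign (sHom C X (tgt (last xs)) (total_deg xs)) (total_deg xs)
        (bop C (Arrow X X (-1) (i X) # xs)))"

definition unit_elements :: "'k ring \<Rightarrow> ('o, 'k, 'm) ainf \<Rightarrow> ('o \<Rightarrow> 'm) \<Rightarrow> bool" where
  "unit_elements K C i \<longleftrightarrow>
     (\<forall>X\<in>Ob C. i X \<in> carrier (sHom C X X (-1)) \<and>
        bop C [Arrow X X (-1) (i X)] = \<zero>\<^bsub>sHom C X X 0\<^esub>) \<and>
     (\<forall>X\<in>Ob C. \<forall>Y\<in>Ob C.
        homotopic_maps K C X Y (\<lambda>d x. right_unit_op C i [Arrow X Y d x]) (\<lambda>d x. x) \<and>
        homotopic_maps K C X Y
          (\<lambda>d x. \<ominus>\<^bsub>sHom C X Y d\<^esub> left_unit_op C i [Arrow X Y d x]) (\<lambda>d x. x))"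

definition unital_ainf_category :: "'k ring \<Rightarrow> ('o, 'k, 'm) ainf \<Rightarrow> bool" where
  "unital_ainf_category K C \<longleftrightarrow> ainf_category K C \<and> (\<exists>i. unit_elements K C i)"

definition strict_unit_equations :: "('o, 'k, 'm) ainf \<Rightarrow> ('o \<Rightarrow> 'm) \<Rightarrow> bool" where
  "strict_unit_equations C i \<longleftrightarrow>
     (\<forall>x\<in>arrows C. right_unit_op C i [x] = el x \<and>
        left_unit_op C i [x] = \<ominus>\<^bsub>sHom C (src x) (tgt x) (deg x)\<^esub> el x) \<and>
     (\<forall>xs. composable C xs \<and> length xs > 1 \<longrightarrow>
        right_unit_op C i xs = \<zero>\<^bsub>sHom C (src (hd xs)) (tgt (last xs)) (total_deg xs)\<^esub> \<and>
        left_unit_op C i xs = \<zero>\<^bsub>sHom C (src (hd xs)) (tgt (last xs)) (total_deg xs)\<^esub>)"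

definition full_ainf_subcategory :: "('o, 'k, 'm) ainf \<Rightarrow> ('o, 'k, 'm) ainf \<Rightarrow> bool" where
  "full_ainf_subcategory B C \<longleftrightarrow>
     Ob B \<subseteq> Ob C \<and>
     (\<forall>X\<in>Ob B. \<forall>Y\<in>Ob B. \<forall>d. Hom B X Y d = Hom C X Y d) \<and>
     (\<forall>xs. composable B xs \<longrightarrow> bop B xs = bop C xs)"


section \<open>The freely generated category \<open>\<E>\<close>\<close>

text \<open>
  The modules \<open>s\<E>(X,Y)\<close> are term algebras: homogeneous terms built from the generators \<open>sC\<close>, the
  module operations, the operations \<open>b\<^sub>n\<close> (\<open>n \<ge> 2\<close>) and \<open>H\<close>, modulo the least congruence that
  makes the hom sets \<open>k\<close>-modules, the inclusion of \<open>sC\<close> and \<open>H\<close> linear, and \<open>b\<^sub>n\<close> multilinear.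
  \<open>TGen X Y d m\<close> is the generator given by \<open>m \<in> sC(X,Y)\<close> of degree \<open>d\<close>; degrees of terms are
  degrees in \<open>s\<E>\<close>.
\<close>

datatype ('o, 'k, 'm) tm =
    TGen 'o 'o int 'm
  | TZero 'o 'o int
  | TAdd "('o, 'k, 'm) tm" "('o, 'k, 'm) tm"
  | TSmult 'k "('o, 'k, 'm) tm"
  | TB "('o, 'k, 'm) tm list"
  | TH "('o, 'k, 'm) tm"

primrec tm_src :: "('o, 'k, 'm) tm \<Rightarrow> 'o" where
  "tm_src (TGen X Y d m) = X"
| "tm_src (TZero X Y d) = X"
| "tm_src (TAdd t u) = tm_src t"
| "tm_src (TSmult r t) = tm_src t"
| "tm_src (TB ts) = hd (map tm_src ts)"
| "tm_src (TH t) = tm_src t"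

primrec tm_tgt :: "('o, 'k, 'm) tm \<Rightarrow> 'o" where
  "tm_tgt (TGen X Y d m) = Y"
| "tm_tgt (TZero X Y d) = Y"
| "tm_tgt (TAdd t u) = tm_tgt t"
| "tm_tgt (TSmult r t) = tm_tgt t"
| "tm_tgt (TB ts) = last (map tm_tgt ts)"
| "tm_tgt (TH t) = tm_tgt t"

primrec tm_deg :: "('o, 'k, 'm) tm \<Rightarrow> int" where
  "tm_deg (TGen X Y d m) = d"
| "tm_deg (TZero X Y d) = d"
| "tm_deg (TAdd t u) = tm_deg t"
| "tm_deg (TSmult r t) = tm_deg t"
| "tm_deg (TB ts) = sum_list (map tm_deg ts) + 1"
| "tm_deg (TH t) = tm_deg t - 1"

text \<open>The terms of the subquiver \<open>P = sC \<oplus> \<Oplus>\<^sub>n b\<^sub>n((s\<E>)\<^bsup>\<otimes>n\<^esup>)\<close>, on which \<open>H\<close> may be applied.\<close>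

primrec in_P :: "('o, 'k, 'm) tm \<Rightarrow> bool" where
  "in_P (TGen X Y d m) \<longleftrightarrow> True"
| "in_P (TZero X Y d) \<longleftrightarrow> True"
| "in_P (TAdd t u) \<longleftrightarrow> in_P t \<and> in_P u"
| "in_P (TSmult r t) \<longleftrightarrow> in_P t"
| "in_P (TB ts) \<longleftrightarrow> True"
| "in_P (TH t) \<longleftrightarrow> False"

fun wf_tm :: "'k ring \<Rightarrow> ('o, 'k, 'm) ainf \<Rightarrow> ('o, 'k, 'm) ainf \<Rightarrow> ('o, 'k, 'm) tm \<Rightarrow> bool" where
  "wf_tm K C B (TGen X Y d m) \<longleftrightarrow> X \<in> Ob C \<and> Y \<in> Ob C \<and> m \<in> carrier (sHom C X Y d)"
| "wf_tm K C B (TZero X Y d) \<longleftrightarrow> X \<in> Ob C \<and> Y \<in> Ob C"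
| "wf_tm K C B (TAdd t u) \<longleftrightarrow> wf_tm K C B t \<and> wf_tm K C B u \<and>
     tm_src t = tm_src u \<and> tm_tgt t = tm_tgt u \<and> tm_deg t = tm_deg u"
| "wf_tm K C B (TSmult r t) \<longleftrightarrow> r \<in> carrier K \<and> wf_tm K C B t"
| "wf_tm K C B (TB ts) \<longleftrightarrow> length ts \<ge> 2 \<and> (\<forall>t\<in>set ts. wf_tm K C B t) \<and>
     successively (\<lambda>t u. tm_tgt t = tm_src u) ts"
| "wf_tm K C B (TH t) \<longleftrightarrow> wf_tm K C B t \<and> in_P t \<and> (tm_src t \<in> Ob B \<or> tm_tgt t \<in> Ob B)"

definition tneg :: "'k ring \<Rightarrow> ('o, 'k, 'm) tm \<Rightarrow> ('o, 'k, 'm) tm" where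
  "tneg K t = TSmult (\<ominus>\<^bsub>K\<^esub> \<one>\<^bsub>K\<^esub>) t"

inductive tm_eq ::
  "'k ring \<Rightarrow> ('o, 'k, 'm) ainf \<Rightarrow> ('o, 'k, 'm) ainf \<Rightarrow> ('o, 'k, 'm) tm \<Rightarrow> ('o, 'k, 'm) tm \<Rightarrow> bool"
  for K C B where
  refl: "wf_tm K C B t \<Longrightarrow> tm_eq K C B t t"
| sym: "tm_eq K C B t u \<Longrightarrow> tm_eq K C B u t"
| trans: "tm_eq K C B t u \<Longrightarrow> tm_eq K C B u v \<Longrightarrow> tm_eq K C B t v"
| cong_add: "tm_eq K C B t t' \<Longrightarrow> tm_eq K C B u u' \<Longrightarrow> wf_tm K C B (TAdd t u) \<Longrightarrow>
    tm_eq K C B (TAdd t u) (TAdd t' u')"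
| cong_smult: "tm_eq K C B t t' \<Longrightarrow> r \<in> carrier K \<Longrightarrow> tm_eq K C B (TSmult r t) (TSmult r t')"
| cong_b: "tm_eq K C B t t' \<Longrightarrow> wf_tm K C B (TB (us @ t # vs)) \<Longrightarrow>
    tm_eq K C B (TB (us @ t # vs)) (TB (us @ t' # vs))"
| cong_H: "tm_eq K C B t t' \<Longrightarrow> wf_tm K C B (TH t) \<Longrightarrow> wf_tm K C B (TH t') \<Longrightarrow>
    tm_eq K C B (TH t) (TH t')"
| add_assoc: "wf_tm K C B (TAdd (TAdd t u) v) \<Longrightarrow>
    tm_eq K C B (TAdd (TAdd t u) v) (TAdd t (TAdd u v))"
| add_comm: "wf_tm K C B (TAdd t u) \<Longrightarrow> tm_eq K C B (TAdd t u) (TAdd u t)"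
| add_zero: "wf_tm K C B t \<Longrightarrow>
    tm_eq K C B (TAdd t (TZero (tm_src t) (tm_tgt t) (tm_deg t))) t"
| add_neg: "wf_tm K C B t \<Longrightarrow>
    tm_eq K C B (TAdd t (tneg K t)) (TZero (tm_src t) (tm_tgt t) (tm_deg t))"
| smult_l_distr: "r \<in> carrier K \<Longrightarrow> r' \<in> carrier K \<Longrightarrow> wf_tm K C B t \<Longrightarrow>
    tm_eq K C B (TSmult (r \<oplus>\<^bsub>K\<^esub> r') t) (TAdd (TSmult r t) (TSmult r' t))"
| smult_r_distr: "r \<in> carrier K \<Longrightarrow> wf_tm K C B (TAdd t u) \<Longrightarrow>
    tm_eq K C B (TSmult r (TAdd t u)) (TAdd (TSmult r t) (TSmult r u))"
| smult_assoc: "r \<in> carrier K \<Longrightarrow> r' \<in> carrier K \<Longrightarrow> wf_tm K C B t \<Longrightarrow>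
    tm_eq K C B (TSmult (r \<otimes>\<^bsub>K\<^esub> r') t) (TSmult r (TSmult r' t))"
| smult_one: "wf_tm K C B t \<Longrightarrow> tm_eq K C B (TSmult \<one>\<^bsub>K\<^esub> t) t"
| gen_add: "wf_tm K C B (TGen X Y d m) \<Longrightarrow> wf_tm K C B (TGen X Y d m') \<Longrightarrow>
    tm_eq K C B (TGen X Y d (m \<oplus>\<^bsub>sHom C X Y d\<^esub> m')) (TAdd (TGen X Y d m) (TGen X Y d m'))"
| gen_smult: "r \<in> carrier K \<Longrightarrow> wf_tm K C B (TGen X Y d m) \<Longrightarrow>
    tm_eq K C B (TGen X Y d (r \<odot>\<^bsub>sHom C X Y d\<^esub> m)) (TSmult r (TGen X Y d m))"
| b_add: "wf_tm K C B (TB (us @ TAdd t u # vs)) \<Longrightarrow>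
    tm_eq K C B (TB (us @ TAdd t u # vs)) (TAdd (TB (us @ t # vs)) (TB (us @ u # vs)))"
| b_smult: "wf_tm K C B (TB (us @ TSmult r t # vs)) \<Longrightarrow>
    tm_eq K C B (TB (us @ TSmult r t # vs)) (TSmult r (TB (us @ t # vs)))"
| H_add: "wf_tm K C B (TH (TAdd t u)) \<Longrightarrow>
    tm_eq K C B (TH (TAdd t u)) (TAdd (TH t) (TH u))"
| H_smult: "wf_tm K C B (TH (TSmult r t)) \<Longrightarrow>
    tm_eq K C B (TH (TSmult r t)) (TSmult r (TH t))"

definition tm_rel ::
  "'k ring \<Rightarrow> ('o, 'k, 'm) ainf \<Rightarrow> ('o, 'k, 'm) ainf \<Rightarrow> ('o, 'k, 'm) tm rel" where
  "tm_rel K C B = {(t, u). tm_eq K C B t u}"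

definition terms ::
  "'k ring \<Rightarrow> ('o, 'k, 'm) ainf \<Rightarrow> ('o, 'k, 'm) ainf \<Rightarrow> 'o \<Rightarrow> 'o \<Rightarrow> int \<Rightarrow> ('o, 'k, 'm) tm set" where
  "terms K C B X Y d = {t. wf_tm K C B t \<and> tm_src t = X \<and> tm_tgt t = Y \<and> tm_deg t = d}"

text \<open>
  The degree \<open>d\<close> component of \<open>s\<E>(X,Y)\<close>. The fields \<open>mult\<close> and \<open>one\<close>, present in every
  \<open>module\<close> record, play no role.
\<close>

definition free_module ::
  "'k ring \<Rightarrow> ('o, 'k, 'm) ainf \<Rightarrow> ('o, 'k, 'm) ainf \<Rightarrow> 'o \<Rightarrow> 'o \<Rightarrow> int
    \<Rightarrow> ('k, ('o, 'k, 'm) tm set) module" where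
  "free_module K C B X Y d =
     \<lparr>carrier = terms K C B X Y d // tm_rel K C B,
      mult = undefined,
      one = undefined,
      zero = tm_rel K C B `` {TZero X Y d},
      add = \<lambda>c c'. \<Union>t\<in>c. \<Union>u\<in>c'. tm_rel K C B `` {TAdd t u},
      smult = \<lambda>r c. \<Union>t\<in>c. tm_rel K C B `` {TSmult r t}\<rparr>"

text \<open>
  The differential \<open>b\<^sub>1\<close> on terms: it extends that of \<open>sC\<close>, is given on results of \<open>b\<^sub>n\<close> by
  \<open>b\<^sub>n b\<^sub>1 = -\<Sum> (1\<^bsup>\<otimes>a\<^esup> \<otimes> b\<^sub>p \<otimes> 1\<^bsup>\<otimes>c\<^esup>) b\<^bsub>a+1+c\<^esub>\<close> over \<open>a + p + c = n\<close>, \<open>a + c > 0\<close> (that is, \<open>p < n\<close>),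
  with the Koszul sign for moving \<open>b\<^sub>p\<close> past the last \<open>c\<close> factors, and by \<open>H b\<^sub>1 = 1 - b\<^sub>1 H\<close>.
\<close>

definition tsign :: "'k ring \<Rightarrow> int \<Rightarrow> ('o, 'k, 'm) tm \<Rightarrow> ('o, 'k, 'm) tm" where
  "tsign K e t = (if even e then t else tneg K t)"

primrec tm_b1 :: "'k ring \<Rightarrow> ('o, 'k, 'm) ainf \<Rightarrow> ('o, 'k, 'm) tm \<Rightarrow> ('o, 'k, 'm) tm" where
  "tm_b1 K C (TGen X Y d m) = TGen X Y (d + 1) (bop C [Arrow X Y d m])"
| "tm_b1 K C (TZero X Y d) = TZero X Y (d + 1)"
| "tm_b1 K C (TAdd t u) = TAdd (tm_b1 K C t) (tm_b1 K C u)"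
| "tm_b1 K C (TSmult r t) = TSmult r (tm_b1 K C t)"
| "tm_b1 K C (TB ts) =
     tneg K (foldr TAdd
       [tsign K (sum_list (map tm_deg (drop (a + p) ts)))
          (TB (take a ts
               @ (if p = 1 then map (tm_b1 K C) ts ! a else TB (take p (drop a ts)))
               # drop (a + p) ts)).
        p \<leftarrow> [1..<length ts], a \<leftarrow> [0..<length ts - p + 1]]
       (TZero (tm_src (TB ts)) (tm_tgt (TB ts)) (tm_deg (TB ts) + 1)))"
| "tm_b1 K C (TH t) = TAdd t (tneg K (TH (tm_b1 K C t)))"

definition free_ainf ::
  "'k ring \<Rightarrow> ('o, 'k, 'm) ainf \<Rightarrow> ('o, 'k, 'm) ainf \<Rightarrow> ('o, 'k, ('o, 'k, 'm) tm set) ainf" where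
  "free_ainf K C B =
     \<lparr>Ob = Ob C,
      Hom = \<lambda>X Y d. free_module K C B X Y (d - 1),
      bop = \<lambda>xs. if length xs = 1
        then (\<Union>t\<in>el (hd xs). tm_rel K C B `` {tm_b1 K C t})
        else (\<Union>ts\<in>listset (map el xs). tm_rel K C B `` {TB ts})\<rparr>"

definition free_incl ::
  "'k ring \<Rightarrow> ('o, 'k, 'm) ainf \<Rightarrow> ('o, 'k, 'm) ainf \<Rightarrow> ('o, 'm) arrow
    \<Rightarrow> ('o, ('o, 'k, 'm) tm set) arrow" where
  "free_incl K C B x =
     Arrow (src x) (tgt x) (deg x) (tm_rel K C B `` {TGen (src x) (tgt x) (deg x) (el x)})"

definition free_P ::
  "'k ring \<Rightarrow> ('o, 'k, 'm) ainf \<Rightarrow> ('o, 'k, 'm) ainf \<Rightarrow> ('o, ('o, 'k, 'm) tm set) arrow set" where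
  "free_P K C B = {x \<in> arrows (free_ainf K C B). \<exists>t\<in>el x. in_P t}"

definition free_H ::
  "'k ring \<Rightarrow> ('o, 'k, 'm) ainf \<Rightarrow> ('o, 'k, 'm) ainf \<Rightarrow> ('o, ('o, 'k, 'm) tm set) arrow
    \<Rightarrow> ('o, ('o, 'k, 'm) tm set) arrow" where
  "free_H K C B x =
     Arrow (src x) (tgt x) (deg x - 1) (\<Union>t\<in>{t \<in> el x. in_P t}. tm_rel K C B `` {TH t})"


section \<open>The quotient \<open>Q(C|B)\<close>\<close>

text \<open>
  \<open>(R\<^sub>C)\<^sub>+\<close>, as a set of homogeneous elements of \<open>s\<E>\<close> with their source, target and degree.
  The rules \<open>zero\<close>, \<open>add\<close>, \<open>smult\<close> say that it is a graded subquiver, i.e. consists of submodules.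
\<close>

inductive_set R_plus ::
  "'k ring \<Rightarrow> ('o, 'k, 'm) ainf \<Rightarrow> ('o, 'k, 'm) ainf \<Rightarrow> ('o, ('o, 'k, 'm) tm set) arrow set"
  for K C B where
  base: "composable C xs \<Longrightarrow> length xs \<ge> 2 \<Longrightarrow>
    X = src (hd xs) \<Longrightarrow> Y = tgt (last xs) \<Longrightarrow> d = total_deg xs + 1 \<Longrightarrow>
    Arrow X Y d
      (bop (free_ainf K C B) (map (free_incl K C B) xs)
         \<ominus>\<^bsub>sHom (free_ainf K C B) X Y d\<^esub> el (free_incl K C B (barrow C xs)))
      \<in> R_plus K C B"
| zero: "X \<in> Ob C \<Longrightarrow> Y \<in> Ob C \<Longrightarrow>
    Arrow X Y d \<zero>\<^bsub>sHom (free_ainf K C B) X Y d\<^esub> \<in> R_plus K C B"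
| add: "Arrow X Y d x \<in> R_plus K C B \<Longrightarrow> Arrow X Y d y \<in> R_plus K C B \<Longrightarrow>
    Arrow X Y d (x \<oplus>\<^bsub>sHom (free_ainf K C B) X Y d\<^esub> y) \<in> R_plus K C B"
| smult: "r \<in> carrier K \<Longrightarrow> Arrow X Y d x \<in> R_plus K C B \<Longrightarrow>
    Arrow X Y d (r \<odot>\<^bsub>sHom (free_ainf K C B) X Y d\<^esub> x) \<in> R_plus K C B"
| closed_b: "composable (free_ainf K C B) (us @ x # vs) \<Longrightarrow> length (us @ x # vs) \<ge> 2 \<Longrightarrow>
    x \<in> R_plus K C B \<Longrightarrow> barrow (free_ainf K C B) (us @ x # vs) \<in> R_plus K C B"
| closed_H: "x \<in> R_plus K C B \<Longrightarrow> x \<in> free_P K C B \<Longrightarrow> src x \<in> Ob B \<or> tgt x \<in> Ob B \<Longrightarrow>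
    free_H K C B x \<in> R_plus K C B"

definition quotient_module :: "('k, 'm) module \<Rightarrow> 'm set \<Rightarrow> ('k, 'm set) module" where
  "quotient_module M N =
     \<lparr>carrier = a_rcosets\<^bsub>M\<^esub> N,
      mult = undefined,
      one = undefined,
      zero = N,
      add = \<lambda>c c'. c <+>\<^bsub>M\<^esub> c',
      smult = \<lambda>r c. \<Union>x\<in>c. N +>\<^bsub>M\<^esub> (r \<odot>\<^bsub>M\<^esub> x)\<rparr>"

definition component :: "('o, 'm) arrow set \<Rightarrow> 'o \<Rightarrow> 'o \<Rightarrow> int \<Rightarrow> 'm set" where
  "component I X Y d = {x. Arrow X Y d x \<in> I}"

text \<open>\<open>quotient_ainf A I\<close> is \<open>A / s\<^sup>-\<^sup>1I\<close>; the degrees in \<open>I\<close> are those of \<open>sA\<close>.\<close>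

definition quotient_ainf ::
  "('o, 'k, 'm) ainf \<Rightarrow> ('o, 'm) arrow set \<Rightarrow> ('o, 'k, 'm set) ainf" where
  "quotient_ainf A I =
     \<lparr>Ob = Ob A,
      Hom = \<lambda>X Y d. quotient_module (Hom A X Y d) (component I X Y (d - 1)),
      bop = \<lambda>xs.
        (let X = src (hd xs); Y = tgt (last xs); d = total_deg xs + 1 in
         \<Union>ys\<in>listset (map el xs).
           component I X Y d +>\<^bsub>sHom A X Y d\<^esub>
             bop A (map2 (\<lambda>x y. Arrow (src x) (tgt x) (deg x) y) xs ys))\<rparr>"

definition Q_cat ::
  "'k ring \<Rightarrow> ('o, 'k, 'm) ainf \<Rightarrow> ('o, 'k, 'm) ainf
    \<Rightarrow> ('o, 'k, ('o, 'k, 'm) tm set set) ainf" where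
  "Q_cat K C B = quotient_ainf (free_ainf K C B) (R_plus K C B)"

end

theory Submission
  imports Defs "HOL-Algebra.Free_Abelian_Groups"
begin

text \<open>
  Write \<open>i\<close> for the unit elements of \<open>C\<close>. Modulo \<open>(R\<^sub>C)\<^sub>+\<close> the maps \<open>(1 \<otimes> i) b\<^sub>2\<close> and \<open>-(i \<otimes> 1) b\<^sub>2\<close> are the
  identity on \<open>sC\<close>, and a homotopy \<open>h\<close> from the identity is defined by recursion on terms. On the right,
  \<open>h = 0\<close> on \<open>sC\<close>, \<open>b\<^sub>n h = (1\<^bsup>\<otimes>n\<^esup> \<otimes> i) b\<^bsub>n+1\<^esub> - (1\<^bsup>\<otimes>n-1\<^esup> \<otimes> h) b\<^sub>n\<close> and \<open>H h = H (1 \<otimes> i) b\<^sub>2 H - h H\<close>; the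
  equations \<open>(1\<^bsup>\<otimes>n\<^esup> \<otimes> i) b\<^bsub>n+1\<^esub> = 0\<close> in \<open>C\<close> make \<open>h\<close> preserve \<open>(R\<^sub>C)\<^sub>+\<close>. On a result \<open>(y\<^sub>1 \<otimes> \<dots> \<otimes> y\<^sub>n) b\<^sub>n\<close>
  the homotopy equation reduces to the one for \<open>y\<^sub>n\<close> by the \<open>A\<^sub>\<infinity>\<close>-relations for \<open>(y\<^sub>1, \<dots>, y\<^sub>n, i)\<close> and
  \<open>(y\<^sub>1, \<dots>, y\<^sub>n h)\<close>. The left side is symmetric. The \<open>A\<^sub>\<infinity>\<close>-relations of the quotient amount to
  \<open>b\<^sub>1 b\<^sub>1 = 0\<close>, since for \<open>n \<ge> 2\<close> they are the definition of \<open>b\<^sub>n b\<^sub>1\<close>.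
\<close>

section \<open>Decompositions of words\<close>

text \<open>The modules of the free category are given by generators, operations and a congruence,
  and no normal form of terms is used. Every map is therefore defined by recursion on terms and has
  to be shown to respect the congruence. Passing to the quotient adds a single generating rule,
  \<open>base\<close>, and (R_C)_+ is then described as the set of terms congruent to 0. Signs are
  the second obstacle: the modules have no common carrier and no type-class addition. Alternating
  sums are therefore formed in one free abelian group on all terms, where Koszul signs are integers,
  and an evaluation homomorphism carries the results back to the modules. The third point is the
  contraction of a whole word to one letter. There an operation is followed by \<open>b_1\<close>,
  which is no constructor but a recursively defined map, so this contraction obeys another formula
  than the rest. To keep all sums indexed by the same set it is either given the value 0 or included
  and subtracted again.\<close>

definition decomps :: "'a list \<Rightarrow> ('a list \<times> 'a list \<times> 'a list) set" where
  "decomps w = {(u, v, z). w = u @ v @ z \<and> v \<noteq> []}"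

definition splits :: "'a list \<Rightarrow> ('a list \<times> 'a list) set" where
  "splits w = {(u, z). w = u @ z}"

lemma finite_splits [simp]: "finite (splits w)"
proof (rule finite_subset)
  show "splits w \<subseteq> (\<lambda>i. (take i w, drop i w)) ` {..length w}"
  proof
    fix x assume "x \<in> splits w"
    then obtain u z where "x = (u, z)" "w = u @ z" by (auto simp: splits_def)
    then show "x \<in> (\<lambda>i. (take i w, drop i w)) ` {..length w}"
      by (intro image_eqI[of _ _ "length u"]) auto
  qed
qed simp

lemma take_take_drop: "take r w @ take n (drop r w) @ drop (r + n) w = w"
  by (metis append_take_drop_id drop_drop add.commute)

text \<open>Passes between factorizations of a word, which are convenient for rearranging sums, and
  the pairs of start and length by which the relations of an A-infinity category are
  indexed.\<close>

lemma sum_dec_index: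
  "(\<Sum>(u, v, z)\<in>decomps w. g u v z) =
   (\<Sum>(r, n)\<in>{(r, n). 1 \<le> n \<and> r + n \<le> length w}. g (take r w) (take n (drop r w)) (drop (r + n) w))"
  by (rule sum.reindex_bij_witness[where j = "\<lambda>(u, v, z). (length u, length v)"
        and i = "\<lambda>(r, n). (take r w, take n (drop r w), drop (r + n) w)"])
    (auto simp: decomps_def Suc_le_eq take_take_drop[symmetric, of w])

lemma finite_index: "finite {(r, n). (1::nat) \<le> n \<and> r + n \<le> k}"
  by (rule finite_subset[of _ "{..k} \<times> {..k}"]) auto

lemma finite_decomps [simp]: "finite (decomps w)"
proof (rule finite_subset)
  show "decomps w \<subseteq> (\<lambda>(i, j). (take i w, take j (drop i w), drop (i + j) w)) ` ({..length w} \<times> {..length w})"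
  proof
    fix x assume "x \<in> decomps w"
    then obtain u v z where "x = (u, v, z)" "w = u @ v @ z" by (auto simp: decomps_def)
    then show "x \<in> (\<lambda>(i, j). (take i w, take j (drop i w), drop (i + j) w)) ` ({..length w} \<times> {..length w})"
      by (intro image_eqI[of _ _ "(length u, length v)"]) auto
  qed
qed simp

text \<open>A nonempty factor of a word with a marked letter \<open>y\<close> lies before
  \<open>y\<close>, lies after \<open>y\<close>, or contains it. The linearity and homotopy
  arguments all single out one letter in this way.\<close>

lemma decomps_insert:
  "decomps (a @ y # b) = (\<lambda>(u, v, z). (u, v, z @ y # b)) ` decomps a \<union> (\<lambda>(u, v, z). (a @ y # u, v, z)) ` decomps b
     \<union> (\<lambda>((a1, a2), (b1, b2)). (a1, a2 @ y # b1, b2)) ` (splits a \<times> splits b)" (is "?L = ?A \<union> ?B \<union> ?C")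
proof
  show "?L \<subseteq> ?A \<union> ?B \<union> ?C"
  proof
    fix x assume "x \<in> ?L"
    then obtain u v z where x: "x = (u, v, z)" "a @ y # b = u @ v @ z" "v \<noteq> []" by (auto simp: decomps_def)
    consider (1) c where "a = u @ v @ c" "z = c @ y # b"
      | (2) c where "u = a @ y # c" "b = c @ v @ z"
      | (3) c d where "a = u @ c" "v = c @ y # d" "b = d @ z"
    proof -
      from x(2) obtain us where "a = u @ us \<and> us @ y # b = v @ z \<or> a @ us = u \<and> y # b = us @ v @ z"
        unfolding append_eq_append_conv2[of a] by blast
      then show thesis
      proof
        assume *: "a = u @ us \<and> us @ y # b = v @ z"
        then obtain vs where "us = v @ vs \<and> vs @ y # b = z \<or> us @ vs = v \<and> y # b = vs @ z"
          unfolding append_eq_append_conv2[of us] by blast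
        with * that show thesis by (auto simp: Cons_eq_append_conv)
      next
        assume *: "a @ us = u \<and> y # b = us @ v @ z"
        with that(2) that(3)[of "[]"] x(3) show thesis by (auto simp: Cons_eq_append_conv)
      qed
    qed
    then show "x \<in> ?A \<union> ?B \<union> ?C"
    proof cases
      case 1
      then have "x \<in> ?A" using x by (force simp: decomps_def image_iff)
      then show ?thesis by blast
    next
      case 2
      then have "x \<in> ?B" using x by (force simp: decomps_def image_iff)
      then show ?thesis by blast
    next
      case 3
      then have "x \<in> ?C" using x by (force simp: splits_def image_iff)
      then show ?thesis by blast
    qed
  qed
qed (auto simp: decomps_def splits_def)

lemma sum_dec_insert:
  fixes g :: "'a list \<Rightarrow> 'a list \<Rightarrow> 'a list \<Rightarrow> 'b::comm_monoid_add"
  shows "(\<Sum>(u, v, z)\<in>decomps (a @ y # b). g u v z) =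
    (\<Sum>(u, v, z)\<in>decomps a. g u v (z @ y # b)) + (\<Sum>(u, v, z)\<in>decomps b. g (a @ y # u) v z)
    + (\<Sum>(a1, a2)\<in>splits a. \<Sum>(b1, b2)\<in>splits b. g a1 (a2 @ y # b1) b2)"
proof -
  let ?A = "(\<lambda>(u, v, z). (u, v, z @ y # b)) ` decomps a"
  let ?B = "(\<lambda>(u, v, z). (a @ y # u, v, z)) ` decomps b"
  let ?C = "(\<lambda>((a1, a2), (b1, b2)). (a1, a2 @ y # b1, b2)) ` (splits a \<times> splits b)"
  have A: "length (fst x) < length a" "length (snd (snd x)) > length b" if "x \<in> ?A" for x
    using that by (auto simp: decomps_def)
  have B: "length (fst x) > length a" "length (snd (snd x)) < length b" if "x \<in> ?B" for x
    using that by (auto simp: decomps_def)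
  have C: "length (fst x) \<le> length a" "length (snd (snd x)) \<le> length b" if "x \<in> ?C" for x
    using that by (auto simp: splits_def)
  have AB: "?A \<inter> ?B = {}" using A(1) B(1) less_asym by blast
  have "?A \<inter> ?C = {}" "?B \<inter> ?C = {}" using A(2) B(1) C leD by blast+
  then have ABC: "(?A \<union> ?B) \<inter> ?C = {}" by blast
  have "(\<Sum>(u, v, z)\<in>decomps (a @ y # b). g u v z) = (\<Sum>(u, v, z)\<in>?A. g u v z)
      + (\<Sum>(u, v, z)\<in>?B. g u v z) + (\<Sum>(u, v, z)\<in>?C. g u v z)"
    unfolding decomps_insert
    by (subst sum.union_disjoint[OF _ _ ABC] sum.union_disjoint[OF _ _ AB];
        (intro finite_UnI finite_imageI finite_cartesian_product finite_decomps finite_splits)?)+ simp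
  also have "(\<Sum>(u, v, z)\<in>?A. g u v z) = (\<Sum>(u, v, z)\<in>decomps a. g u v (z @ y # b))"
    by (subst sum.reindex) (auto simp: inj_on_def intro!: sum.cong)
  also have "(\<Sum>(u, v, z)\<in>?B. g u v z) = (\<Sum>(u, v, z)\<in>decomps b. g (a @ y # u) v z)"
    by (subst sum.reindex) (auto simp: inj_on_def intro!: sum.cong)
  also have "(\<Sum>(u, v, z)\<in>?C. g u v z) = (\<Sum>((a1, a2), b1, b2)\<in>splits a \<times> splits b. g a1 (a2 @ y # b1) b2)"
    by (subst sum.reindex) (auto simp: inj_on_def splits_def intro!: sum.cong)
  also have "\<dots> = (\<Sum>(a1, a2)\<in>splits a. \<Sum>(b1, b2)\<in>splits b. g a1 (a2 @ y # b1) b2)"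
    by (subst sum.cartesian_product[symmetric]) (simp add: case_prod_beta)
  finally show ?thesis .
qed

section \<open>Iterated contractions: disjoint and nested factors\<close>

lemma decomps_singleton [simp]: "decomps [x] = {([], [x], [])}"
  by (auto simp: decomps_def Cons_eq_append_conv)

lemma decomps_whole [simp]: "([], w, []) \<in> decomps w \<longleftrightarrow> w \<noteq> []"
  by (simp add: decomps_def)

text \<open>Of two disjoint factors the right one is chosen first here, the left one in
  \<open>sum_dec_right\<close>. Both iterated sums are brought to the same five-part factorizations,
  so that they can be compared term by term.\<close>

lemma sum_dec_left:
  "(\<Sum>(u, v, z)\<in>decomps w. \<Sum>(a, b, c)\<in>decomps u. g a b c v z) =
   (\<Sum>(a, b, c, d, e)\<in>{(a, b, c, d, e). w = a @ b @ c @ d @ e \<and> b \<noteq> [] \<and> d \<noteq> []}. g a b c d e)"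
proof -
  have "(\<Sum>(u, v, z)\<in>decomps w. \<Sum>(a, b, c)\<in>decomps u. g a b c v z)
      = (\<Sum>((u, v, z), a, b, c)\<in>(SIGMA x:decomps w. decomps (fst x)). g a b c v z)"
    by (subst sum.Sigma[symmetric]) (auto intro!: sum.cong)
  also have "\<dots> = (\<Sum>(a, b, c, d, e)\<in>{(a, b, c, d, e). w = a @ b @ c @ d @ e \<and> b \<noteq> [] \<and> d \<noteq> []}. g a b c d e)"
    by (rule sum.reindex_bij_witness[where j = "\<lambda>((u, v, z), a, b, c). (a, b, c, v, z)"
          and i = "\<lambda>(a, b, c, d, e). ((a @ b @ c, d, e), a, b, c)"]) (auto simp: decomps_def)
  finally show ?thesis .
qed

lemma sum_dec_right:
  "(\<Sum>(u, v, z)\<in>decomps w. \<Sum>(c, d, e)\<in>decomps z. g u v c d e) =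
   (\<Sum>(a, b, c, d, e)\<in>{(a, b, c, d, e). w = a @ b @ c @ d @ e \<and> b \<noteq> [] \<and> d \<noteq> []}. g a b c d e)"
proof -
  have "(\<Sum>(u, v, z)\<in>decomps w. \<Sum>(c, d, e)\<in>decomps z. g u v c d e)
      = (\<Sum>((u, v, z), c, d, e)\<in>(SIGMA x:decomps w. decomps (snd (snd x))). g u v c d e)"
    by (subst sum.Sigma[symmetric]) (auto intro!: sum.cong)
  also have "\<dots> = (\<Sum>(a, b, c, d, e)\<in>{(a, b, c, d, e). w = a @ b @ c @ d @ e \<and> b \<noteq> [] \<and> d \<noteq> []}. g a b c d e)"
    by (rule sum.reindex_bij_witness[where j = "\<lambda>((u, v, z), c, d, e). (u, v, c, d, e)"
          and i = "\<lambda>(a, b, c, d, e). ((a, b, c @ d @ e), c, d, e)"]) (auto simp: decomps_def)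
  finally show ?thesis .
qed

text \<open>Choosing \<open>v\<close> and then enlarging it by \<open>u2\<close> on the left and
  \<open>z1\<close> on the right amounts to choosing the larger factor \<open>m\<close> and then
  \<open>v\<close> inside it.\<close>

lemma sum_dec_nested:
  "(\<Sum>(u, v, z)\<in>decomps w. \<Sum>(u1, u2)\<in>splits u. \<Sum>(z1, z2)\<in>splits z. g u1 u2 v z1 z2) =
   (\<Sum>(u1, m, z2)\<in>decomps w. \<Sum>(u2, v, z1)\<in>decomps m. g u1 u2 v z1 z2)"
proof -
  have "(\<Sum>(u, v, z)\<in>decomps w. \<Sum>(u1, u2)\<in>splits u. \<Sum>(z1, z2)\<in>splits z. g u1 u2 v z1 z2)
      = (\<Sum>(u, v, z)\<in>decomps w. \<Sum>((u1, u2), z1, z2)\<in>splits u \<times> splits z. g u1 u2 v z1 z2)"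
    by (intro sum.cong) (auto simp: sum.cartesian_product case_prod_beta)
  also have "\<dots> = (\<Sum>((u, v, z), (u1, u2), z1, z2)\<in>(SIGMA x:decomps w. splits (fst x) \<times> splits (snd (snd x))). g u1 u2 v z1 z2)"
    by (subst sum.Sigma[symmetric]) (auto intro!: sum.cong)
  also have "\<dots> = (\<Sum>((u1, m, z2), u2, v, z1)\<in>(SIGMA x:decomps w. decomps (fst (snd x))). g u1 u2 v z1 z2)"
    by (rule sum.reindex_bij_witness[where j = "\<lambda>((u, v, z), (u1, u2), z1, z2). ((u1, u2 @ v @ z1, z2), u2, v, z1)"
          and i = "\<lambda>((u1, m, z2), u2, v, z1). ((u1 @ u2, v, z1 @ z2), (u1, u2), z1, z2)"])
      (auto simp: decomps_def splits_def)
  also have "\<dots> = (\<Sum>(u1, m, z2)\<in>decomps w. \<Sum>(u2, v, z1)\<in>decomps m. g u1 u2 v z1 z2)"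
    by (subst sum.Sigma[symmetric]) (auto intro!: sum.cong)
  finally show ?thesis .
qed

lemma splits_Nil [simp]: "splits [] = {([], [])}"
  by (auto simp: splits_def)

lemma decomps_Nil [simp]: "decomps [] = {}"
  by (auto simp: decomps_def)

section \<open>Sums over words with a marked last or first letter\<close>

lemma sum_dec_snoc:
  fixes g :: "'a list \<Rightarrow> 'a list \<Rightarrow> 'a list \<Rightarrow> 'b::comm_monoid_add"
  shows "(\<Sum>(u, v, z)\<in>decomps (a @ [y]). g u v z) =
    (\<Sum>(u, v, z)\<in>decomps a. g u v (z @ [y])) + (\<Sum>(a1, a2)\<in>splits a. g a1 (a2 @ [y]) [])"
  using sum_dec_insert[of g a y "[]"] by simp

lemma sum_dec_Cons:
  fixes g :: "'a list \<Rightarrow> 'a list \<Rightarrow> 'a list \<Rightarrow> 'b::comm_monoid_add"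
  shows "(\<Sum>(u, v, z)\<in>decomps (y # b). g u v z) =
    (\<Sum>(u, v, z)\<in>decomps b. g (y # u) v z) + (\<Sum>(b1, b2)\<in>splits b. g [] (y # b1) b2)"
  using sum_dec_insert[of g "[]" y b] by simp

lemma sum_spl_snoc:
  fixes g :: "'a list \<Rightarrow> 'a list \<Rightarrow> 'b::comm_monoid_add"
  shows "(\<Sum>(a1, a2)\<in>splits (w @ [x]). g a1 a2) = (\<Sum>(a1, a2)\<in>splits w. g a1 (a2 @ [x])) + g (w @ [x]) []"
proof -
  have *: "splits (w @ [x]) = insert (w @ [x], []) ((\<lambda>(a1, a2). (a1, a2 @ [x])) ` splits w)"
  proof (intro equalityI subsetI)
    fix y assume "y \<in> splits (w @ [x])"
    then obtain a b where y: "y = (a, b)" "w @ [x] = a @ b" by (auto simp: splits_def)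
    show "y \<in> insert (w @ [x], []) ((\<lambda>(a1, a2). (a1, a2 @ [x])) ` splits w)"
    proof (cases b rule: rev_cases)
      case (snoc b' x')
      then have "y = (\<lambda>(a1, a2). (a1, a2 @ [x])) (a, b')" "(a, b') \<in> splits w" using y by (auto simp: splits_def)
      then show ?thesis by blast
    qed (use y in simp)
  qed (auto simp: splits_def)
  have "(\<Sum>(a1, a2)\<in>splits (w @ [x]). g a1 a2)
    = g (w @ [x]) [] + (\<Sum>(a1, a2)\<in>(\<lambda>(a1, a2). (a1, a2 @ [x])) ` splits w. g a1 a2)"
    unfolding * by (subst sum.insert) auto
  also have "(\<Sum>(a1, a2)\<in>(\<lambda>(a1, a2). (a1, a2 @ [x])) ` splits w. g a1 a2) = (\<Sum>(a1, a2)\<in>splits w. g a1 (a2 @ [x]))"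
    by (subst sum.reindex) (auto simp: inj_on_def intro!: sum.cong)
  finally show ?thesis by (simp add: add.commute)
qed

lemma sum_spl_Cons:
  fixes g :: "'a list \<Rightarrow> 'a list \<Rightarrow> 'b::comm_monoid_add"
  shows "(\<Sum>(b1, b2)\<in>splits (x # w). g b1 b2) = g [] (x # w) + (\<Sum>(b1, b2)\<in>splits w. g (x # b1) b2)"
proof -
  have *: "splits (x # w) = insert ([], x # w) ((\<lambda>(b1, b2). (x # b1, b2)) ` splits w)"
    by (auto simp: splits_def Cons_eq_append_conv image_iff)
  have "(\<Sum>(b1, b2)\<in>splits (x # w). g b1 b2)
    = g [] (x # w) + (\<Sum>(b1, b2)\<in>(\<lambda>(b1, b2). (x # b1, b2)) ` splits w. g b1 b2)"
    unfolding * by (subst sum.insert) auto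
  also have "(\<Sum>(b1, b2)\<in>(\<lambda>(b1, b2). (x # b1, b2)) ` splits w. g b1 b2) = (\<Sum>(b1, b2)\<in>splits w. g (x # b1) b2)"
    by (subst sum.reindex) (auto simp: inj_on_def intro!: sum.cong)
  finally show ?thesis .
qed

text \<open>Exactly one splitting has an empty first part and exactly one an empty second part.
  Corrections attached to these exceptional splittings leave a sum in this way.\<close>

lemma sum_spl_delta:
  fixes c :: "'b::comm_monoid_add" and w :: "'a list"
  shows "(\<Sum>(a1, a2)\<in>splits w. if a1 = [] then c else 0) = c" "(\<Sum>(a1, a2)\<in>splits w. if a2 = [] then c else 0) = c"
proof -
  have "(\<Sum>(a1, a2)\<in>splits w. if a1 = [] then c else 0) = (\<Sum>(a1, a2)\<in>{([] :: 'a list, w)}. c)"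
    by (rule sum.mono_neutral_cong_right[OF finite_splits]) (auto simp: splits_def split: if_splits)
  then show "(\<Sum>(a1, a2)\<in>splits w. if a1 = [] then c else 0) = c" by simp
  have "(\<Sum>(a1, a2)\<in>splits w. if a2 = [] then c else 0) = (\<Sum>(a1, a2)\<in>{(w, [] :: 'a list)}. c)"
    by (rule sum.mono_neutral_cong_right[OF finite_splits]) (auto simp: splits_def split: if_splits)
  then show "(\<Sum>(a1, a2)\<in>splits w. if a2 = [] then c else 0) = c" by simp
qed

locale quotient_construction = ainf_category K C
  for K :: "'k ring" and C :: "('o, 'k, 'm) ainf" +
  fixes B :: "('o, 'k, 'm) ainf"
begin

abbreviation "wft \<equiv> wf_tm K C B"
abbreviation "tms \<equiv> terms K C B"

definition gen :: "('o, 'm) arrow \<Rightarrow> ('o, 'k, 'm) tm" where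
  "gen x = TGen (src x) (tgt x) (deg x) (el x)"

section \<open>Terms and paths\<close>

text \<open>Both endpoints are arguments so that empty words are typed as well, between equal
  objects. A path can then be cut at any place, and the parts before and after a contracted factor
  need no case distinction.\<close>

fun path :: "'o \<Rightarrow> ('o, 'k, 'm) tm list \<Rightarrow> 'o \<Rightarrow> bool" where
  "path X [] Y \<longleftrightarrow> X = Y"
| "path X (t # ts) Y \<longleftrightarrow> wft t \<and> tm_src t = X \<and> path (tm_tgt t) ts Y"

abbreviation ldeg :: "('o, 'k, 'm) tm list \<Rightarrow> int" where
  "ldeg ts \<equiv> sum_list (map tm_deg ts)"

lemma path_append [simp]: "path X (us @ vs) Y \<longleftrightarrow> (\<exists>Z. path X us Z \<and> path Z vs Y)"
  by (induction us arbitrary: X) auto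

lemma path_endpoints: "path X ts Y \<Longrightarrow> ts \<noteq> [] \<Longrightarrow> tm_src (hd ts) = X \<and> tm_tgt (last ts) = Y"
  by (induction ts arbitrary: X) (auto split: if_splits)

lemma path_iff:
  assumes "ts \<noteq> []"
  shows "path X ts Y \<longleftrightarrow> (\<forall>t\<in>set ts. wft t) \<and> successively (\<lambda>t u. tm_tgt t = tm_src u) ts
     \<and> X = tm_src (hd ts) \<and> Y = tm_tgt (last ts)"
  using assms by (induction ts arbitrary: X rule: list_nonempty_induct) (auto simp: successively_Cons)

lemma wft_TB_iff: "wft (TB ts) \<longleftrightarrow> length ts \<ge> 2 \<and> (\<exists>X Y. path X ts Y)"
  by (cases "ts = []") (auto simp: path_iff)

lemma src_TB: "path X ts Y \<Longrightarrow> ts \<noteq> [] \<Longrightarrow> tm_src (TB ts) = X"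
  and tgt_TB: "path X ts Y \<Longrightarrow> ts \<noteq> [] \<Longrightarrow> tm_tgt (TB ts) = Y"
  using path_endpoints[of X ts Y] by (auto simp: hd_map last_map)

lemma wft_TB: "path X ts Y \<Longrightarrow> length ts \<ge> 2 \<Longrightarrow> wft (TB ts) \<and> tm_src (TB ts) = X \<and> tm_tgt (TB ts) = Y"
  by (intro conjI; (rule src_TB tgt_TB | subst wft_TB_iff); force)

lemma wft_TBE:
  assumes "wft (TB ts)"
  obtains X Y where "length ts \<ge> 2" "path X ts Y" "tm_src (TB ts) = X" "tm_tgt (TB ts) = Y"
proof -
  obtain X Y where "length ts \<ge> 2" "path X ts Y" using assms wft_TB_iff by blast
  with wft_TB that show thesis by blast
qed

text \<open>From here on the type of a \<open>TB\<close> term is read off from a path instead of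
  \<open>hd\<close> and \<open>last\<close>.\<close>

declare wf_tm.simps(5) [simp del] tm_src.simps(5) [simp del] tm_tgt.simps(5) [simp del]

lemma wft_Ob: "wft t \<Longrightarrow> tm_src t \<in> Ob C \<and> tm_tgt t \<in> Ob C"
proof (induction t)
  case (TB ts)
  then obtain X Y where *: "length ts \<ge> 2" "path X ts Y" "tm_src (TB ts) = X" "tm_tgt (TB ts) = Y"
    by (elim wft_TBE)
  then have ne: "ts \<noteq> []" by auto
  then have "wft (hd ts)" "wft (last ts)" using * path_iff[of ts X Y] by auto
  moreover have "tm_src (hd ts) = X" "tm_tgt (last ts) = Y" using path_endpoints * ne by blast+
  ultimately show ?case using TB.IH[of "hd ts"] TB.IH[of "last ts"] ne *(3,4) by simp
qed auto

lemma path_Ob: "path X ts Y \<Longrightarrow> ts \<noteq> [] \<Longrightarrow> X \<in> Ob C \<and> Y \<in> Ob C"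
  using path_iff[of ts X Y] wft_Ob by simp

lemma minus_one_closed [simp]: "\<ominus>\<^bsub>K\<^esub> \<one>\<^bsub>K\<^esub> \<in> carrier K"
  by (simp add: base_ring cring.cring_simprules(3,6))

lemma one_K_closed [simp]: "\<one>\<^bsub>K\<^esub> \<in> carrier K"
  by (simp add: base_ring cring.cring_simprules(6))

lemma wft_tneg [simp]: "wft (tneg K t) \<longleftrightarrow> wft t"
  and src_tneg [simp]: "tm_src (tneg K t) = tm_src t"
  and tgt_tneg [simp]: "tm_tgt (tneg K t) = tm_tgt t"
  and deg_tneg [simp]: "tm_deg (tneg K t) = tm_deg t"
  and in_P_tneg [simp]: "in_P (tneg K t) = in_P t"
  by (auto simp: tneg_def)

lemma tsign_simps [simp]:
  "wft (tsign K e t) \<longleftrightarrow> wft t" "tm_src (tsign K e t) = tm_src t" "tm_tgt (tsign K e t) = tm_tgt t"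
  "tm_deg (tsign K e t) = tm_deg t" "in_P (tsign K e t) = in_P t"
  by (auto simp: tsign_def)

lemma sHom_module: "X \<in> Ob C \<Longrightarrow> Y \<in> Ob C \<Longrightarrow> module K (sHom C X Y d)"
  by (simp add: sHom_def Hom_module)

lemma composable_path:
  "composable C xs \<longleftrightarrow> xs \<noteq> [] \<and> path (src (hd xs)) (map gen xs) (tgt (last xs))"
proof (cases "xs = []")
  case False
  have "successively (\<lambda>t u. tm_tgt t = tm_src u) (map gen xs) \<longleftrightarrow> successively (\<lambda>x y. tgt x = src y) xs"
    by (simp add: successively_map gen_def)
  with False show ?thesis
    by (auto simp: composable_def path_iff gen_def arrows_def hd_map last_map)
qed (simp add: composable_def)

lemma ldeg_gen [simp]: "sum_list (map (tm_deg \<circ> gen) xs) = total_deg xs"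
  by (simp add: total_deg_def gen_def o_def)

section \<open>Congruences on terms\<close>

text \<open>
  \<open>geq False\<close> is \<open>tm_eq\<close>. The additional rule \<open>base\<close> makes \<open>geq True\<close> the congruence on terms whose
  classes are the elements of the quotient by \<open>(R\<^sub>C)\<^sub>+\<close>; most facts are proved for both at once.
\<close>

inductive geq :: "bool \<Rightarrow> ('o, 'k, 'm) tm \<Rightarrow> ('o, 'k, 'm) tm \<Rightarrow> bool" for f where
  refl: "wft t \<Longrightarrow> geq f t t"
| sym: "geq f t u \<Longrightarrow> geq f u t"
| trans: "geq f t u \<Longrightarrow> geq f u v \<Longrightarrow> geq f t v"
| cong_add: "geq f t t' \<Longrightarrow> geq f u u' \<Longrightarrow> wft (TAdd t u) \<Longrightarrow> geq f (TAdd t u) (TAdd t' u')"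
| cong_smult: "geq f t t' \<Longrightarrow> r \<in> carrier K \<Longrightarrow> geq f (TSmult r t) (TSmult r t')"
| cong_b: "geq f t t' \<Longrightarrow> wft (TB (us @ t # vs)) \<Longrightarrow> geq f (TB (us @ t # vs)) (TB (us @ t' # vs))"
| cong_H: "geq f t t' \<Longrightarrow> wft (TH t) \<Longrightarrow> wft (TH t') \<Longrightarrow> geq f (TH t) (TH t')"
| add_assoc: "wft (TAdd (TAdd t u) v) \<Longrightarrow> geq f (TAdd (TAdd t u) v) (TAdd t (TAdd u v))"
| add_comm: "wft (TAdd t u) \<Longrightarrow> geq f (TAdd t u) (TAdd u t)"
| add_zero: "wft t \<Longrightarrow> geq f (TAdd t (TZero (tm_src t) (tm_tgt t) (tm_deg t))) t"
| add_neg: "wft t \<Longrightarrow> geq f (TAdd t (tneg K t)) (TZero (tm_src t) (tm_tgt t) (tm_deg t))"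
| smult_l_distr: "r \<in> carrier K \<Longrightarrow> r' \<in> carrier K \<Longrightarrow> wft t \<Longrightarrow>
    geq f (TSmult (r \<oplus>\<^bsub>K\<^esub> r') t) (TAdd (TSmult r t) (TSmult r' t))"
| smult_r_distr: "r \<in> carrier K \<Longrightarrow> wft (TAdd t u) \<Longrightarrow>
    geq f (TSmult r (TAdd t u)) (TAdd (TSmult r t) (TSmult r u))"
| smult_assoc: "r \<in> carrier K \<Longrightarrow> r' \<in> carrier K \<Longrightarrow> wft t \<Longrightarrow>
    geq f (TSmult (r \<otimes>\<^bsub>K\<^esub> r') t) (TSmult r (TSmult r' t))"
| smult_one: "wft t \<Longrightarrow> geq f (TSmult \<one>\<^bsub>K\<^esub> t) t"
| gen_add: "wft (TGen X Y d m) \<Longrightarrow> wft (TGen X Y d m') \<Longrightarrow>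
    geq f (TGen X Y d (m \<oplus>\<^bsub>sHom C X Y d\<^esub> m')) (TAdd (TGen X Y d m) (TGen X Y d m'))"
| gen_smult: "r \<in> carrier K \<Longrightarrow> wft (TGen X Y d m) \<Longrightarrow>
    geq f (TGen X Y d (r \<odot>\<^bsub>sHom C X Y d\<^esub> m)) (TSmult r (TGen X Y d m))"
| b_add: "wft (TB (us @ TAdd t u # vs)) \<Longrightarrow>
    geq f (TB (us @ TAdd t u # vs)) (TAdd (TB (us @ t # vs)) (TB (us @ u # vs)))"
| b_smult: "wft (TB (us @ TSmult r t # vs)) \<Longrightarrow>
    geq f (TB (us @ TSmult r t # vs)) (TSmult r (TB (us @ t # vs)))"
| H_add: "wft (TH (TAdd t u)) \<Longrightarrow> geq f (TH (TAdd t u)) (TAdd (TH t) (TH u))"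
| H_smult: "wft (TH (TSmult r t)) \<Longrightarrow> geq f (TH (TSmult r t)) (TSmult r (TH t))"
| base: "f \<Longrightarrow> composable C xs \<Longrightarrow> length xs \<ge> 2 \<Longrightarrow> geq f (TB (map gen xs)) (gen (barrow C xs))"

lemma wft_TB_replace:
  assumes "wft (TB (us @ t # vs))" "wft t'" "tm_src t' = tm_src t" "tm_tgt t' = tm_tgt t"
  shows "wft (TB (us @ t' # vs)) \<and> tm_src (TB (us @ t' # vs)) = tm_src (TB (us @ t # vs))
    \<and> tm_tgt (TB (us @ t' # vs)) = tm_tgt (TB (us @ t # vs))"
proof -
  obtain X Y where "length (us @ t # vs) \<ge> 2" "path X (us @ t # vs) Y"
    "tm_src (TB (us @ t # vs)) = X" "tm_tgt (TB (us @ t # vs)) = Y"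
    using assms(1) by (elim wft_TBE)
  moreover then have "path X (us @ t' # vs) Y" "length (us @ t' # vs) \<ge> 2" using assms by auto
  ultimately show ?thesis using wft_TB[of X "us @ t' # vs" Y] by simp
qed

lemma wft_TB_slot: "wft (TB (us @ t # vs)) \<Longrightarrow> wft t"
  by (auto elim!: wft_TBE)

lemma wft_gen_barrow: "composable C xs \<Longrightarrow> wft (gen (barrow C xs))"
  using bop_closed[of xs] path_Ob[of "src (hd xs)" "map gen xs" "tgt (last xs)"] composable_path[of xs]
  by (auto simp: gen_def barrow_def)

lemma geq_wft:
  assumes "geq f t u"
  shows "wft t \<and> wft u \<and> tm_src t = tm_src u \<and> tm_tgt t = tm_tgt u \<and> tm_deg t = tm_deg u"
  using assms
proof induction
  case (cong_b t t' us vs)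
  then show ?case using wft_TB_replace[of us t vs t'] by auto
next
  case (b_add us t u vs)
  then have *: "wft (TAdd t u)" using wft_TB_slot by blast
  then show ?case using wft_TB_replace[OF b_add, of t] wft_TB_replace[OF b_add, of u] b_add by auto
next
  case (b_smult us r t vs)
  then have *: "wft (TSmult r t)" using wft_TB_slot by blast
  then show ?case using wft_TB_replace[OF b_smult, of t] b_smult by auto
next
  case (base xs)
  then show ?case using composable_path[of xs] wft_TB[of "src (hd xs)" "map gen xs" "tgt (last xs)"]
      wft_gen_barrow[of xs] by (auto simp: barrow_def) (auto simp: gen_def)
next
  case (gen_add X Y d m m')
  then interpret module K "sHom C X Y d" using sHom_module by auto
  show ?case using gen_add by auto
next
  case (gen_smult r X Y d m)
  then interpret module K "sHom C X Y d" using sHom_module by auto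
  show ?case using gen_smult by auto
next
  case (smult_l_distr r r' t)
  then show ?case using cring.cring_simprules(1)[OF base_ring] by auto
next
  case (smult_assoc r r' t)
  then show ?case using cring.cring_simprules(5)[OF base_ring] by auto
qed (auto dest: wft_Ob)

lemma geq_False_imp_tm_eq: "geq False t u \<Longrightarrow> tm_eq K C B t u"
  by (induction rule: geq.induct; (erule FalseE | (rule tm_eq.intros; assumption)))

lemma tm_eq_imp_geq: "tm_eq K C B t u \<Longrightarrow> geq f t u"
  by (induction rule: tm_eq.induct; (rule geq.intros; assumption))

lemma geq_False: "geq False t u \<longleftrightarrow> tm_eq K C B t u"
  using geq_False_imp_tm_eq tm_eq_imp_geq by blast

lemma geq_mono: "geq False t u \<Longrightarrow> geq f t u"
  using geq_False tm_eq_imp_geq by blast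

section \<open>Modules of classes of terms\<close>

lemma in_terms_iff: "t \<in> tms X Y d \<longleftrightarrow> wft t \<and> tm_src t = X \<and> tm_tgt t = Y \<and> tm_deg t = d"
  by (simp add: terms_def)

lemma geq_terms: "geq f t u \<Longrightarrow> t \<in> tms X Y d \<longleftrightarrow> u \<in> tms X Y d"
  using geq_wft[of f t u] by (auto simp: in_terms_iff)

lemma TAdd_in_terms [simp]: "t \<in> tms X Y d \<Longrightarrow> u \<in> tms X Y d \<Longrightarrow> TAdd t u \<in> tms X Y d"
  and TSmult_in_terms [simp]: "t \<in> tms X Y d \<Longrightarrow> r \<in> carrier K \<Longrightarrow> TSmult r t \<in> tms X Y d"
  and TZero_in_terms [simp]: "TZero X Y d \<in> tms X Y d \<longleftrightarrow> X \<in> Ob C \<and> Y \<in> Ob C"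
  and tneg_in_terms [simp]: "tneg K t \<in> tms X Y d \<longleftrightarrow> t \<in> tms X Y d"
  by (auto simp: in_terms_iff)

text \<open>Common interface to the modules of classes of terms and to the cosets modulo (R_C)_+,
  with \<pi> in the role of the projection from terms. What follows from the rules of
  \<open>geq\<close> is proved from this predicate alone and then holds for the free category and
  for the quotient.\<close>

definition represents ::
  "bool \<Rightarrow> 'o \<Rightarrow> 'o \<Rightarrow> int \<Rightarrow> ('k, 'e) module \<Rightarrow> (('o, 'k, 'm) tm \<Rightarrow> 'e) \<Rightarrow> bool" where
  "represents f X Y d M \<pi> \<longleftrightarrow>
     carrier M = \<pi> ` tms X Y d \<and> \<zero>\<^bsub>M\<^esub> = \<pi> (TZero X Y d) \<and>
     (\<forall>t\<in>tms X Y d. \<forall>u\<in>tms X Y d. \<pi> t \<oplus>\<^bsub>M\<^esub> \<pi> u = \<pi> (TAdd t u)) \<and>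
     (\<forall>r\<in>carrier K. \<forall>t\<in>tms X Y d. r \<odot>\<^bsub>M\<^esub> \<pi> t = \<pi> (TSmult r t)) \<and>
     (\<forall>t\<in>tms X Y d. \<forall>u\<in>tms X Y d. \<pi> t = \<pi> u \<longleftrightarrow> geq f t u)"

lemma representsD:
  assumes "represents f X Y d M \<pi>"
  shows "carrier M = \<pi> ` tms X Y d" "\<zero>\<^bsub>M\<^esub> = \<pi> (TZero X Y d)"
    "t \<in> tms X Y d \<Longrightarrow> u \<in> tms X Y d \<Longrightarrow> \<pi> t \<oplus>\<^bsub>M\<^esub> \<pi> u = \<pi> (TAdd t u)"
    "r \<in> carrier K \<Longrightarrow> t \<in> tms X Y d \<Longrightarrow> r \<odot>\<^bsub>M\<^esub> \<pi> t = \<pi> (TSmult r t)"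
    "t \<in> tms X Y d \<Longrightarrow> u \<in> tms X Y d \<Longrightarrow> \<pi> t = \<pi> u \<longleftrightarrow> geq f t u"
  using assms by (auto simp: represents_def)

lemma represents_abelian_group:
  assumes M: "represents f X Y d M \<pi>" and XY: "X \<in> Ob C" "Y \<in> Ob C"
  shows "abelian_group M"
proof -
  note [simp] = representsD[OF M]
  have comm: "\<pi> (TAdd t u) = \<pi> (TAdd u t)" if "t \<in> tms X Y d" "u \<in> tms X Y d" for t u
    using that geq.add_comm[of t u f] by (simp add: in_terms_iff)
  show ?thesis
  proof (rule abelian_groupI)
    fix x y z
    assume "x \<in> carrier M" "y \<in> carrier M" "z \<in> carrier M"
    then obtain t u v where *: "t \<in> tms X Y d" "u \<in> tms X Y d" "v \<in> tms X Y d"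
      "x = \<pi> t" "y = \<pi> u" "z = \<pi> v" by auto
    then show "(x \<oplus>\<^bsub>M\<^esub> y) \<oplus>\<^bsub>M\<^esub> z = x \<oplus>\<^bsub>M\<^esub> (y \<oplus>\<^bsub>M\<^esub> z)"
      using geq.add_assoc[of t u v f] by (simp add: in_terms_iff)
  next
    fix x assume "x \<in> carrier M"
    then obtain t where *: "t \<in> tms X Y d" "x = \<pi> t" by auto
    have "\<pi> (TAdd t (TZero X Y d)) = \<pi> t"
      using * XY geq.add_zero[of t f] by (simp add: in_terms_iff)
    then show "\<zero>\<^bsub>M\<^esub> \<oplus>\<^bsub>M\<^esub> x = x"
      using * XY comm[of "TZero X Y d" t] representsD(3)[OF M, of "TZero X Y d" t] by (simp del: representsD(5)[OF M])
    have n: "\<pi> (TAdd t (tneg K t)) = \<pi> (TZero X Y d)"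
      using * XY geq.add_neg[of t f] by (simp add: in_terms_iff)
    then have "\<pi> (tneg K t) \<oplus>\<^bsub>M\<^esub> x = \<zero>\<^bsub>M\<^esub>"
      using * XY comm[of "tneg K t" t] by (simp del: representsD(5)[OF M])
    then show "\<exists>y\<in>carrier M. y \<oplus>\<^bsub>M\<^esub> x = \<zero>\<^bsub>M\<^esub>"
      using * by (intro bexI[of _ "\<pi> (tneg K t)"]) auto
  next
    fix x y assume "x \<in> carrier M" "y \<in> carrier M"
    then show "x \<oplus>\<^bsub>M\<^esub> y = y \<oplus>\<^bsub>M\<^esub> x" using comm by auto
  qed (use XY in auto)
qed

lemma represents_module:
  assumes M: "represents f X Y d M \<pi>" and XY: "X \<in> Ob C" "Y \<in> Ob C"
  shows "module K M"
proof (rule moduleI)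
  interpret K: cring K by (rule base_ring)
  note [simp] = representsD[OF M]
  fix a b x y
  assume "a \<in> carrier K" "b \<in> carrier K" "x \<in> carrier M" "y \<in> carrier M"
  then obtain t u where *: "a \<in> carrier K" "b \<in> carrier K" "t \<in> tms X Y d" "u \<in> tms X Y d"
      "x = \<pi> t" "y = \<pi> u" by auto
  show "(a \<oplus>\<^bsub>K\<^esub> b) \<odot>\<^bsub>M\<^esub> x = a \<odot>\<^bsub>M\<^esub> x \<oplus>\<^bsub>M\<^esub> b \<odot>\<^bsub>M\<^esub> x"
    using * geq.smult_l_distr[of a b t f] by (simp add: in_terms_iff)
  show "a \<odot>\<^bsub>M\<^esub> (x \<oplus>\<^bsub>M\<^esub> y) = a \<odot>\<^bsub>M\<^esub> x \<oplus>\<^bsub>M\<^esub> a \<odot>\<^bsub>M\<^esub> y"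
    using * geq.smult_r_distr[of a t u f] by (simp add: in_terms_iff)
  show "a \<otimes>\<^bsub>K\<^esub> b \<odot>\<^bsub>M\<^esub> x = a \<odot>\<^bsub>M\<^esub> (b \<odot>\<^bsub>M\<^esub> x)"
    using * geq.smult_assoc[of a b t f] by (simp add: in_terms_iff)
qed (use represents_abelian_group[OF M XY] base_ring representsD[OF M] geq.smult_one
     in \<open>auto simp: in_terms_iff\<close>)

lemma represents_neg:
  assumes M: "represents f X Y d M \<pi>" and t: "t \<in> tms X Y d"
  shows "\<ominus>\<^bsub>M\<^esub> \<pi> t = \<pi> (tneg K t)"
proof -
  have XY: "X \<in> Ob C" "Y \<in> Ob C" using t wft_Ob by (auto simp: in_terms_iff)
  interpret M: abelian_group M by (rule represents_abelian_group[OF M XY])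
  note [simp] = representsD[OF M]
  have "\<pi> (tneg K t) \<oplus>\<^bsub>M\<^esub> \<pi> t = \<zero>\<^bsub>M\<^esub>"
    using t XY geq.add_neg[of t f] geq.trans[OF geq.add_comm[of "tneg K t" t f]] by (simp add: in_terms_iff)
  then show ?thesis using M.minus_equality[of "\<pi> (tneg K t)" "\<pi> t"] t by simp
qed

definition tm_class :: "bool \<Rightarrow> ('o, 'k, 'm) tm \<Rightarrow> ('o, 'k, 'm) tm set" where
  "tm_class f t = {u. geq f t u}"

text \<open>At \<open>False\<close> these are the modules of the free category. At
  \<open>True\<close> it is an auxiliary model that detects \<open>geq True\<close>; the elements of
  the quotient category itself are cosets, one set level higher.\<close>

definition class_module :: "bool \<Rightarrow> 'o \<Rightarrow> 'o \<Rightarrow> int \<Rightarrow> ('k, ('o, 'k, 'm) tm set) module" where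
  "class_module f X Y d =
     \<lparr>carrier = tm_class f ` tms X Y d, mult = undefined, one = undefined,
      ring.zero = tm_class f (TZero X Y d),
      ring.add = \<lambda>c c'. \<Union>t\<in>c. \<Union>u\<in>c'. tm_class f (TAdd t u),
      smult = \<lambda>r c. \<Union>t\<in>c. tm_class f (TSmult r t)\<rparr>"

lemma tm_class_eq_iff: "wft t \<Longrightarrow> tm_class f t = tm_class f u \<longleftrightarrow> geq f t u"
  unfolding tm_class_def using geq.refl geq.sym geq.trans by blast

lemma UN_gcl:
  assumes "wft t" "\<And>u. geq f t u \<Longrightarrow> F u = F t"
  shows "(\<Union>u\<in>tm_class f t. F u) = F t"
proof -
  have "t \<in> tm_class f t" using assms(1) by (simp add: tm_class_def geq.refl)
  then have "(\<Union>u\<in>tm_class f t. F u) = (\<Union>u\<in>tm_class f t. F t)"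
    by (intro SUP_cong) (auto simp only: tm_class_def mem_Collect_eq intro!: assms(2))
  with \<open>t \<in> tm_class f t\<close> show ?thesis by auto
qed

lemma geq_TAdd: "geq f t t' \<Longrightarrow> geq f u u' \<Longrightarrow> t \<in> tms X Y d \<Longrightarrow> u \<in> tms X Y d \<Longrightarrow>
    geq f (TAdd t u) (TAdd t' u')"
  by (rule geq.cong_add) (auto simp: in_terms_iff)

lemma represents_gmod: "represents f X Y d (class_module f X Y d) (tm_class f)"
  unfolding represents_def
proof (intro conjI ballI)
  fix t u assume *: "t \<in> tms X Y d" "u \<in> tms X Y d"
  have "(\<Union>t'\<in>tm_class f t. \<Union>u'\<in>tm_class f u. tm_class f (TAdd t' u')) = (\<Union>u'\<in>tm_class f u. tm_class f (TAdd t u'))"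
  proof (rule UN_gcl)
    fix t' assume t': "geq f t t'"
    have "tm_class f (TAdd t' u') = tm_class f (TAdd t u')" if "u' \<in> tm_class f u" for u'
    proof -
      have "geq f (TAdd t u') (TAdd t' u')"
        using that t' * geq_TAdd[of f t t' u' u' X Y d] geq_terms[of f u u'] geq_wft[of f u u']
        by (auto simp: tm_class_def intro: geq.refl)
      then show ?thesis using tm_class_eq_iff geq_wft by blast
    qed
    then show "(\<Union>u'\<in>tm_class f u. tm_class f (TAdd t' u')) = (\<Union>u'\<in>tm_class f u. tm_class f (TAdd t u'))" by simp
  qed (use * in \<open>auto simp: in_terms_iff\<close>)
  also have "\<dots> = tm_class f (TAdd t u)"
  proof (rule UN_gcl)
    fix u' assume "geq f u u'"
    then have "geq f (TAdd t u) (TAdd t u')"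
      using * geq_TAdd[of f t t u u' X Y d] by (auto simp: in_terms_iff intro: geq.refl)
    then show "tm_class f (TAdd t u') = tm_class f (TAdd t u)" using tm_class_eq_iff geq_wft by blast
  qed (use * in \<open>auto simp: in_terms_iff\<close>)
  finally show "tm_class f t \<oplus>\<^bsub>class_module f X Y d\<^esub> tm_class f u = tm_class f (TAdd t u)" by (simp add: class_module_def)
next
  fix r t assume *: "r \<in> carrier K" "t \<in> tms X Y d"
  have "(\<Union>t'\<in>tm_class f t. tm_class f (TSmult r t')) = tm_class f (TSmult r t)"
  proof (rule UN_gcl)
    fix t' assume "geq f t t'"
    then have "geq f (TSmult r t) (TSmult r t')" using * by (auto intro: geq.cong_smult)
    then show "tm_class f (TSmult r t') = tm_class f (TSmult r t)" using tm_class_eq_iff geq_wft by blast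
  qed (use * in \<open>auto simp: in_terms_iff\<close>)
  then show "r \<odot>\<^bsub>class_module f X Y d\<^esub> tm_class f t = tm_class f (TSmult r t)" by (simp add: class_module_def)
qed (auto simp: class_module_def tm_class_eq_iff in_terms_iff)

section \<open>Integral combinations of terms\<close>

text \<open>
  Signed sums are computed in the free abelian group on all terms, a type-class group, modulo the
  subgroup \<open>null_combs f\<close> of combinations that vanish in the modules of classes.
\<close>

inductive_set null_combs :: "bool \<Rightarrow> (('o, 'k, 'm) tm \<Rightarrow>\<^sub>0 int) set" for f where
  zero: "0 \<in> null_combs f"
| diff: "x \<in> null_combs f \<Longrightarrow> y \<in> null_combs f \<Longrightarrow> x - y \<in> null_combs f"
| geq: "geq f t u \<Longrightarrow> frag_of t - frag_of u \<in> null_combs f"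
| add: "wft (TAdd t u) \<Longrightarrow> frag_of (TAdd t u) - (frag_of t + frag_of u) \<in> null_combs f"

definition eqv :: "bool \<Rightarrow> (('o, 'k, 'm) tm \<Rightarrow>\<^sub>0 int) \<Rightarrow> (('o, 'k, 'm) tm \<Rightarrow>\<^sub>0 int) \<Rightarrow> bool" where
  "eqv f x y \<longleftrightarrow> x - y \<in> null_combs f"

lemma null_combs_minus: "x \<in> null_combs f \<Longrightarrow> - x \<in> null_combs f"
  using null_combs.diff[OF null_combs.zero, of x f] by simp

lemma null_combs_add: "x \<in> null_combs f \<Longrightarrow> y \<in> null_combs f \<Longrightarrow> x + y \<in> null_combs f"
  using null_combs.diff[of x f "- y"] null_combs_minus by simp

lemma eqv_refl [simp]: "eqv f x x"
  by (simp add: eqv_def null_combs.zero)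

lemma eqv_sym: "eqv f x y \<Longrightarrow> eqv f y x"
  unfolding eqv_def using null_combs_minus[of "x - y"] by simp

lemma eqv_trans [trans]: "eqv f x y \<Longrightarrow> eqv f y z \<Longrightarrow> eqv f x z"
  unfolding eqv_def using null_combs_add[of "x - y" f "y - z"] by simp

lemma eqv_add: "eqv f x y \<Longrightarrow> eqv f x' y' \<Longrightarrow> eqv f (x + x') (y + y')"
  unfolding eqv_def using null_combs_add[of "x - y" f "x' - y'"] by (simp add: algebra_simps)

lemma eqv_minus: "eqv f x y \<Longrightarrow> eqv f (- x) (- y)"
  unfolding eqv_def using null_combs_minus[of "x - y"] by (simp add: algebra_simps)

lemma eqv_diff: "eqv f x y \<Longrightarrow> eqv f x' y' \<Longrightarrow> eqv f (x - x') (y - y')"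
  using eqv_add[of f x y "- x'" "- y'"] eqv_minus by simp

lemma frag_cmul_diff: "frag_cmul c (x - y) = frag_cmul c x - frag_cmul c y"
  by (intro poly_mapping_eqI) (simp add: lookup_minus right_diff_distrib)

lemma frag_cmul_minus: "frag_cmul c (- x) = - frag_cmul c x"
  by (intro poly_mapping_eqI) simp

lemma eqv_cmul: "eqv f x y \<Longrightarrow> eqv f (frag_cmul c x) (frag_cmul c y)"
  unfolding eqv_def
  using frag_closure_minus_cmul[of "\<lambda>z. z \<in> null_combs f" "x - y" c] null_combs.zero null_combs.diff
  by (simp add: frag_cmul_diff)

lemma eqv_sum: "(\<And>i. i \<in> I \<Longrightarrow> eqv f (x i) (y i)) \<Longrightarrow> eqv f (sum x I) (sum y I)"
  by (induction I rule: infinite_finite_induct) (auto intro: eqv_add)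

lemma eqv_sum_list: "(\<And>i. i \<in> set L \<Longrightarrow> eqv f (x i) (y i)) \<Longrightarrow> eqv f (sum_list (map x L)) (sum_list (map y L))"
  by (induction L) (auto intro: eqv_add)

text \<open>Allows a map given on terms, such as an insertion into a word or a homotopy, to be
  applied to a whole signed sum. It suffices to test it on the two kinds of generators of
  \<open>null_combs\<close>.\<close>

lemma eqv_extend:
  assumes "eqv f x y" "\<And>t u. geq f t u \<Longrightarrow> eqv f' (g t) (g u)"
    "\<And>t u. wft (TAdd t u) \<Longrightarrow> eqv f' (g (TAdd t u)) (g t + g u)"
  shows "eqv f' (frag_extend g x) (frag_extend g y)"
proof -
  have "frag_extend g z \<in> null_combs f'" if "z \<in> null_combs f" for z
    using that
    by induction (use assms(2,3) in \<open>auto simp: frag_extend_diff frag_extend_add eqv_def null_combs.zero null_combs.diff\<close>)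
  from this[of "x - y"] assms(1) show ?thesis by (simp add: eqv_def frag_extend_diff)
qed

text \<open>Evaluation of signed sums in a module of fixed type, a term of any other type going to
  0. Congruent terms have the same type, and so do a well-formed sum and its summands; hence null
  combinations are sent to 0 even if they mix types.\<close>

lemma represents_ev:
  assumes M: "represents f X Y d M \<pi>" and XY: "X \<in> Ob C" "Y \<in> Ob C"
  shows "\<exists>ev. (\<forall>x. ev x \<in> carrier M) \<and> (\<forall>x y. ev (x + y) = ev x \<oplus>\<^bsub>M\<^esub> ev y) \<and>
    (\<forall>x. ev (- x) = \<ominus>\<^bsub>M\<^esub> ev x) \<and> ev 0 = \<zero>\<^bsub>M\<^esub> \<and>
    (\<forall>t\<in>tms X Y d. ev (frag_of t) = \<pi> t) \<and> (\<forall>x\<in>null_combs f. ev x = \<zero>\<^bsub>M\<^esub>)"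
proof -
  interpret M: abelian_group M by (rule represents_abelian_group[OF M XY])
  note R = representsD[OF M]
  obtain h where h: "h \<in> hom (free_Abelian_group UNIV) (add_monoid M)"
    and hf: "\<And>t. h (frag_of t) = (if t \<in> tms X Y d then \<pi> t else \<zero>\<^bsub>M\<^esub>)"
  proof (rule comm_group.free_Abelian_group_universal[OF M.a_comm_group,
        of "\<lambda>t. if t \<in> tms X Y d then \<pi> t else \<zero>\<^bsub>M\<^esub>" UNIV])
    show "(\<lambda>t. if t \<in> tms X Y d then \<pi> t else \<zero>\<^bsub>M\<^esub>) ` UNIV \<subseteq> carrier (add_monoid M)"
      using R(1) M.zero_closed by auto
  qed auto
  have closed: "h x \<in> carrier M" for x using h by (auto simp: hom_def)
  have add: "h (x + y) = h x \<oplus>\<^bsub>M\<^esub> h y" for x y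
    using h by (auto simp: hom_def)
  have zero: "h 0 = \<zero>\<^bsub>M\<^esub>"
    using add[of 0 0] closed[of 0] by (metis M.add.r_cancel_one' add.right_neutral)
  have neg: "h (- x) = \<ominus>\<^bsub>M\<^esub> h x" for x
    using add[of "- x" x] zero closed by (metis M.minus_equality add.left_inverse)
  have diff: "h (x - y) = h x \<oplus>\<^bsub>M\<^esub> \<ominus>\<^bsub>M\<^esub> h y" for x y
    using add[of x "- y"] neg by simp
  have kill: "h x = \<zero>\<^bsub>M\<^esub>" if "x \<in> null_combs f" for x
    using that
  proof induction
    case zero then show ?case by (rule \<open>h 0 = \<zero>\<^bsub>M\<^esub>\<close>)
  next
    case (diff x y) then show ?case using \<open>\<And>x y. h (x - y) = h x \<oplus>\<^bsub>M\<^esub> \<ominus>\<^bsub>M\<^esub> h y\<close> by simp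
  next
    case (geq t u)
    then have "h (frag_of t) = h (frag_of u)" using geq_terms[OF geq] R(5) by (auto simp: hf)
    then show ?case using diff closed by (simp add: M.r_neg)
  next
    case (add t u)
    have "h (frag_of (TAdd t u)) = h (frag_of t) \<oplus>\<^bsub>M\<^esub> h (frag_of u)"
      using add R(3) by (auto simp: hf in_terms_iff)
    then show ?case using diff \<open>\<And>x y. h (x + y) = h x \<oplus>\<^bsub>M\<^esub> h y\<close> closed by (simp add: M.r_neg)
  qed
  show ?thesis using closed add neg zero kill hf by (intro exI[of _ h]) simp
qed

text \<open>Nothing is lost by computing with signed sums: evaluation in \<open>class_module\<close>
  sends the two terms to their classes, so equivalence of the combinations forces congruence of the
  terms.\<close>

lemma geqI_frag:
  assumes "eqv f (frag_of t) (frag_of u)" "t \<in> tms X Y d" "u \<in> tms X Y d"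
  shows "geq f t u"
proof -
  have XY: "X \<in> Ob C" "Y \<in> Ob C" using assms(2) wft_Ob by (auto simp: in_terms_iff)
  let ?M = "class_module f X Y d"
  interpret M: abelian_group ?M by (rule represents_abelian_group[OF represents_gmod XY])
  obtain ev where ev: "\<forall>x. ev x \<in> carrier ?M" "\<forall>x y. ev (x + y) = ev x \<oplus>\<^bsub>?M\<^esub> ev y"
    "\<forall>x. ev (- x) = \<ominus>\<^bsub>?M\<^esub> ev x" "ev 0 = \<zero>\<^bsub>?M\<^esub>"
    "\<forall>t\<in>tms X Y d. ev (frag_of t) = tm_class f t" "\<forall>x\<in>null_combs f. ev x = \<zero>\<^bsub>?M\<^esub>"
    using represents_ev[OF represents_gmod[of f X Y d] XY] by (elim exE conjE)
  have "ev (frag_of t) \<oplus>\<^bsub>?M\<^esub> \<ominus>\<^bsub>?M\<^esub> ev (frag_of u) = \<zero>\<^bsub>?M\<^esub>"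
    using ev(6)[rule_format, of "frag_of t - frag_of u"]
      ev(2)[rule_format, of "frag_of t" "- frag_of u"] ev(3) assms(1)
    by (simp add: eqv_def)
  then have "ev (frag_of t) = ev (frag_of u)"
    using ev(1) by (metis M.a_inv_closed M.minus_equality M.minus_minus)
  then show ?thesis using ev(5) assms(2,3) tm_class_eq_iff by (simp add: in_terms_iff)
qed

text \<open>The value \<open>0\<close> on ill-formed terms makes \<open>cls\<close> of a term with a varying subterm additive
  without side conditions on types.\<close>

definition cls :: "('o, 'k, 'm) tm \<Rightarrow> (('o, 'k, 'm) tm \<Rightarrow>\<^sub>0 int)" where
  "cls t = (if wft t then frag_of t else 0)"

lemma frag_extend_cls: "wft t \<Longrightarrow> frag_extend g (cls t) = g t"
  by (simp add: cls_def)

lemma geqI: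
  assumes "eqv f (cls t) (cls u)" "t \<in> tms X Y d" "u \<in> tms X Y d"
  shows "geq f t u"
  using assms geqI_frag by (auto simp: cls_def in_terms_iff)

lemma cls_geq: "geq f t u \<Longrightarrow> eqv f (cls t) (cls u)"
  using geq_wft[of f t u] by (simp add: cls_def eqv_def null_combs.geq)

lemma cls_add: "wft (TAdd t u) \<Longrightarrow> eqv f (cls (TAdd t u)) (cls t + cls u)"
  using null_combs.add[of t u f] by (auto simp: cls_def eqv_def)

text \<open>A zero term is a basis element of the free abelian group and not its 0, but adding it to
  itself gives a congruent term, and this makes it null.\<close>

lemma cls_zero: "eqv f (cls (TZero X Y d)) 0"
proof (cases "wft (TZero X Y d)")
  case True
  let ?Z = "TZero X Y d :: ('o, 'k, 'm) tm"
  have "eqv f (cls ?Z + cls ?Z) (cls (TAdd ?Z ?Z))"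
    by (rule eqv_sym, rule cls_add) (use True in simp)
  also have "eqv f \<dots> (cls ?Z)"
    using geq.add_zero[OF True, of f] cls_geq by simp
  finally have "eqv f (cls ?Z + cls ?Z) (cls ?Z)" .
  then show ?thesis by (simp add: eqv_def)
qed (auto simp: cls_def)

lemma cls_neg: "eqv f (cls (tneg K t)) (- cls t)"
proof (cases "wft t")
  case True
  have "eqv f (cls t + cls (tneg K t)) (cls (TAdd t (tneg K t)))"
    using True by (intro eqv_sym[OF cls_add]) simp
  also have "eqv f \<dots> 0"
    using geq.add_neg[OF True, of f] cls_geq eqv_trans cls_zero by blast
  finally show ?thesis by (simp add: eqv_def add.commute)
qed (simp add: cls_def)

definition sg :: "int \<Rightarrow> int" where
  "sg e = (if even e then 1 else -1)"

lemma sg_simps [simp]: "sg 0 = 1" "sg 1 = -1" "sg (-1) = -1" "sg (- d) = sg d" "sg d * sg d = 1"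
    "sg d * (sg d * c) = c"
  by (auto simp: sg_def)

lemma sg_add: "sg (a + b) = sg a * sg b"
  and sg_pred: "sg (a + (b - 1)) = - sg (a + b)"
  by (auto simp: sg_def)

lemma cls_tsign: "eqv f (cls (tsign K e t)) (frag_cmul (sg e) (cls t))"
  using cls_neg by (simp add: tsign_def sg_def)

lemma cls_smult:
  assumes "r \<in> carrier K" "eqv f x y"
  shows "eqv f (frag_extend (\<lambda>t. cls (TSmult r t)) x) (frag_extend (\<lambda>t. cls (TSmult r t)) y)"
proof (rule eqv_extend[OF assms(2)])
  show "eqv f (cls (TSmult r t)) (cls (TSmult r u))" if "geq f t u" for t u
    using that assms(1) by (intro cls_geq geq.cong_smult)
  show "eqv f (cls (TSmult r (TAdd t u))) (cls (TSmult r t) + cls (TSmult r u))" if "wft (TAdd t u)" for t u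
    by (rule eqv_trans[OF cls_geq[OF geq.smult_r_distr[OF assms(1) that, of f]]
      cls_add[of "TSmult r t" "TSmult r u" f]]) (use that assms(1) in simp)
qed

text \<open>Turns the right-nested sum that \<open>tm_b1\<close> builds into a sum of combinations;
  the zero term at its end contributes nothing.\<close>

lemma foldr_TAdd:
  assumes "\<And>t. t \<in> set L \<Longrightarrow> t \<in> tms X Y d" "X \<in> Ob C" "Y \<in> Ob C"
  shows "foldr TAdd L (TZero X Y d) \<in> tms X Y d
    \<and> eqv f (cls (foldr TAdd L (TZero X Y d))) (sum_list (map cls L))"
  using assms(1)
proof (induction L)
  case Nil
  then show ?case using assms(2,3) cls_zero by simp
next
  case (Cons t L)
  then have *: "t \<in> tms X Y d" "foldr TAdd L (TZero X Y d) \<in> tms X Y d"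
    "eqv f (cls (foldr TAdd L (TZero X Y d))) (sum_list (map cls L))" by auto
  then have "eqv f (cls (TAdd t (foldr TAdd L (TZero X Y d)))) (cls t + sum_list (map cls L))"
    by (intro eqv_trans[OF cls_add eqv_add[OF eqv_refl]]) (auto simp: in_terms_iff)
  with * show ?case by simp
qed

lemma in_P_foldr_TAdd: "(\<And>t. t \<in> set L \<Longrightarrow> in_P t) \<Longrightarrow> in_P (foldr TAdd L (TZero X Y d))"
  by (induction L) auto

section \<open>The differential on terms\<close>

abbreviation "b1 \<equiv> tm_b1 K C"

text \<open>All operations on words at once: the recursively defined differential on one letter, the
  constructor on longer words. With it the A-infinity relations can be written uniformly in the
  length.\<close>

definition Bt :: "('o, 'k, 'm) tm list \<Rightarrow> ('o, 'k, 'm) tm" where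
  "Bt v = (if length v = 1 then b1 (hd v) else TB v)"

lemma Bt_single [simp]: "Bt [t] = b1 t"
  by (simp add: Bt_def)

lemma Bt_TB: "length v \<ge> 2 \<Longrightarrow> Bt v = TB v"
  by (simp add: Bt_def)

lemma Bt_slot: "u \<noteq> [] \<or> z \<noteq> [] \<Longrightarrow> Bt (u @ t # z) = TB (u @ t # z)"
  by (auto simp: Bt_def)

lemma length_slot: "u \<noteq> [] \<or> z \<noteq> [] \<Longrightarrow> length (u @ t # z) \<ge> 2"
  by (cases u; cases z) auto

text \<open>Kept as a predicate on single terms because for a \<open>TB\<close> term it has to be
  derived from the same property of the letters. The clause on \<open>in_P\<close> is what allows
  \<open>H\<close> to be applied to \<open>b1 t\<close>.\<close>

definition homog :: "('o, 'k, 'm) tm \<Rightarrow> bool" where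
  "homog t \<longleftrightarrow> wft (b1 t) \<and> tm_src (b1 t) = tm_src t \<and> tm_tgt (b1 t) = tm_tgt t
     \<and> tm_deg (b1 t) = tm_deg t + 1 \<and> (in_P t \<longrightarrow> in_P (b1 t))"

lemma path_Bt_homog:
  assumes "path X v Y" "v \<noteq> []" "\<And>t. t \<in> set v \<Longrightarrow> homog t"
  shows "wft (Bt v) \<and> tm_src (Bt v) = X \<and> tm_tgt (Bt v) = Y \<and> tm_deg (Bt v) = ldeg v + 1"
proof (cases "length v = 1")
  case True
  then obtain t where "v = [t]" by (auto simp: length_Suc_conv)
  with assms show ?thesis by (simp add: homog_def)
next
  case False
  with assms(2) have "length v \<ge> 2" by (cases v rule: list.exhaust) (auto simp: Suc_le_eq)
  with wft_TB[OF assms(1)] show ?thesis by (simp add: Bt_TB)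
qed

text \<open>The index pairs of the list comprehension in \<open>tm_b1\<close>, in its order:
  \<open>p\<close> is the length of the contracted factor and \<open>a\<close> its start.\<close>

definition b1_index :: "'a list \<Rightarrow> (nat \<times> nat) list" where
  "b1_index ts = concat (map (\<lambda>p. map (Pair p) [0..<length ts - p + 1]) [1..<length ts])"

lemma set_b1_index: "set (b1_index ts) = {(p, a). 1 \<le> p \<and> p < length ts \<and> a + p \<le> length ts}"
proof (intro equalityI subsetI)
  fix x assume "x \<in> {(p, a). 1 \<le> p \<and> p < length ts \<and> a + p \<le> length ts}"
  then obtain p a where "x = (p, a)" "1 \<le> p" "p < length ts" "a < length ts - p + 1" by auto
  then show "x \<in> set (b1_index ts)" unfolding b1_index_def set_concat set_map
    by (intro UN_I[of "map (Pair p) [0..<length ts - p + 1]"] image_eqI[of _ _ p]) (auto simp del: upt_Suc)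
qed (auto simp: b1_index_def simp del: upt_Suc)

lemma distinct_b1_index: "distinct (b1_index ts)"
  unfolding b1_index_def
  by (rule distinct_concat) (auto simp: distinct_map inj_on_def)

lemma b1_TB_foldr:
  "b1 (TB ts) = tneg K (foldr TAdd
     (map (\<lambda>(p, a). tsign K (ldeg (drop (a + p) ts))
         (TB (take a ts @ Bt (take p (drop a ts)) # drop (a + p) ts))) (b1_index ts))
     (TZero (tm_src (TB ts)) (tm_tgt (TB ts)) (tm_deg (TB ts) + 1)))"
proof -
  \<comment> \<open>Being primitive recursive, \<open>tm_b1\<close> reaches the differential of a
    letter through \<open>map b1 ts ! a\<close>; a factor of length 1 consists of exactly this
    letter.\<close>
  have *: "(if p = 1 then map b1 ts ! a else TB (take p (drop a ts))) = Bt (take p (drop a ts))"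
    if "1 \<le> p" "p < length ts" "a < length ts - p + 1" for p a
  proof (cases "p = 1")
    case True
    then have "take p (drop a ts) = [ts ! a]" using that by (simp add: take_Suc hd_drop_conv_nth)
    then show ?thesis using that True by simp
  qed (use that in \<open>simp add: Bt_def\<close>)
  have "[tsign K (ldeg (drop (a + p) ts))
          (TB (take a ts
               @ (if p = 1 then map b1 ts ! a else TB (take p (drop a ts)))
               # drop (a + p) ts)).
        p \<leftarrow> [1..<length ts], a \<leftarrow> [0..<length ts - p + 1]]
     = map (\<lambda>(p, a). tsign K (ldeg (drop (a + p) ts))
         (TB (take a ts @ Bt (take p (drop a ts)) # drop (a + p) ts))) (b1_index ts)"
    unfolding b1_index_def map_concat
    by (intro arg_cong[of _ _ concat]) (use * in \<open>auto simp del: One_nat_def\<close>)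
  then show ?thesis by simp
qed

lemma b1_TB_terms:
  assumes "path X ts Y" "length ts \<ge> 2" "\<And>t. t \<in> set ts \<Longrightarrow> homog t" "(p, a) \<in> set (b1_index ts)"
  shows "tsign K e (TB (take a ts @ Bt (take p (drop a ts)) # drop (a + p) ts)) \<in> tms X Y (2 + ldeg ts)"
proof -
  let ?u = "take a ts" and ?v = "take p (drop a ts)" and ?z = "drop (a + p) ts"
  have pa: "1 \<le> p" "p < length ts" "a + p \<le> length ts" using assms(4) by (auto simp: set_b1_index)
  have ts: "ts = ?u @ ?v @ ?z" by (metis append_take_drop_id drop_drop add.commute)
  have "path X (?u @ ?v @ ?z) Y" using assms(1) by (simp only: ts[symmetric])
  then obtain Z Z' where Z: "path X ?u Z" "path Z ?v Z'" "path Z' ?z Y" by auto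
  have "set ?v \<subseteq> set ts" by (meson order.trans set_drop_subset set_take_subset)
  then have v: "wft (Bt ?v) \<and> tm_src (Bt ?v) = Z \<and> tm_tgt (Bt ?v) = Z' \<and> tm_deg (Bt ?v) = ldeg ?v + 1"
    using assms(3) pa by (intro path_Bt_homog[OF Z(2)]) auto
  have "path X (?u @ Bt ?v # ?z) Y" using Z v by auto
  moreover have "length (?u @ Bt ?v # ?z) \<ge> 2" using pa by auto
  moreover have "ldeg ts = ldeg ?u + ldeg ?v + ldeg ?z"
    by (subst ts) (simp only: map_append sum_list_append add.assoc)
  ultimately show ?thesis using wft_TB[of X "?u @ Bt ?v # ?z" Y] v by (simp add: in_terms_iff)
qed

lemma homog: "wft t \<Longrightarrow> homog t"
proof (induction t)
  case (TGen X Y d m)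
  then have "composable C [Arrow X Y d m]" by (simp add: composable_def arrows_def)
  from bop_closed[OF this] TGen show ?case by (simp add: homog_def total_deg_def)
next
  case (TB ts)
  then obtain X Y where ts: "length ts \<ge> 2" "path X ts Y" "tm_src (TB ts) = X" "tm_tgt (TB ts) = Y"
    by (elim wft_TBE)
  have XY: "X \<in> Ob C" "Y \<in> Ob C" using wft_Ob[OF TB.prems] ts by auto
  have hom: "homog t" if "t \<in> set ts" for t
    using TB.IH that ts(2) path_iff[of ts X Y] by (cases ts) auto
  let ?L = "map (\<lambda>(p, a). tsign K (ldeg (drop (a + p) ts))
         (TB (take a ts @ Bt (take p (drop a ts)) # drop (a + p) ts))) (b1_index ts)"
  have "foldr TAdd ?L (TZero X Y (2 + ldeg ts)) \<in> tms X Y (2 + ldeg ts)"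
    by (rule foldr_TAdd[of ?L X Y "2 + ldeg ts" False, THEN conjunct1])
      (use b1_TB_terms[OF ts(2,1) hom] XY in auto)
  moreover have "in_P (foldr TAdd ?L (TZero X Y (2 + ldeg ts)))"
    by (rule in_P_foldr_TAdd) auto
  ultimately show ?case using ts unfolding homog_def b1_TB_foldr by (simp add: in_terms_iff)
qed (auto simp: homog_def)

lemma wft_b1 [simp]: "wft t \<Longrightarrow> wft (b1 t)"
  and src_b1 [simp]: "wft t \<Longrightarrow> tm_src (b1 t) = tm_src t"
  and tgt_b1 [simp]: "wft t \<Longrightarrow> tm_tgt (b1 t) = tm_tgt t"
  and deg_b1 [simp]: "wft t \<Longrightarrow> tm_deg (b1 t) = tm_deg t + 1"
  and in_P_b1 [simp]: "wft t \<Longrightarrow> in_P t \<Longrightarrow> in_P (b1 t)"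
  using homog by (auto simp: homog_def)

lemma path_wft: "path X v Y \<Longrightarrow> t \<in> set v \<Longrightarrow> wft t"
  by (induction v arbitrary: X) auto

lemma path_Bt:
  assumes "path X v Y" "v \<noteq> []"
  shows "wft (Bt v)" "tm_src (Bt v) = X" "tm_tgt (Bt v) = Y" "tm_deg (Bt v) = ldeg v + 1"
  using path_Bt_homog[OF assms] path_wft[OF assms(1)] homog by auto

lemma path_dec:
  assumes "path X w Y" "(u, v, z) \<in> decomps w"
  shows "path X (u @ Bt v # z) Y" "wft (Bt v)" "tm_deg (Bt v) = ldeg v + 1" "v \<noteq> []"
    "\<exists>Z Z'. path Z v Z'" "\<And>t. t \<in> set v \<Longrightarrow> t \<in> set w"
  using assms path_Bt by (auto simp: decomps_def)

text \<open>The value 0 for the contraction of the whole word accounts for the condition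
  \<open>a + c > 0\<close> in the formula for \<open>b_n b_1\<close>, so that sums may run over all
  of \<open>decomps\<close>.\<close>

definition b1_summand :: "('o, 'k, 'm) tm list \<Rightarrow> ('o, 'k, 'm) tm list \<Rightarrow> ('o, 'k, 'm) tm list
    \<Rightarrow> (('o, 'k, 'm) tm \<Rightarrow>\<^sub>0 int)" where
  "b1_summand u v z = (if u = [] \<and> z = [] then 0 else frag_cmul (sg (ldeg z)) (cls (TB (u @ Bt v # z))))"

lemma b1_TB_eqv:
  assumes "path X w Y" "length w \<ge> 2"
  shows "eqv f (cls (b1 (TB w))) (- (\<Sum>(u, v, z)\<in>decomps w. b1_summand u v z))"
proof -
  let ?F = "\<lambda>p a. TB (take a w @ Bt (take p (drop a w)) # drop (a + p) w)"
  let ?L = "map (\<lambda>(p, a). tsign K (ldeg (drop (a + p) w)) (?F p a)) (b1_index w)"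
  have XY: "X \<in> Ob C" "Y \<in> Ob C" using assms path_Ob[of X w Y] by fastforce+
  have st: "tm_src (TB w) = X" "tm_tgt (TB w) = Y" using wft_TB[OF assms] by auto
  have "eqv f (cls (b1 (TB w))) (- cls (foldr TAdd ?L (TZero X Y (2 + ldeg w))))"
    unfolding b1_TB_foldr st using cls_neg by simp
  also have "eqv f \<dots> (- sum_list (map cls ?L))"
    by (rule eqv_minus, rule foldr_TAdd[THEN conjunct2])
      (use b1_TB_terms[OF assms homog] path_wft[OF assms(1)] XY in auto)
  also have "eqv f \<dots> (- sum_list (map (\<lambda>(p, a). frag_cmul (sg (ldeg (drop (a + p) w))) (cls (?F p a))) (b1_index w)))"
    unfolding map_map by (intro eqv_minus eqv_sum_list) (auto intro: cls_tsign)
  also have "sum_list (map (\<lambda>(p, a). frag_cmul (sg (ldeg (drop (a + p) w))) (cls (?F p a))) (b1_index w))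
      = (\<Sum>(p, a)\<in>{(p, a). 1 \<le> p \<and> p < length w \<and> a + p \<le> length w}.
          frag_cmul (sg (ldeg (drop (a + p) w))) (cls (?F p a)))"
    by (simp add: sum_list_distinct_conv_sum_set distinct_b1_index set_b1_index)
  also have "\<dots> = (\<Sum>(r, n)\<in>{(r, n). 1 \<le> n \<and> r + n \<le> length w} - {(0, length w)}.
          b1_summand (take r w) (take n (drop r w)) (drop (r + n) w))"
    by (rule sum.reindex_bij_witness[where i = prod.swap and j = prod.swap]) (auto simp: b1_summand_def)
  also have "\<dots> = (\<Sum>(u, v, z)\<in>decomps w. b1_summand u v z)"
    unfolding sum_dec_index by (rule sum.mono_neutral_left[OF finite_index]) (auto simp: b1_summand_def)
  finally show ?thesis .
qed

text \<open>The left-hand side of the A-infinity relation for the word \<open>w\<close>; the sign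
  comes from moving the inner operation past \<open>z\<close>.\<close>

definition bb :: "('o, 'k, 'm) tm list \<Rightarrow> (('o, 'k, 'm) tm \<Rightarrow>\<^sub>0 int)" where
  "bb w = (\<Sum>(u, v, z)\<in>decomps w. frag_cmul (sg (ldeg z)) (cls (Bt (u @ Bt v # z))))"

lemma bb_single: "bb [x] = cls (b1 (b1 x))"
  by (simp add: bb_def)

lemma bb_eqv_0:
  assumes "path X w Y" "length w \<ge> 2"
  shows "eqv f (bb w) 0"
proof -
  have ne: "w \<noteq> []" using assms(2) by auto
  have "bb w = cls (b1 (TB w)) + (\<Sum>(u, v, z)\<in>decomps w - {([], w, [])}. frag_cmul (sg (ldeg z)) (cls (Bt (u @ Bt v # z))))"
    unfolding bb_def by (subst sum.remove[of _ "([], w, [])"]) (use ne assms(2) in \<open>auto simp: Bt_TB\<close>)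
  also have "(\<Sum>(u, v, z)\<in>decomps w - {([], w, [])}. frag_cmul (sg (ldeg z)) (cls (Bt (u @ Bt v # z))))
     = (\<Sum>(u, v, z)\<in>decomps w. b1_summand u v z)"
  proof (rule sum.mono_neutral_cong_left)
    fix x assume "x \<in> decomps w - {([], w, [])}"
    then obtain u v z where x: "x = (u, v, z)" "w = u @ v @ z" "(u, v, z) \<noteq> ([], w, [])"
      by (auto simp: decomps_def)
    then have uz: "u \<noteq> [] \<or> z \<noteq> []" by auto
    then have "Bt (u @ Bt v # z) = TB (u @ Bt v # z)" by (simp add: Bt_slot)
    with x(1) uz show "(case x of (u, v, z) \<Rightarrow> frag_cmul (sg (ldeg z)) (cls (Bt (u @ Bt v # z))))
      = (case x of (u, v, z) \<Rightarrow> b1_summand u v z)" by (auto simp: b1_summand_def)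
  qed (auto simp: b1_summand_def)
  finally show ?thesis using b1_TB_eqv[OF assms, of f] by (simp add: eqv_def)
qed

section \<open>Linear operators on terms\<close>

text \<open>Induction over the congruence, done once for the differential and for both homotopies.
  The module axioms are inherited because \<open>F\<close> commutes literally with the module
  constructors. What each operator still has to supply concerns generators, arguments of
  \<open>TB\<close> and \<open>TH\<close>, and the rule \<open>base\<close>.\<close>

lemma linear_preserves:
  fixes F :: "('o, 'k, 'm) tm \<Rightarrow> ('o, 'k, 'm) tm"
  assumes F: "\<And>t. wft t \<Longrightarrow> wft (F t) \<and> tm_src (F t) = tm_src t \<and> tm_tgt (F t) = tm_tgt t
      \<and> tm_deg (F t) = tm_deg t + \<delta>"
    and F_add: "\<And>t u. F (TAdd t u) = TAdd (F t) (F u)"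
    and F_smult: "\<And>r t. F (TSmult r t) = TSmult r (F t)"
    and F_zero: "\<And>X Y d. F (TZero X Y d) = TZero X Y (d + \<delta>)"
    and F_gen_add: "\<And>X Y d m m'. wft (TGen X Y d m) \<Longrightarrow> wft (TGen X Y d m') \<Longrightarrow>
      geq f (F (TGen X Y d (m \<oplus>\<^bsub>sHom C X Y d\<^esub> m'))) (TAdd (F (TGen X Y d m)) (F (TGen X Y d m')))"
    and F_gen_smult: "\<And>X Y d r m. r \<in> carrier K \<Longrightarrow> wft (TGen X Y d m) \<Longrightarrow>
      geq f (F (TGen X Y d (r \<odot>\<^bsub>sHom C X Y d\<^esub> m))) (TSmult r (F (TGen X Y d m)))"
    and F_b: "\<And>us t t' vs. geq f t t' \<Longrightarrow> geq f (F t) (F t') \<Longrightarrow> wft (TB (us @ t # vs)) \<Longrightarrow>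
      geq f (F (TB (us @ t # vs))) (F (TB (us @ t' # vs)))"
    and F_b_add: "\<And>us t u vs. wft (TB (us @ TAdd t u # vs)) \<Longrightarrow>
      geq f (F (TB (us @ TAdd t u # vs))) (TAdd (F (TB (us @ t # vs))) (F (TB (us @ u # vs))))"
    and F_b_smult: "\<And>us r t vs. wft (TB (us @ TSmult r t # vs)) \<Longrightarrow>
      geq f (F (TB (us @ TSmult r t # vs))) (TSmult r (F (TB (us @ t # vs))))"
    and F_H: "\<And>t t'. geq f t t' \<Longrightarrow> geq f (F t) (F t') \<Longrightarrow> wft (TH t) \<Longrightarrow> wft (TH t') \<Longrightarrow>
      geq f (F (TH t)) (F (TH t'))"
    and F_H_add: "\<And>t u. wft (TH (TAdd t u)) \<Longrightarrow> geq f (F (TH (TAdd t u))) (TAdd (F (TH t)) (F (TH u)))"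
    and F_H_smult: "\<And>r t. wft (TH (TSmult r t)) \<Longrightarrow> geq f (F (TH (TSmult r t))) (TSmult r (F (TH t)))"
    and F_base: "\<And>xs. f \<Longrightarrow> composable C xs \<Longrightarrow> length xs \<ge> 2 \<Longrightarrow>
      geq f (F (TB (map gen xs))) (F (gen (barrow C xs)))"
  assumes tu: "geq f t u"
  shows "geq f (F t) (F u)"
  using tu
proof induction
  case (refl t)
  then show ?case using F geq.refl by blast
next
  case (sym t u)
  then show ?case using geq.sym by blast
next
  case (trans t u v)
  then show ?case using geq.trans by blast
next
  case (cong_add t t' u u')
  then show ?case unfolding F_add using F[of t] F[of u] by (intro geq.cong_add) auto
next
  case (cong_smult t t' r)
  then show ?case unfolding F_smult by (intro geq.cong_smult)
next
  case (add_assoc t u v)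
  then show ?case unfolding F_add using F[of t] F[of u] F[of v] by (intro geq.add_assoc) auto
next
  case (add_comm t u)
  then show ?case unfolding F_add using F[of t] F[of u] by (intro geq.add_comm) auto
next
  case (add_zero t)
  then show ?case unfolding F_add F_zero using F[of t] geq.add_zero[of "F t" f] by simp
next
  case (add_neg t)
  then show ?case unfolding F_add F_zero tneg_def F_smult
    using F[of t] geq.add_neg[of "F t" f] by (simp add: tneg_def)
next
  case (smult_l_distr r r' t)
  then show ?case unfolding F_add F_smult using F[of t] by (intro geq.smult_l_distr) auto
next
  case (smult_r_distr r t u)
  then show ?case unfolding F_add F_smult using F[of t] F[of u] by (intro geq.smult_r_distr) auto
next
  case (smult_assoc r r' t)
  then show ?case unfolding F_smult using F[of t] by (intro geq.smult_assoc) auto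
next
  case (smult_one t)
  then show ?case unfolding F_smult using F[of t] by (intro geq.smult_one) auto
next
  case (base xs)
  then show ?case using F_base by blast
qed (simp_all only: F_add F_smult F_gen_add F_gen_smult F_b F_b_add F_b_smult F_H F_H_add F_H_smult)

text \<open>Multiplication of a signed sum by a scalar of \<open>K\<close>. The coefficients of
  combinations are integers, so the scalar acts on the terms.\<close>

definition scale :: "'k \<Rightarrow> (('o, 'k, 'm) tm \<Rightarrow>\<^sub>0 int) \<Rightarrow> (('o, 'k, 'm) tm \<Rightarrow>\<^sub>0 int)" where
  "scale r x = frag_extend (\<lambda>t. cls (TSmult r t)) x"

lemma scale_cls: "r \<in> carrier K \<Longrightarrow> scale r (cls t) = cls (TSmult r t)"
  by (simp add: scale_def cls_def)

lemma scale_eqv: "r \<in> carrier K \<Longrightarrow> eqv f x y \<Longrightarrow> eqv f (scale r x) (scale r y)"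
  unfolding scale_def by (rule cls_smult)

lemma scale_simps [simp]: "scale r 0 = 0" "scale r (x + y) = scale r x + scale r y"
  "scale r (x - y) = scale r x - scale r y" "scale r (- x) = - scale r x"
  "scale r (frag_cmul c x) = frag_cmul c (scale r x)"
  by (simp_all add: scale_def frag_extend_add frag_extend_diff frag_extend_minus frag_extend_cmul)

lemma scale_sum: "finite I \<Longrightarrow> scale r (sum g I) = (\<Sum>i\<in>I. scale r (g i))"
  by (simp add: scale_def frag_extend_sum o_def)

text \<open>Linearity in one letter, all others being fixed. The value 0 on ill-formed terms makes
  the property stable under insertion into a word, whatever the surrounding letters are.\<close>

definition multilinear :: "bool \<Rightarrow> (('o, 'k, 'm) tm \<Rightarrow> ('o, 'k, 'm) tm \<Rightarrow>\<^sub>0 int) \<Rightarrow> bool" where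
  "multilinear f g \<longleftrightarrow> (\<forall>t. \<not> wft t \<longrightarrow> g t = 0) \<and> (\<forall>t u. geq f t u \<longrightarrow> eqv f (g t) (g u)) \<and>
     (\<forall>t u. wft (TAdd t u) \<longrightarrow> eqv f (g (TAdd t u)) (g t + g u)) \<and>
     (\<forall>r t. wft (TSmult r t) \<longrightarrow> eqv f (g (TSmult r t)) (scale r (g t)))"

lemma multilinearD:
  assumes "multilinear f g"
  shows "\<not> wft t \<Longrightarrow> g t = 0" "geq f t u \<Longrightarrow> eqv f (g t) (g u)"
    "wft (TAdd t u) \<Longrightarrow> eqv f (g (TAdd t u)) (g t + g u)"
    "wft (TSmult r t) \<Longrightarrow> eqv f (g (TSmult r t)) (scale r (g t))"
  using assms by (auto simp: multilinear_def)

lemma multilinear_cls: "multilinear f cls"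
  unfolding multilinear_def using cls_geq cls_add
  by (auto simp: scale_cls) (auto simp: cls_def)

text \<open>Well-formedness of the surrounding word depends on the marked letter only through its
  type. So either all the words compared are well-formed and the rules for \<open>TB\<close> apply,
  or all are ill-formed and both sides are 0.\<close>

lemma multilinear_slot:
  assumes "multilinear f g"
  shows "multilinear f (\<lambda>t. g (TB (us @ t # vs)))"
  unfolding multilinear_def
proof (intro conjI allI impI)
  note g = multilinearD[OF assms]
  fix t assume "\<not> wft t"
  then have "\<not> wft (TB (us @ t # vs))" using wft_TB_slot by blast
  then show "g (TB (us @ t # vs)) = 0" by (rule g)
next
  note g = multilinearD[OF assms]
  fix t u assume tu: "geq f t u"
  show "eqv f (g (TB (us @ t # vs))) (g (TB (us @ u # vs)))"
  proof (cases "wft (TB (us @ t # vs))")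
    case True
    then show ?thesis using geq.cong_b[OF tu True] g by blast
  next
    case False
    then have "\<not> wft (TB (us @ u # vs))" using geq_wft[OF tu] wft_TB_replace[of us u vs t] by auto
    with False show ?thesis using g(1) by simp
  qed
next
  note g = multilinearD[OF assms]
  fix t u assume tu: "wft (TAdd t u)"
  show "eqv f (g (TB (us @ TAdd t u # vs))) (g (TB (us @ t # vs)) + g (TB (us @ u # vs)))"
  proof (cases "wft (TB (us @ TAdd t u # vs))")
    case True
    have "eqv f (g (TB (us @ TAdd t u # vs))) (g (TAdd (TB (us @ t # vs)) (TB (us @ u # vs))))"
      using geq.b_add[OF True] g by blast
    also have "eqv f \<dots> (g (TB (us @ t # vs)) + g (TB (us @ u # vs)))"
      using geq_wft[OF geq.b_add[OF True]] g(3) by blast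
    finally show ?thesis .
  next
    case False
    then have "\<not> wft (TB (us @ t # vs))" "\<not> wft (TB (us @ u # vs))"
      using wft_TB_replace[of us t vs "TAdd t u"] wft_TB_replace[of us u vs "TAdd t u"] tu by auto
    with False show ?thesis using g(1) by simp
  qed
next
  note g = multilinearD[OF assms]
  fix r t assume rt: "wft (TSmult r t)"
  show "eqv f (g (TB (us @ TSmult r t # vs))) (scale r (g (TB (us @ t # vs))))"
  proof (cases "wft (TB (us @ TSmult r t # vs))")
    case True
    have "eqv f (g (TB (us @ TSmult r t # vs))) (g (TSmult r (TB (us @ t # vs))))"
      using geq.b_smult[OF True] g by blast
    also have "eqv f \<dots> (scale r (g (TB (us @ t # vs))))"
      using geq_wft[OF geq.b_smult[OF True]] g(4) by blast
    finally show ?thesis .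
  next
    case False
    then have "\<not> wft (TB (us @ t # vs))"
      using wft_TB_replace[of us t vs "TSmult r t"] rt by auto
    with False show ?thesis using g(1) by simp
  qed
qed

lemma cls_slot: "multilinear f (\<lambda>t. cls (TB (us @ t # vs)))"
  by (rule multilinear_slot[OF multilinear_cls])

lemma cls_sub: "wft (TAdd t u) \<Longrightarrow> eqv f (cls (TAdd t (tneg K u))) (cls t - cls u)"
  using eqv_trans[OF cls_add eqv_add[OF eqv_refl cls_neg], of t u f] by simp

lemma cls_H_cong: "geq f t t' \<Longrightarrow> wft (TH t) \<Longrightarrow> wft (TH t') \<Longrightarrow> eqv f (cls (TH t)) (cls (TH t'))"
  by (intro cls_geq geq.cong_H)

lemma cls_H_add:
  assumes "wft (TH (TAdd t u))"
  shows "eqv f (cls (TH (TAdd t u))) (cls (TH t) + cls (TH u))"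
  using eqv_trans[OF cls_geq[OF geq.H_add[OF assms]] cls_add] assms by auto

lemma cls_H_smult:
  assumes "wft (TH (TSmult r t))"
  shows "eqv f (cls (TH (TSmult r t))) (scale r (cls (TH t)))"
  using cls_geq[OF geq.H_smult[OF assms], of f] assms by (simp add: scale_cls)

lemma cls_H_zero: "eqv f (cls (TH (TZero X Y d))) 0"
proof (cases "wft (TH (TZero X Y d))")
  case True
  let ?Z = "TZero X Y d :: ('o, 'k, 'm) tm"
  have "eqv f (cls (TH ?Z) + cls (TH ?Z)) (cls (TH (TAdd ?Z ?Z)))"
    by (rule eqv_sym, rule cls_H_add) (use True in simp)
  also have "eqv f \<dots> (cls (TH ?Z))"
    using geq.add_zero[of ?Z f] True by (intro cls_H_cong) auto
  finally show ?thesis by (simp add: eqv_def)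
qed (auto simp: cls_def)

text \<open>\<open>H\<close> is defined on \<open>P\<close> only and does not extend to arbitrary
  combinations by linearity. Instead, a null term is congruent to a zero term, which lies in
  \<open>P\<close>.\<close>

lemma cls_H_eqv_0:
  assumes "eqv f (cls t) 0" "wft (TH t)"
  shows "eqv f (cls (TH t)) 0"
proof -
  have t: "t \<in> tms (tm_src t) (tm_tgt t) (tm_deg t)" using assms(2) by (simp add: in_terms_iff)
  have "eqv f (cls t) (cls (TZero (tm_src t) (tm_tgt t) (tm_deg t)))"
    by (rule eqv_trans[OF assms(1) eqv_sym[OF cls_zero]])
  then have "geq f t (TZero (tm_src t) (tm_tgt t) (tm_deg t))"
    by (rule geqI[OF _ t]) (use assms(2) wft_Ob[of t] in auto)
  then have "eqv f (cls (TH t)) (cls (TH (TZero (tm_src t) (tm_tgt t) (tm_deg t))))"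
    using assms(2) wft_Ob[of t] by (intro cls_H_cong) auto
  then show ?thesis using cls_H_zero eqv_trans by blast
qed

section \<open>The differential respects the congruences\<close>

text \<open>The sign involves the degree of the marked letter. With the degree as a parameter
  \<open>d\<close>, a sum of terms and its summands can be rewritten with literally the same
  sign.\<close>

lemma b1_summand_left:
  assumes "tm_deg t = d"
  shows "b1_summand u v (z @ t # vs) = frag_cmul (sg (ldeg z + d + ldeg vs)) (cls (TB ((u @ Bt v # z) @ t # vs)))"
  using assms by (simp add: b1_summand_def add.assoc)

lemma b1_summand_right: "b1_summand (us @ t # u) v z = frag_cmul (sg (ldeg z)) (cls (TB (us @ t # (u @ Bt v # z))))"
  by (simp add: b1_summand_def)

lemma b1_summand_mid:
  "b1_summand a1 (a2 @ t # b1') b2 = (if a1 = [] \<and> b2 = [] then 0 else frag_cmul (sg (ldeg b2))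
     (if a2 = [] \<and> b1' = [] then cls (TB (a1 @ b1 t # b2)) else cls (TB (a1 @ TB (a2 @ t # b1') # b2))))"
  by (simp add: b1_summand_def Bt_slot)

lemma sum_eqv3:
  assumes "\<And>i. i \<in> I \<Longrightarrow> eqv f (a i) (a' i)" "\<And>i. i \<in> J \<Longrightarrow> eqv f (b i) (b' i)"
    "\<And>i j. i \<in> L \<Longrightarrow> j \<in> M \<Longrightarrow> eqv f (c i j) (c' i j)"
  shows "eqv f (sum a I + sum b J + (\<Sum>i\<in>L. \<Sum>j\<in>M. c i j)) (sum a' I + sum b' J + (\<Sum>i\<in>L. \<Sum>j\<in>M. c' i j))"
  using assms by (intro eqv_add eqv_sum) auto

definition b1_sum :: "('o, 'k, 'm) tm list \<Rightarrow> (('o, 'k, 'm) tm \<Rightarrow>\<^sub>0 int)" where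
  "b1_sum w = (\<Sum>(u, v, z)\<in>decomps w. b1_summand u v z)"

lemma b1_sum_slot:
  "b1_sum (us @ t # vs) = (\<Sum>x\<in>decomps us. b1_summand (fst x) (fst (snd x)) (snd (snd x) @ t # vs))
     + (\<Sum>x\<in>decomps vs. b1_summand (us @ t # fst x) (fst (snd x)) (snd (snd x)))
     + (\<Sum>x\<in>splits us. \<Sum>y\<in>splits vs. b1_summand (fst x) (snd x @ t # fst y) (snd y))"
  unfolding b1_sum_def sum_dec_insert by (simp add: case_prod_beta)

text \<open>In each nonzero summand the marked letter is a letter of the outer word, a letter of a
  contracted factor of length at least 2, or the whole contracted factor. In the last case it occurs
  as \<open>b1 t\<close>, which is why congruence of the differentials is assumed.\<close>

lemma b1_sum_cong:
  assumes "geq f t t'" "geq f (b1 t) (b1 t')"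
  shows "eqv f (b1_sum (us @ t # vs)) (b1_sum (us @ t' # vs))"
proof -
  note d = geq_wft[OF assms(1)]
  note m = multilinearD(2)[OF cls_slot assms(1)]
    multilinearD(2)[OF cls_slot[where us = "a @ x # b" for a x b] assms(1), unfolded append_assoc append_Cons] multilinearD(2)[OF cls_slot assms(2)]
    multilinearD(2)[OF multilinear_slot[OF cls_slot] assms(1)]
  show ?thesis unfolding b1_sum_slot b1_summand_left[OF HOL.refl] b1_summand_right b1_summand_mid
    by (rule sum_eqv3) (use d in \<open>auto intro!: eqv_cmul m\<close>)
qed

lemma b1_sum_add:
  assumes "wft (TAdd t u)"
  shows "eqv f (b1_sum (us @ TAdd t u # vs)) (b1_sum (us @ t # vs) + b1_sum (us @ u # vs))"
proof -
  have d: "tm_deg u = tm_deg t" using assms by simp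
  have a': "wft (TAdd (b1 t) (b1 u))" using assms by simp
  note m = multilinearD(3)[OF cls_slot assms]
    multilinearD(3)[OF cls_slot[where us = "a @ x # b" for a x b] assms, unfolded append_assoc append_Cons] multilinearD(3)[OF cls_slot a']
    multilinearD(3)[OF multilinear_slot[OF cls_slot] assms]
  note b1_summand_left' = b1_summand_left[of t "tm_deg t", OF HOL.refl] b1_summand_left[of u "tm_deg t", OF d]
    b1_summand_left[of "TAdd t u" "tm_deg t", OF tm_deg.simps(3)]
  have "b1_sum (us @ t # vs) + b1_sum (us @ u # vs) =
      (\<Sum>x\<in>decomps us. b1_summand (fst x) (fst (snd x)) (snd (snd x) @ t # vs) + b1_summand (fst x) (fst (snd x)) (snd (snd x) @ u # vs))
     + (\<Sum>x\<in>decomps vs. b1_summand (us @ t # fst x) (fst (snd x)) (snd (snd x)) + b1_summand (us @ u # fst x) (fst (snd x)) (snd (snd x)))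
     + (\<Sum>x\<in>splits us. \<Sum>y\<in>splits vs. b1_summand (fst x) (snd x @ t # fst y) (snd y) + b1_summand (fst x) (snd x @ u # fst y) (snd y))"
    unfolding b1_sum_slot sum.distrib by (simp add: algebra_simps)
  moreover have "eqv f (b1_sum (us @ TAdd t u # vs)) \<dots>"
    unfolding b1_sum_slot b1_summand_left' b1_summand_right b1_summand_mid
    by (rule sum_eqv3) (auto intro!: eqv_cmul m simp flip: frag_cmul_distrib2)
  ultimately show ?thesis by simp
qed

lemma b1_sum_smult:
  assumes "wft (TSmult r t)"
  shows "eqv f (b1_sum (us @ TSmult r t # vs)) (scale r (b1_sum (us @ t # vs)))"
proof -
  have a': "wft (TSmult r (b1 t))" using assms by simp
  note m = multilinearD(4)[OF cls_slot assms]
    multilinearD(4)[OF cls_slot[where us = "a @ x # b" for a x b] assms, unfolded append_assoc append_Cons] multilinearD(4)[OF cls_slot a']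
    multilinearD(4)[OF multilinear_slot[OF cls_slot] assms]
  have "scale r (b1_sum (us @ t # vs)) =
      (\<Sum>x\<in>decomps us. scale r (b1_summand (fst x) (fst (snd x)) (snd (snd x) @ t # vs)))
     + (\<Sum>x\<in>decomps vs. scale r (b1_summand (us @ t # fst x) (fst (snd x)) (snd (snd x))))
     + (\<Sum>x\<in>splits us. \<Sum>y\<in>splits vs. scale r (b1_summand (fst x) (snd x @ t # fst y) (snd y)))"
    unfolding b1_sum_slot by (simp add: scale_sum)
  moreover have "eqv f (b1_sum (us @ TSmult r t # vs)) \<dots>"
    unfolding b1_sum_slot b1_summand_left[of t "tm_deg t", OF HOL.refl] b1_summand_left[of "TSmult r t" "tm_deg t", OF tm_deg.simps(4)] b1_summand_right b1_summand_mid
    by (rule sum_eqv3) (auto intro!: eqv_cmul m)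
  ultimately show ?thesis by simp
qed

lemma b1_TB_GS:
  assumes "wft (TB w)"
  shows "eqv f (cls (b1 (TB w))) (- b1_sum w)"
  using assms b1_TB_eqv unfolding b1_sum_def by (auto elim!: wft_TBE)

lemma b1_terms: "t \<in> tms X Y d \<Longrightarrow> b1 t \<in> tms X Y (d + 1)"
  by (simp add: in_terms_iff)

lemma geqI':
  assumes "eqv f (cls t) (cls u)" "wft t" "wft u" "tm_src t = tm_src u" "tm_tgt t = tm_tgt u" "tm_deg t = tm_deg u"
  shows "geq f t u"
  using geqI[OF assms(1), of "tm_src u" "tm_tgt u" "tm_deg u"] assms by (simp add: in_terms_iff)

section \<open>Signed sums of generators and the relations of the given category\<close>

lemma cls_gen_add:
  assumes "wft (TGen X Y d m)" "wft (TGen X Y d m')"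
  shows "eqv f (cls (TGen X Y d (m \<oplus>\<^bsub>sHom C X Y d\<^esub> m'))) (cls (TGen X Y d m) + cls (TGen X Y d m'))"
  by (rule eqv_trans[OF cls_geq[OF geq.gen_add[OF assms]] cls_add]) (use assms in auto)

lemma cls_gen_zero:
  assumes "X \<in> Ob C" "Y \<in> Ob C"
  shows "eqv f (cls (TGen X Y d \<zero>\<^bsub>sHom C X Y d\<^esub>)) 0"
proof -
  interpret M: module K "sHom C X Y d" by (rule sHom_module[OF assms])
  let ?Z = "TGen X Y d \<zero>\<^bsub>sHom C X Y d\<^esub> :: ('o, 'k, 'm) tm"
  have "eqv f (cls ?Z) (cls ?Z + cls ?Z)"
    using cls_gen_add[of X Y d "\<zero>\<^bsub>sHom C X Y d\<^esub>" "\<zero>\<^bsub>sHom C X Y d\<^esub>" f] assms by simp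
  then show ?thesis by (simp add: eqv_def) (metis null_combs_minus minus_minus)
qed

lemma cls_gen_neg:
  assumes "X \<in> Ob C" "Y \<in> Ob C" "m \<in> carrier (sHom C X Y d)"
  shows "eqv f (cls (TGen X Y d (\<ominus>\<^bsub>sHom C X Y d\<^esub> m))) (- cls (TGen X Y d m))"
proof -
  interpret M: module K "sHom C X Y d" by (rule sHom_module[OF assms(1,2)])
  have "eqv f (cls (TGen X Y d (m \<oplus>\<^bsub>sHom C X Y d\<^esub> (\<ominus>\<^bsub>sHom C X Y d\<^esub> m))))
      (cls (TGen X Y d m) + cls (TGen X Y d (\<ominus>\<^bsub>sHom C X Y d\<^esub> m)))"
    by (rule cls_gen_add) (use assms in auto)
  then have "eqv f (cls (TGen X Y d m) + cls (TGen X Y d (\<ominus>\<^bsub>sHom C X Y d\<^esub> m))) 0"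
    using eqv_trans[OF eqv_sym cls_gen_zero[OF assms(1,2), of f d]] assms(3) by (simp add: M.r_neg)
  then show ?thesis by (simp add: eqv_def add.commute)
qed

lemma cls_gen_finsum:
  assumes "X \<in> Ob C" "Y \<in> Ob C" "finite J" "\<And>j. j \<in> J \<Longrightarrow> m j \<in> carrier (sHom C X Y d)"
  shows "eqv f (cls (TGen X Y d (finsum (sHom C X Y d) (\<lambda>j. ksign (sHom C X Y d) (s j) (m j)) J)))
    (\<Sum>j\<in>J. frag_cmul (sg (s j)) (cls (TGen X Y d (m j))))"
  using assms(3,4)
proof (induction J)
  case empty
  interpret M: module K "sHom C X Y d" by (rule sHom_module[OF assms(1,2)])
  show ?case using cls_gen_zero[OF assms(1,2)] by simp
next
  case (insert j J)
  interpret M: module K "sHom C X Y d" by (rule sHom_module[OF assms(1,2)])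
  let ?F = "\<lambda>j. ksign (sHom C X Y d) (s j) (m j)"
  have cl: "?F i \<in> carrier (sHom C X Y d)" if "i \<in> insert j J" for i
    using insert.prems[OF that] by (simp add: ksign_def)
  have "eqv f (cls (TGen X Y d (?F j \<oplus>\<^bsub>sHom C X Y d\<^esub> finsum (sHom C X Y d) ?F J)))
     (cls (TGen X Y d (?F j)) + cls (TGen X Y d (finsum (sHom C X Y d) ?F J)))"
    by (rule cls_gen_add) (use assms(1,2) cl M.finsum_closed[of ?F J] in auto)
  also have "eqv f \<dots> (frag_cmul (sg (s j)) (cls (TGen X Y d (m j)))
      + (\<Sum>j\<in>J. frag_cmul (sg (s j)) (cls (TGen X Y d (m j)))))"
    using insert cls_gen_neg[OF assms(1,2)]
    by (intro eqv_add insert.IH) (auto simp: ksign_def sg_def)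
  finally show ?case
    using insert.hyps cl M.finsum_insert[of J j ?F] by auto
qed

lemma path_gen:
  assumes "path X (map gen xs) Y" "xs \<noteq> []"
  shows "composable C xs" "src (hd xs) = X" "tgt (last xs) = Y"
proof -
  have "tm_src (hd (map gen xs)) = X \<and> tm_tgt (last (map gen xs)) = Y"
    using path_endpoints[OF assms(1)] assms(2) by simp
  then show "src (hd xs) = X" "tgt (last xs) = Y"
    using assms(2) by (simp_all add: hd_map last_map gen_def)
  then show "composable C xs" using assms composable_path by simp
qed

text \<open>Carries the A-infinity relation of \<open>C\<close>, an equation in one module of
  \<open>C\<close>, to signed sums of generators. Contractions keep the endpoints and each raises
  the degree by 1, so all summands lie in that module.\<close>

lemma gen_relation:
  assumes "composable C xs"
  shows "eqv f (\<Sum>(u, v, z)\<in>decomps xs. frag_cmul (sg (total_deg z)) (cls (gen (barrow C (u @ barrow C v # z))))) 0"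
proof -
  let ?X = "src (hd xs)" and ?Y = "tgt (last xs)" and ?d = "total_deg xs + 2"
  let ?M = "sHom C ?X ?Y ?d"
  let ?I = "{(r, n). 1 \<le> n \<and> r + n \<le> length xs}"
  let ?ys = "\<lambda>r n. take r xs @ barrow C (take n (drop r xs)) # drop (r + n) xs"
  have XY: "?X \<in> Ob C" "?Y \<in> Ob C"
    using assms composable_path[of xs] path_Ob[of ?X "map gen xs" ?Y] by auto
  have ys: "composable C (?ys r n) \<and> src (hd (?ys r n)) = ?X \<and> tgt (last (?ys r n)) = ?Y
      \<and> total_deg (?ys r n) + 1 = ?d" if rn: "(r, n) \<in> ?I" for r n
  proof -
    let ?u = "take r xs" and ?v = "take n (drop r xs)" and ?z = "drop (r + n) xs"
    have xs: "?u @ ?v @ ?z = xs" by (rule take_take_drop)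
    have vne: "?v \<noteq> []" "xs \<noteq> []" using rn by auto
    have "path ?X (map gen (?u @ ?v @ ?z)) ?Y" using assms composable_path[of xs] by (simp only: xs)
    then obtain Z Z' where Z: "path ?X (map gen ?u) Z" "path Z (map gen ?v) Z'" "path Z' (map gen ?z) ?Y"
      by auto
    note v = path_gen(1)[OF Z(2) vne(1)] and e = path_gen(2,3)[OF Z(2) vne(1)]
    have g: "wft (gen (barrow C ?v))" "tm_src (gen (barrow C ?v)) = Z" "tm_tgt (gen (barrow C ?v)) = Z'"
      using wft_gen_barrow[OF v] e by (simp_all add: gen_def barrow_def)
    have p: "path ?X (map gen (?ys r n)) ?Y" using Z g by auto
    have "?ys r n \<noteq> []" by simp
    note e' = path_gen[OF p this]
    have "total_deg xs = total_deg ?u + total_deg ?v + total_deg ?z"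
      by (subst xs[symmetric]) (simp only: total_deg_def map_append sum_list_append add.assoc)
    then have "total_deg (?ys r n) + 1 = ?d" by (simp add: total_deg_def barrow_def)
    with e' show ?thesis by blast
  qed
  have "eqv f (cls (TGen ?X ?Y ?d (finsum ?M (\<lambda>x. ksign ?M (total_deg (drop (fst x + snd x) xs)) (bop C (?ys (fst x) (snd x)))) ?I)))
    (\<Sum>x\<in>?I. frag_cmul (sg (total_deg (drop (fst x + snd x) xs))) (cls (TGen ?X ?Y ?d (bop C (?ys (fst x) (snd x))))))"
  proof (rule cls_gen_finsum[OF XY finite_index])
    fix x assume "x \<in> ?I"
    then have "(fst x, snd x) \<in> ?I" by auto
    from ys[OF this] bop_closed[of "?ys (fst x) (snd x)"]
    show "bop C (?ys (fst x) (snd x)) \<in> carrier ?M" by (simp only:)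
  qed
  moreover have "finsum ?M (\<lambda>x. ksign ?M (total_deg (drop (fst x + snd x) xs)) (bop C (?ys (fst x) (snd x)))) ?I = \<zero>\<^bsub>?M\<^esub>"
    using ainf_relation[OF assms HOL.refl] by (simp only: split_def)
  moreover have "(\<Sum>x\<in>?I. frag_cmul (sg (total_deg (drop (fst x + snd x) xs))) (cls (TGen ?X ?Y ?d (bop C (?ys (fst x) (snd x))))))
    = (\<Sum>(u, v, z)\<in>decomps xs. frag_cmul (sg (total_deg z)) (cls (gen (barrow C (u @ barrow C v # z)))))"
    unfolding sum_dec_index
  proof (rule sum.cong)
    fix x assume "x \<in> ?I"
    then have "(fst x, snd x) \<in> ?I" by auto
    from ys[OF this] have "gen (barrow C (?ys (fst x) (snd x))) = TGen ?X ?Y ?d (bop C (?ys (fst x) (snd x)))"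
      by (simp add: gen_def barrow_def)
    then show "frag_cmul (sg (total_deg (drop (fst x + snd x) xs))) (cls (TGen ?X ?Y ?d (bop C (?ys (fst x) (snd x))))) =
      (case x of (r, n) \<Rightarrow> frag_cmul (sg (total_deg (drop (r + n) xs))) (cls (gen (barrow C (?ys r n)))))"
      by (simp add: case_prod_beta)
  qed simp
  ultimately show ?thesis using eqv_trans[OF eqv_sym cls_gen_zero[OF XY]] by simp
qed

lemma Bt_gen:
  assumes "composable C v" "f"
  shows "geq f (Bt (map gen v)) (gen (barrow C v))"
proof (cases "length v = 1")
  case True
  then obtain x where v: "v = [x]" by (auto simp: length_Suc_conv)
  have "Bt (map gen v) = gen (barrow C v)" by (simp add: v gen_def barrow_def total_deg_def)
  then show ?thesis using geq.refl wft_gen_barrow[OF assms(1)] by metis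
next
  case False
  then have "length v \<ge> 2" using assms(1) by (cases v rule: list.exhaust) (auto simp: Suc_le_eq composable_def)
  then show ?thesis using geq.base[OF assms(2,1)] by (simp add: Bt_TB)
qed

lemma composable_dec:
  assumes "composable C xs" "(u, v, z) \<in> decomps xs"
  shows "composable C v" "composable C (u @ barrow C v # z)"
proof -
  have xs: "xs = u @ v @ z" "v \<noteq> []" using assms(2) by (auto simp: decomps_def)
  obtain Z Z' where Z: "path (src (hd xs)) (map gen u) Z" "path Z (map gen v) Z'"
    "path Z' (map gen z) (tgt (last xs))"
    using assms(1) composable_path[of xs] xs(1) by auto
  note v = path_gen[OF Z(2) xs(2)]
  then show "composable C v" by simp
  have "path (src (hd xs)) (map gen (u @ barrow C v # z)) (tgt (last xs))"
    using Z v wft_gen_barrow[OF v(1)] by (auto simp: gen_def barrow_def)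
  from path_gen(1)[OF this] show "composable C (u @ barrow C v # z)" by simp
qed

text \<open>The rule \<open>base\<close> replaces first the inner contraction by its value in
  \<open>C\<close> and then the outer one, which is again a word of generators.\<close>

lemma b1_summand_gen:
  assumes "composable C xs" "(u, v, z) \<in> decomps xs" "u \<noteq> [] \<or> z \<noteq> []" f
  shows "eqv f (b1_summand (map gen u) (map gen v) (map gen z))
    (frag_cmul (sg (total_deg z)) (cls (gen (barrow C (u @ barrow C v # z)))))"
proof -
  have "eqv f (cls (TB (map gen u @ Bt (map gen v) # map gen z))) (cls (TB (map gen u @ gen (barrow C v) # map gen z)))"
    using multilinearD(2)[OF cls_slot] Bt_gen[OF composable_dec(1)[OF assms(1,2)] assms(4)] by blast
  also have "eqv f \<dots> (cls (gen (barrow C (u @ barrow C v # z))))"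
    using cls_geq[OF geq.base[OF assms(4) composable_dec(2)[OF assms(1,2)]]] assms(3) by (cases u; cases z) auto
  finally show ?thesis using assms(3) by (auto simp: b1_summand_def intro: eqv_cmul)
qed

lemma sum_dec_map:
  "(\<Sum>(u, v, z)\<in>decomps (map h xs). g u v z) = (\<Sum>(u, v, z)\<in>decomps xs. g (map h u) (map h v) (map h z))"
  unfolding sum_dec_index by (simp add: take_map drop_map)

text \<open>The stability of R_C under the differential. Modulo \<open>base\<close> every proper
  contraction takes its value in \<open>C\<close>, and the relation in \<open>C\<close> expresses
  their sum by the one remaining contraction, that of the whole word followed by
  \<open>b_1\<close>.\<close>

lemma b1_sum_gen:
  assumes "composable C xs" "length xs \<ge> 2" f
  shows "eqv f (- b1_sum (map gen xs)) (cls (gen (barrow C [barrow C xs])))"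
proof -
  let ?g = "\<lambda>(u, v, z). frag_cmul (sg (total_deg z)) (cls (gen (barrow C (u @ barrow C v # z))))"
  have ne: "xs \<noteq> []" using assms(2) by auto
  have "b1_sum (map gen xs) = (\<Sum>(u, v, z)\<in>decomps xs. b1_summand (map gen u) (map gen v) (map gen z))"
    by (simp add: b1_sum_def sum_dec_map)
  also have "\<dots> = (\<Sum>(u, v, z)\<in>decomps xs - {([], xs, [])}. b1_summand (map gen u) (map gen v) (map gen z))"
    by (rule sum.mono_neutral_right) (auto simp: b1_summand_def)
  also have "eqv f \<dots> (sum ?g (decomps xs - {([], xs, [])}))"
  proof (rule eqv_sum)
    fix x assume "x \<in> decomps xs - {([], xs, [])}"
    then obtain u v z where x: "x = (u, v, z)" "xs = u @ v @ z" "v \<noteq> []" "(u, v, z) \<noteq> ([], xs, [])"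
      by (auto simp: decomps_def)
    then have "u \<noteq> [] \<or> z \<noteq> []" by auto
    with b1_summand_gen[OF assms(1) _ this assms(3)] x(2,3)
    show "eqv f (case x of (u, v, z) \<Rightarrow> b1_summand (map gen u) (map gen v) (map gen z)) (?g x)"
      unfolding x(1) by (simp add: decomps_def)
  qed
  also have "sum ?g (decomps xs - {([], xs, [])}) = sum ?g (decomps xs) - cls (gen (barrow C [barrow C xs]))"
    using ne by (subst sum.remove[of "decomps xs" "([], xs, [])"]) (auto simp: total_deg_def)
  also have "eqv f \<dots> (0 - cls (gen (barrow C [barrow C xs])))"
    using gen_relation[OF assms(1)] by (intro eqv_diff) auto
  finally show ?thesis using eqv_minus by fastforce
qed

text \<open>At \<open>True\<close> this contains the stability of (R_C)_+ under \<open>b_1\<close>,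
  so that the differential descends to the quotient.\<close>

theorem geq_b1:
  assumes "geq f t u"
  shows "geq f (b1 t) (b1 u)"
proof (rule linear_preserves[where F = b1 and \<delta> = 1, OF _ _ _ _ _ _ _ _ _ _ _ _ _ assms])
  fix us t t' vs assume *: "geq f t t'" "geq f (b1 t) (b1 t')" "wft (TB (us @ t # vs))"
  have w: "wft (TB (us @ t' # vs))" using *(1,3) geq_wft wft_TB_replace by metis
  have "eqv f (cls (b1 (TB (us @ t # vs)))) (cls (b1 (TB (us @ t' # vs))))"
    using eqv_trans[OF b1_TB_GS[OF *(3)] eqv_trans[OF eqv_minus[OF b1_sum_cong[OF *(1,2)]] eqv_sym[OF b1_TB_GS[OF w]]]] .
  then show "geq f (b1 (TB (us @ t # vs))) (b1 (TB (us @ t' # vs)))"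
    using geq_wft[OF geq.cong_b[OF *(1,3)]] by (intro geqI') (auto simp del: tm_b1.simps(5))
next
  fix us t u vs assume w: "wft (TB (us @ TAdd t u # vs))"
  have tu: "wft (TAdd t u)" using w wft_TB_slot by blast
  have w': "wft (TB (us @ t # vs))" "wft (TB (us @ u # vs))"
    using geq_wft[OF geq.b_add[OF w]] by auto
  have eq: "geq f (TB (us @ TAdd t u # vs)) (TAdd (TB (us @ t # vs)) (TB (us @ u # vs)))"
    by (rule geq.b_add[OF w])
  then have wA: "wft (TAdd (b1 (TB (us @ t # vs))) (b1 (TB (us @ u # vs))))"
    using geq_wft[OF eq] w' by (auto simp del: tm_b1.simps(5))
  have "eqv f (cls (b1 (TB (us @ TAdd t u # vs)))) (- (b1_sum (us @ t # vs) + b1_sum (us @ u # vs)))"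
    by (rule eqv_trans[OF b1_TB_GS[OF w] eqv_minus[OF b1_sum_add[OF tu]]])
  also have "\<dots> = - b1_sum (us @ t # vs) + - b1_sum (us @ u # vs)" by simp
  also have "eqv f \<dots> (cls (b1 (TB (us @ t # vs))) + cls (b1 (TB (us @ u # vs))))"
    by (intro eqv_add eqv_sym[OF b1_TB_GS] w')
  also have "eqv f \<dots> (cls (TAdd (b1 (TB (us @ t # vs))) (b1 (TB (us @ u # vs)))))"
    by (rule eqv_sym[OF cls_add[OF wA]])
  finally show "geq f (b1 (TB (us @ TAdd t u # vs))) (TAdd (b1 (TB (us @ t # vs))) (b1 (TB (us @ u # vs))))"
    using geq_wft[OF eq] wA by (intro geqI') (auto simp del: tm_b1.simps(5))
next
  fix us r t vs assume w: "wft (TB (us @ TSmult r t # vs))"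
  have rt: "wft (TSmult r t)" using w wft_TB_slot by blast
  then have r: "r \<in> carrier K" by simp
  have eq: "geq f (TB (us @ TSmult r t # vs)) (TSmult r (TB (us @ t # vs)))"
    by (rule geq.b_smult[OF w])
  then have w': "wft (TB (us @ t # vs))" using geq_wft by force
  have "eqv f (cls (b1 (TB (us @ TSmult r t # vs)))) (- scale r (b1_sum (us @ t # vs)))"
    by (rule eqv_trans[OF b1_TB_GS[OF w] eqv_minus[OF b1_sum_smult[OF rt]]])
  also have "\<dots> = scale r (- b1_sum (us @ t # vs))" by simp
  also have "eqv f \<dots> (scale r (cls (b1 (TB (us @ t # vs)))))"
    by (rule scale_eqv[OF r eqv_sym[OF b1_TB_GS[OF w']]])
  also have "\<dots> = cls (TSmult r (b1 (TB (us @ t # vs))))" by (rule scale_cls[OF r])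
  finally show "geq f (b1 (TB (us @ TSmult r t # vs))) (TSmult r (b1 (TB (us @ t # vs))))"
    using geq_wft[OF eq] w' r by (intro geqI') (auto simp del: tm_b1.simps(5))
next
  fix t t' assume *: "geq f t t'" "geq f (b1 t) (b1 t')" "wft (TH t)" "wft (TH t')"
  then have "geq f (TH (b1 t)) (TH (b1 t'))" by (intro geq.cong_H) auto
  then show "geq f (b1 (TH t)) (b1 (TH t'))"
    using * unfolding tm_b1.simps tneg_def by (intro geq.cong_add geq.cong_smult) auto
next
  fix t u assume w: "wft (TH (TAdd t u))"
  then have w': "wft (TH (TAdd (b1 t) (b1 u)))" by auto
  have "eqv f (cls (b1 (TH (TAdd t u)))) (cls (TAdd t u) - cls (TH (TAdd (b1 t) (b1 u))))"
    unfolding tm_b1.simps by (rule cls_sub) (use w in auto)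
  also have "eqv f \<dots> ((cls t + cls u) - (cls (TH (b1 t)) + cls (TH (b1 u))))"
    by (intro eqv_diff cls_add cls_H_add w') (use w in auto)
  also have "\<dots> = (cls t - cls (TH (b1 t))) + (cls u - cls (TH (b1 u)))" by simp
  also have "eqv f \<dots> (cls (b1 (TH t)) + cls (b1 (TH u)))"
    unfolding tm_b1.simps by (intro eqv_add eqv_sym[OF cls_sub]) (use w in auto)
  also have "eqv f \<dots> (cls (TAdd (b1 (TH t)) (b1 (TH u))))"
    by (rule eqv_sym[OF cls_add]) (use w in auto)
  finally have "eqv f (cls (b1 (TH (TAdd t u)))) (cls (TAdd (b1 (TH t)) (b1 (TH u))))" .
  moreover have "wft (TH t)" "wft (TH u)" using w by auto
  ultimately show "geq f (b1 (TH (TAdd t u))) (TAdd (b1 (TH t)) (b1 (TH u)))"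
    using w by (intro geqI') (auto simp del: tm_b1.simps)
next
  fix r t assume w: "wft (TH (TSmult r t))"
  then have w': "wft (TH (TSmult r (b1 t)))" and r: "r \<in> carrier K" by auto
  have "eqv f (cls (b1 (TH (TSmult r t)))) (cls (TSmult r t) - cls (TH (TSmult r (b1 t))))"
    unfolding tm_b1.simps by (rule cls_sub) (use w in auto)
  also have "eqv f \<dots> (cls (TSmult r t) - scale r (cls (TH (b1 t))))"
    by (intro eqv_diff eqv_refl cls_H_smult w')
  also have "\<dots> = scale r (cls t - cls (TH (b1 t)))" by (simp add: scale_cls r)
  also have "eqv f \<dots> (scale r (cls (b1 (TH t))))"
    unfolding tm_b1.simps by (intro scale_eqv[OF r] eqv_sym[OF cls_sub]) (use w in auto)
  also have "\<dots> = cls (TSmult r (b1 (TH t)))" by (rule scale_cls[OF r])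
  finally show "geq f (b1 (TH (TSmult r t))) (TSmult r (b1 (TH t)))"
    using w by (intro geqI') auto
next
  fix xs assume *: f "composable C xs" "length xs \<ge> 2"
  have p: "path (src (hd xs)) (map gen xs) (tgt (last xs))" using *(2) composable_path by simp
  have w: "wft (TB (map gen xs))" using wft_TB[OF p] *(3) by simp
  have "eqv f (cls (b1 (TB (map gen xs)))) (cls (gen (barrow C [barrow C xs])))"
    by (rule eqv_trans[OF b1_TB_GS[OF w] b1_sum_gen[OF *(2,3,1)]])
  moreover have "gen (barrow C [barrow C xs]) = b1 (gen (barrow C xs))"
    by (simp add: gen_def barrow_def total_deg_def)
  ultimately show "geq f (b1 (TB (map gen xs))) (b1 (gen (barrow C xs)))"
    using geq_wft[OF geq.base[OF *]] by (intro geqI') (auto simp del: tm_b1.simps)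
next
  fix X Y d m m' assume *: "wft (TGen X Y d m)" "wft (TGen X Y d m')"
  have "bop C [Arrow X Y d (m \<oplus>\<^bsub>sHom C X Y d\<^esub> m')] = bop C [Arrow X Y d m] \<oplus>\<^bsub>sHom C X Y (d + 1)\<^esub> bop C [Arrow X Y d m']"
    using bop_add[OF HOL.refl, of "[]" X Y d m "[]" m'] * by (simp add: composable_def arrows_def total_deg_def)
  then show "geq f (b1 (TGen X Y d (m \<oplus>\<^bsub>sHom C X Y d\<^esub> m'))) (TAdd (b1 (TGen X Y d m)) (b1 (TGen X Y d m')))"
    using geq.gen_add[of X Y "d + 1" "bop C [Arrow X Y d m]" "bop C [Arrow X Y d m']" f]
      wft_b1[OF *(1)] wft_b1[OF *(2)] by simp
next
  fix X Y d r m assume *: "r \<in> carrier K" "wft (TGen X Y d m)"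
  have "bop C [Arrow X Y d (r \<odot>\<^bsub>sHom C X Y d\<^esub> m)] = r \<odot>\<^bsub>sHom C X Y (d + 1)\<^esub> bop C [Arrow X Y d m]"
    using bop_smult[OF HOL.refl *(1), of "[]" X Y d m "[]"] * by (simp add: composable_def arrows_def total_deg_def)
  then show "geq f (b1 (TGen X Y d (r \<odot>\<^bsub>sHom C X Y d\<^esub> m))) (TSmult r (b1 (TGen X Y d m)))"
    using geq.gen_smult[of r X Y "d + 1" "bop C [Arrow X Y d m]" f] wft_b1[OF *(2)] *(1) by simp
qed auto

section \<open>The differential squares to zero\<close>

lemma multilinear_b1: "multilinear f (\<lambda>t. if wft t then cls (b1 t) else 0)"
  unfolding multilinear_def
proof (intro conjI allI impI)
  fix t u assume "geq f t u"
  then show "eqv f (if wft t then cls (b1 t) else 0) (if wft u then cls (b1 u) else 0)"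
    using cls_geq[OF geq_b1] geq_wft by auto
next
  fix t u assume "wft (TAdd t u)"
  then show "eqv f (if wft (TAdd t u) then cls (b1 (TAdd t u)) else 0)
     ((if wft t then cls (b1 t) else 0) + (if wft u then cls (b1 u) else 0))"
    by (auto intro!: cls_add)
qed (auto simp: scale_cls)

text \<open>Inserts a signed sum between \<open>u\<close> and \<open>z\<close> and applies the
  operation to the resulting word. If \<open>u\<close> and \<open>z\<close> are empty this is
  \<open>b1\<close>, and well-formedness of the argument is tested explicitly so that the map
  vanishes on ill-formed terms.\<close>

definition slot :: "('o, 'k, 'm) tm list \<Rightarrow> ('o, 'k, 'm) tm list \<Rightarrow> (('o, 'k, 'm) tm \<Rightarrow>\<^sub>0 int)
    \<Rightarrow> (('o, 'k, 'm) tm \<Rightarrow>\<^sub>0 int)" where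
  "slot u z = frag_extend (\<lambda>t. if u = [] \<and> z = [] then if wft t then cls (b1 t) else 0 else cls (TB (u @ t # z)))"

lemma multilinear_extend:
  assumes "multilinear f g" "eqv f x y"
  shows "eqv f (frag_extend g x) (frag_extend g y)"
  by (rule eqv_extend[OF assms(2)]) (use multilinearD[OF assms(1)] in auto)

lemma slot_eqv:
  assumes "eqv f x y"
  shows "eqv f (slot u z x) (slot u z y)"
  unfolding slot_def using multilinear_extend[OF multilinear_b1 assms] multilinear_extend[OF cls_slot assms]
  by (cases "u = [] \<and> z = []") auto

lemma slot_simps:
  "slot u z 0 = 0" "slot u z (frag_cmul c x) = frag_cmul c (slot u z x)"
  "finite I \<Longrightarrow> slot u z (sum g I) = (\<Sum>i\<in>I. slot u z (g i))"
  "wft t \<Longrightarrow> slot u z (cls t) = cls (Bt (u @ t # z))"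
  by (auto simp: slot_def frag_extend_cmul frag_extend_sum o_def frag_extend_cls Bt_slot)

text \<open>Both sides sum over the ways of contracting two subwords: on the left, the contractions of
  disjoint subwords cancel in pairs by the sign rule, so that only the nested ones remain.\<close>

lemma bb_contract:
  assumes p: "path X w Y"
  shows "(\<Sum>(u, v, z)\<in>decomps w. frag_cmul (sg (ldeg z)) (bb (u @ Bt v # z))) =
    (\<Sum>(u, m, z)\<in>decomps w. slot u z (bb m))"
proof -
  let ?T = "\<lambda>a b c d e. cls (Bt (a @ Bt b # c @ Bt d # e))"
  let ?Q = "{(a, b, c, d, e). w = a @ b @ c @ d @ e \<and> b \<noteq> [] \<and> d \<noteq> []}"
  have degB: "tm_deg (Bt v) = ldeg v + 1" if "(u, v, z) \<in> decomps w" for u v z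
    using path_dec(3)[OF p that] .
  \<comment> \<open>\<open>Bt v\<close> is the marked letter of the contracted word. A second
    contraction to its left has to move past it, and its degree exceeds that of \<open>v\<close> by
    1; this is the source of the minus sign in the first sum.\<close>
  have expand: "frag_cmul (sg (ldeg z)) (bb (u @ Bt v # z)) =
      (\<Sum>(a, b, c)\<in>decomps u. frag_cmul (- (sg (ldeg c) * sg (ldeg v))) (?T a b c v z))
    + (\<Sum>(c, d, e)\<in>decomps z. frag_cmul (sg (ldeg c) * sg (ldeg d)) (?T u v c d e))
    + (\<Sum>(u1, u2)\<in>splits u. \<Sum>(z1, z2)\<in>splits z. frag_cmul (sg (ldeg z1)) (cls (Bt (u1 @ Bt (u2 @ Bt v # z1) # z2))))"
    if "(u, v, z) \<in> decomps w" for u v z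
    unfolding bb_def sum_dec_insert frag_cmul_distrib2 frag_cmul_sum
    using degB[OF that]
    by (intro arg_cong2[of _ _ _ _ "(+)"] sum.cong)
      (auto simp: sg_add mult_ac frag_cmul_sum decomps_def splits_def intro!: sum.cong)
  have "(\<Sum>(u, v, z)\<in>decomps w. frag_cmul (sg (ldeg z)) (bb (u @ Bt v # z))) =
      (\<Sum>(u, v, z)\<in>decomps w. \<Sum>(a, b, c)\<in>decomps u. frag_cmul (- (sg (ldeg c) * sg (ldeg v))) (?T a b c v z))
    + (\<Sum>(u, v, z)\<in>decomps w. \<Sum>(c, d, e)\<in>decomps z. frag_cmul (sg (ldeg c) * sg (ldeg d)) (?T u v c d e))
    + (\<Sum>(u, v, z)\<in>decomps w. \<Sum>(u1, u2)\<in>splits u. \<Sum>(z1, z2)\<in>splits z. frag_cmul (sg (ldeg z1)) (cls (Bt (u1 @ Bt (u2 @ Bt v # z1) # z2))))"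
    unfolding sum.distrib[symmetric] by (rule sum.cong) (use expand in auto)
  also have "\<dots> = (\<Sum>(a, b, c, d, e)\<in>?Q. frag_cmul (- (sg (ldeg c) * sg (ldeg d))) (?T a b c d e))
      + (\<Sum>(a, b, c, d, e)\<in>?Q. frag_cmul (sg (ldeg c) * sg (ldeg d)) (?T a b c d e))
      + (\<Sum>(u1, m, z2)\<in>decomps w. \<Sum>(u2, v, z1)\<in>decomps m. frag_cmul (sg (ldeg z1)) (cls (Bt (u1 @ Bt (u2 @ Bt v # z1) # z2))))"
    unfolding sum_dec_left sum_dec_right sum_dec_nested ..
  also have "(\<Sum>(a, b, c, d, e)\<in>?Q. frag_cmul (- (sg (ldeg c) * sg (ldeg d))) (?T a b c d e))
      + (\<Sum>(a, b, c, d, e)\<in>?Q. frag_cmul (sg (ldeg c) * sg (ldeg d)) (?T a b c d e)) = 0"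
    unfolding sum.distrib[symmetric]
    by (rule sum.neutral) (auto simp: simp flip: frag_cmul_distrib minus_frag_cmul)
  also have "0 + (\<Sum>(u1, m, z2)\<in>decomps w. \<Sum>(u2, v, z1)\<in>decomps m. frag_cmul (sg (ldeg z1)) (cls (Bt (u1 @ Bt (u2 @ Bt v # z1) # z2))))
      = (\<Sum>(u1, m, z2)\<in>decomps w. slot u1 z2 (bb m))"
  proof -
    have "(\<Sum>(u2, v, z1)\<in>decomps m. frag_cmul (sg (ldeg z1)) (cls (Bt (u1 @ Bt (u2 @ Bt v # z1) # z2)))) = slot u1 z2 (bb m)"
      if "(u1, m, z2) \<in> decomps w" for u1 m z2
    proof -
      from path_dec(5)[OF p that] obtain Z Z' where m: "path Z m Z'" by blast
      have "slot u1 z2 (bb m) = (\<Sum>x\<in>decomps m. slot u1 z2 (case x of (u2, v, z1) \<Rightarrow> frag_cmul (sg (ldeg z1)) (cls (Bt (u2 @ Bt v # z1)))))"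
        unfolding bb_def by (simp add: slot_simps)
      also have "\<dots> = (\<Sum>(u2, v, z1)\<in>decomps m. frag_cmul (sg (ldeg z1)) (cls (Bt (u1 @ Bt (u2 @ Bt v # z1) # z2))))"
      proof (rule sum.cong)
        fix x assume "x \<in> decomps m"
        then obtain u2 v z1 where x: "x = (u2, v, z1)" "(u2, v, z1) \<in> decomps m" by (cases x) auto
        have "wft (Bt (u2 @ Bt v # z1))" using path_Bt(1)[OF path_dec(1)[OF m x(2)]] by simp
        then show "slot u1 z2 (case x of (u2, v, z1) \<Rightarrow> frag_cmul (sg (ldeg z1)) (cls (Bt (u2 @ Bt v # z1))))
          = (case x of (u2, v, z1) \<Rightarrow> frag_cmul (sg (ldeg z1)) (cls (Bt (u1 @ Bt (u2 @ Bt v # z1) # z2))))"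
          by (simp add: x(1) slot_simps)
      qed simp
      finally show ?thesis by simp
    qed
    then show ?thesis by (auto intro!: sum.cong)
  qed
  finally show ?thesis .
qed

text \<open>For a \<open>TB\<close> term \<open>bb_contract\<close> is applied. On its left all
  words but the contraction of the whole of \<open>w\<close> have at least two letters, so their
  \<open>bb\<close> is null and \<open>b1 (b1 (TB w))\<close> remains. On its right the factors with
  at least two letters vanish for the same reason, and single letters by induction.\<close>

theorem b1_b1: "wft t \<Longrightarrow> eqv f (cls (b1 (b1 t))) 0"
proof (induction t)
  case (TGen X Y d m)
  then have "composable C [Arrow X Y d m]" by (simp add: composable_def arrows_def)
  from gen_relation[OF this, of f] show ?case
    by (simp add: gen_def barrow_def total_deg_def)
next
  case (TZero X Y d)
  then show ?case by (simp add: cls_zero)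
next
  case (TAdd t u)
  then have "eqv f (cls (b1 (b1 (TAdd t u)))) (cls (b1 (b1 t)) + cls (b1 (b1 u)))"
    by (simp add: cls_add)
  also have "eqv f \<dots> (0 + 0)" using TAdd by (intro eqv_add) auto
  finally show ?case by simp
next
  case (TSmult r t)
  then have "eqv f (scale r (cls (b1 (b1 t)))) (scale r 0)" by (intro scale_eqv) auto
  with TSmult show ?case by (simp add: scale_cls)
next
  case (TH t)
  then have t: "wft t" "wft (TH t)" by auto
  have "eqv f (cls (b1 (b1 (TH t)))) (cls (b1 t) - cls (b1 (TH (b1 t))))"
    unfolding tm_b1.simps(6)[of K C t] tm_b1.simps(3) tneg_def tm_b1.simps(4) unfolding tneg_def[symmetric]
    by (rule cls_sub) (use t in simp)
  also have "eqv f \<dots> (cls (b1 t) - (cls (b1 t) - cls (TH (b1 (b1 t)))))"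
    unfolding tm_b1.simps(6)[of K C "b1 t"] by (intro eqv_diff eqv_refl cls_sub) (use t in simp)
  also have "\<dots> = cls (TH (b1 (b1 t)))" by simp
  also have "eqv f \<dots> 0" by (rule cls_H_eqv_0) (use TH t in auto)
  finally show ?case .
next
  case (TB w)
  then obtain X Y where p: "length w \<ge> 2" "path X w Y" by (elim wft_TBE)
  have ne: "w \<noteq> []" using p(1) by auto
  let ?g = "\<lambda>(u, v, z). frag_cmul (sg (ldeg z)) (bb (u @ Bt v # z))"
  have "cls (b1 (b1 (TB w))) = ?g ([], w, [])" using p(1) by (simp add: bb_single Bt_TB)
  also have "\<dots> = sum ?g (decomps w) - sum ?g (decomps w - {([], w, [])})"
    using ne by (subst sum.remove[of "decomps w" "([], w, [])"]) auto
  also have "eqv f \<dots> (sum ?g (decomps w) - (\<Sum>x\<in>decomps w - {([], w, [])}. 0))"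
  proof (intro eqv_diff eqv_refl eqv_sum)
    fix x assume "x \<in> decomps w - {([], w, [])}"
    then obtain u v z where x: "x = (u, v, z)" "(u, v, z) \<in> decomps w" "(u, v, z) \<noteq> ([], w, [])"
      by (cases x) auto
    then have uz: "u \<noteq> [] \<or> z \<noteq> []" by (auto simp: decomps_def)
    have "eqv f (bb (u @ Bt v # z)) 0"
      by (rule bb_eqv_0[OF path_dec(1)[OF p(2) x(2)] length_slot[OF uz]])
    then show "eqv f (?g x) 0" using eqv_cmul[of f "bb (u @ Bt v # z)" 0] by (simp add: x(1))
  qed
  also have "\<dots> = (\<Sum>(u, m, z)\<in>decomps w. slot u z (bb m))" using bb_contract[OF p(2)] by simp
  also have "eqv f \<dots> (\<Sum>x\<in>decomps w. 0)"
  proof (rule eqv_sum)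
    fix x assume "x \<in> decomps w"
    then obtain u m z where x: "x = (u, m, z)" "(u, m, z) \<in> decomps w" by (cases x) auto
    obtain Z Z' where m: "path Z m Z'" "m \<noteq> []" using path_dec(4,5)[OF p(2) x(2)] by blast
    have "eqv f (bb m) 0"
    proof (cases "length m = 1")
      case True
      then obtain t where t: "m = [t]" by (auto simp: length_Suc_conv)
      then have "t \<in> set w" "wft t" using path_dec(6)[OF p(2) x(2)] m by auto
      then show ?thesis using TB.IH t by (simp add: bb_single)
    next
      case False
      then have "length m \<ge> 2" using m(2) by (cases m rule: list.exhaust) (auto simp: Suc_le_eq)
      then show ?thesis using bb_eqv_0 m by blast
    qed
    then have "eqv f (slot u z (bb m)) (slot u z 0)" by (rule slot_eqv)
    then show "eqv f (case x of (u, m, z) \<Rightarrow> slot u z (bb m)) 0" by (simp add: x(1) slot_simps)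
  qed
  finally show ?case by simp
qed

lemma bb_relation:
  assumes "path X w Y" "w \<noteq> []"
  shows "eqv f (bb w) 0"
proof (cases "length w = 1")
  case True
  then obtain t where t: "w = [t]" by (auto simp: length_Suc_conv)
  then show ?thesis using assms b1_b1 by (simp add: bb_single)
next
  case False
  then have "length w \<ge> 2" using assms(2) by (cases w rule: list.exhaust) (auto simp: Suc_le_eq)
  then show ?thesis using bb_eqv_0 assms by blast
qed

section \<open>The free category\<close>

abbreviation "E \<equiv> free_ainf K C B"
abbreviation "R \<equiv> R_plus K C B"

lemma tm_rel_Image: "tm_rel K C B `` {t} = tm_class False t"
  by (auto simp: tm_rel_def tm_class_def geq_False)

lemma free_module_eq: "free_module K C B X Y d = class_module False X Y d"
  by (auto simp: free_module_def class_module_def tm_rel_Image quotient_def intro!: ext)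

lemma sHom_free: "sHom E X Y d = class_module False X Y d"
  by (simp add: sHom_def free_ainf_def free_module_eq)

definition arrow_of :: "(('o, 'k, 'm) tm \<Rightarrow> 'e) \<Rightarrow> ('o, 'k, 'm) tm \<Rightarrow> ('o, 'e) arrow" where
  "arrow_of \<pi> t = Arrow (tm_src t) (tm_tgt t) (tm_deg t) (\<pi> t)"

lemma arrow_of_simps [simp]: "src (arrow_of \<pi> t) = tm_src t" "tgt (arrow_of \<pi> t) = tm_tgt t"
    "deg (arrow_of \<pi> t) = tm_deg t" "el (arrow_of \<pi> t) = \<pi> t" "total_deg (map (arrow_of \<pi>) ts) = ldeg ts"
  by (simp_all add: arrow_of_def total_deg_def o_def)

text \<open>Words of classes lift to words of terms letter by letter. Composability is unaffected
  because an arrow carries the endpoints of its representing term.\<close>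

lemma composable_arw:
  assumes "arrows A = arrow_of \<pi> ` {t. wft t}"
  shows "composable A xs \<longleftrightarrow> (\<exists>ts X Y. xs = map (arrow_of \<pi>) ts \<and> path X ts Y \<and> ts \<noteq> [])"
proof
  assume *: "composable A xs"
  then have "xs \<in> map (arrow_of \<pi>) ` lists {t. wft t}"
    unfolding lists_image[symmetric] by (simp add: composable_def assms in_lists_conv_set subset_iff)
  then obtain ts where ts: "xs = map (arrow_of \<pi>) ts" "set ts \<subseteq> {t. wft t}"
    by (auto simp: in_lists_conv_set)
  then show "\<exists>ts X Y. xs = map (arrow_of \<pi>) ts \<and> path X ts Y \<and> ts \<noteq> []"
    using * by (intro exI[of _ ts]) (auto simp: composable_def successively_map path_iff)
next
  assume "\<exists>ts X Y. xs = map (arrow_of \<pi>) ts \<and> path X ts Y \<and> ts \<noteq> []"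
  then show "composable A xs"
    by (auto simp: composable_def assms successively_map path_iff)
qed

lemma map_arw_ends:
  assumes "path X ts Y" "ts \<noteq> []"
  shows "src (hd (map (arrow_of \<pi>) ts)) = X" "tgt (last (map (arrow_of \<pi>) ts)) = Y"
  using path_endpoints[OF assms] assms(2) by (simp_all add: hd_map last_map)

lemma arrows_represented:
  assumes "Ob A = Ob C" "\<And>X Y d. X \<in> Ob C \<Longrightarrow> Y \<in> Ob C \<Longrightarrow> represents f X Y d (sHom A X Y d) \<pi>"
  shows "arrows A = arrow_of \<pi> ` {t. wft t}"
proof (intro equalityI subsetI)
  fix x assume x: "x \<in> arrows A"
  then have XY: "src x \<in> Ob C" "tgt x \<in> Ob C" and "el x \<in> carrier (sHom A (src x) (tgt x) (deg x))"
    by (auto simp: arrows_def assms(1))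
  then obtain t where "t \<in> tms (src x) (tgt x) (deg x)" "el x = \<pi> t"
    using representsD(1)[OF assms(2)[OF XY]] by auto
  then show "x \<in> arrow_of \<pi> ` {t. wft t}" by (cases x) (auto simp: in_terms_iff arrow_of_def intro!: image_eqI[of _ _ t])
next
  fix x assume "x \<in> arrow_of \<pi> ` {t. wft t}"
  then obtain t where t: "wft t" "x = arrow_of \<pi> t" by auto
  then show "x \<in> arrows A"
    using wft_Ob[OF t(1)] representsD(1)[OF assms(2), of "tm_src t" "tm_tgt t" "tm_deg t"]
    by (auto simp: arrows_def assms(1) in_terms_iff)
qed

abbreviation "ca \<equiv> arrow_of (tm_class False)"

lemma Ob_free [simp]: "Ob E = Ob C"
  by (simp add: free_ainf_def)

lemma arrows_free: "arrows E = ca ` {t. wft t}"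
  by (rule arrows_represented[where f = False]) (simp_all add: sHom_free represents_gmod)

lemmas composable_free = composable_arw[OF arrows_free]

lemma listset_gcl: "us \<in> listset (map (tm_class f) ts) \<longleftrightarrow> list_all2 (geq f) ts us"
  by (induction ts arbitrary: us) (auto simp: set_Cons_def tm_class_def list_all2_Cons1)

text \<open>The arguments are replaced one at a time, since \<open>cong_b\<close> changes a single
  letter; \<open>ws\<close> is the prefix already replaced.\<close>

lemma geq_TB_list:
  assumes "list_all2 (geq f) ts us" "path X (ws @ ts) Y" "length (ws @ ts) \<ge> 2"
  shows "geq f (TB (ws @ ts)) (TB (ws @ us)) \<and> path X (ws @ us) Y"
  using assms
proof (induction arbitrary: ws rule: list_all2_induct)
  case Nil
  then show ?case using wft_TB[of X ws Y] by (auto intro: geq.refl)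
next
  case (Cons t ts u us)
  have w: "wft (TB (ws @ t # ts))" using wft_TB Cons.prems by blast
  have p: "path X ((ws @ [u]) @ ts) Y" using Cons.prems(1) geq_wft[OF Cons.hyps(1)] by auto
  have "geq f (TB ((ws @ [u]) @ ts)) (TB ((ws @ [u]) @ us)) \<and> path X ((ws @ [u]) @ us) Y"
    by (rule Cons.IH[OF p]) (use Cons.prems in simp)
  moreover have "geq f (TB (ws @ t # ts)) (TB (ws @ u # ts))" by (rule geq.cong_b[OF Cons.hyps(1) w])
  ultimately show ?case using geq.trans by auto
qed

lemma geq_Bt_list:
  assumes "list_all2 (geq f) ts us" "path X ts Y" "ts \<noteq> []"
  shows "geq f (Bt ts) (Bt us)" "path X us Y" "us \<noteq> []"
proof -
  have l: "length us = length ts" using assms(1) by (simp add: list_all2_lengthD)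
  show "us \<noteq> []" using l assms(3) by auto
  have "geq f (Bt ts) (Bt us) \<and> path X us Y"
  proof (cases "length ts = 1")
    case True
    then obtain t u where tu: "ts = [t]" "us = [u]" "geq f t u"
      using assms(1) by (auto simp: length_Suc_conv list_all2_Cons1)
    then show ?thesis using geq_b1[OF tu(3)] geq_wft[OF tu(3)] assms(2) by auto
  next
    case False
    then have "length ts \<ge> 2" using assms(3) by (cases ts rule: list.exhaust) (auto simp: Suc_le_eq)
    then show ?thesis using geq_TB_list[OF assms(1), of X "[]" Y] assms(2) l by (simp add: Bt_TB)
  qed
  then show "geq f (Bt ts) (Bt us)" "path X us Y" by auto
qed

lemma path_geq_refl: "path X ts Y \<Longrightarrow> list_all2 (geq f) ts ts"
  by (induction ts arbitrary: X) (auto intro: geq.refl)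

lemma UN_const: "x \<in> A \<Longrightarrow> (\<And>y. y \<in> A \<Longrightarrow> F y = c) \<Longrightarrow> (\<Union>y\<in>A. F y) = c"
  by auto

lemma bop_free:
  assumes "path X ts Y" "ts \<noteq> []"
  shows "bop E (map ca ts) = tm_class False (Bt ts)"
proof -
  have els: "map el (map ca ts) = map (tm_class False) ts" by simp
  have "bop E (map ca ts) = (\<Union>us\<in>listset (map (tm_class False) ts). tm_class False (Bt us))"
  proof (cases "length ts = 1")
    case True
    then obtain t where "ts = [t]" by (auto simp: length_Suc_conv)
    then show ?thesis by (auto simp: free_ainf_def tm_rel_Image set_Cons_def)
  next
    case False
    have "Bt us = TB us" if "us \<in> listset (map (tm_class False) ts)" for us
      using that False by (auto simp: listset_gcl Bt_def dest: list_all2_lengthD)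
    with False show ?thesis unfolding free_ainf_def tm_rel_Image ainf.simps els by simp
  qed
  also have "\<dots> = tm_class False (Bt ts)"
  proof (rule UN_const)
    show "ts \<in> listset (map (tm_class False) ts)" using path_geq_refl[OF assms(1)] by (simp add: listset_gcl)
    fix us assume "us \<in> listset (map (tm_class False) ts)"
    then have "geq False (Bt ts) (Bt us)" using geq_Bt_list(1) assms by (simp add: listset_gcl)
    then show "tm_class False (Bt us) = tm_class False (Bt ts)" using tm_class_eq_iff geq_wft by blast
  qed
  finally show ?thesis .
qed

lemma arrow_of_Bt:
  assumes "path X ts Y" "ts \<noteq> []" "bop A (map (arrow_of \<pi>) ts) = \<pi> (Bt ts)"
  shows "barrow A (map (arrow_of \<pi>) ts) = arrow_of \<pi> (Bt ts)"
  using assms path_Bt[OF assms(1,2)] map_arw_ends[OF assms(1,2), of \<pi>] by (simp add: barrow_def arrow_of_def[of \<pi> "Bt ts"])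

lemma barrow_free: "path X ts Y \<Longrightarrow> ts \<noteq> [] \<Longrightarrow> barrow E (map ca ts) = ca (Bt ts)"
  by (rule arrow_of_Bt[OF _ _ bop_free])

lemma ca_eq_iff:
  assumes "wft t" "wft u"
  shows "ca t = ca u \<longleftrightarrow> geq False t u"
  using assms tm_class_eq_iff[of t False u] geq_wft[of False t u] by (auto simp: arrow_of_def)

lemma ca_eqI:
  assumes "eqv False (cls t) (cls u)" "wft t" "wft u" "tm_src t = tm_src u" "tm_tgt t = tm_tgt u" "tm_deg t = tm_deg u"
  shows "ca t = ca u"
  using geqI'[OF assms] ca_eq_iff assms(2,3) by simp

lemma Arrow_eq_ca: "Arrow X Y d c = ca t \<longleftrightarrow> tm_src t = X \<and> tm_tgt t = Y \<and> tm_deg t = d \<and> c = tm_class False t"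
  by (auto simp: arrow_of_def)

section \<open>The submodule of relations\<close>

lemma class_module_minus:
  assumes "t \<in> tms X Y d" "u \<in> tms X Y d"
  shows "tm_class f t \<ominus>\<^bsub>class_module f X Y d\<^esub> tm_class f u = tm_class f (TAdd t (tneg K u))"
  unfolding a_minus_def represents_neg[OF represents_gmod assms(2)]
  using representsD(3)[OF represents_gmod assms(1), of "tneg K u"] assms(2) by simp

lemma free_incl_eq: "free_incl K C B x = ca (gen x)"
  by (simp add: free_incl_def arrow_of_def gen_def tm_rel_Image)

lemma map_free_incl: "map (free_incl K C B) xs = map ca (map gen xs)"
  by (simp add: free_incl_eq)

lemma slot_diff: "slot u z (x - y) = slot u z x - slot u z y"
  by (simp add: slot_def frag_extend_diff)

lemma cls_TB_slot: "wft t \<Longrightarrow> length (us @ t # vs) \<ge> 2 \<Longrightarrow> cls (TB (us @ t # vs)) = slot us vs (cls t)"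
  by (simp add: slot_simps Bt_TB)

text \<open>The class of a term of \<open>P\<close> may contain terms outside \<open>P\<close>,
  hence a separate representative \<open>s\<close>. All representatives that lie in \<open>P\<close>
  have the same image under \<open>H\<close>.\<close>

lemma free_H_ca:
  assumes "wft t" "wft (TH s)" "geq False t s"
  shows "free_H K C B (ca t) = ca (TH s)"
proof -
  note d = geq_wft[OF assms(3)]
  have "(\<Union>t'\<in>{t' \<in> tm_class False t. in_P t'}. tm_class False (TH t')) = tm_class False (TH s)"
  proof (rule UN_const)
    show "s \<in> {t' \<in> tm_class False t. in_P t'}" using assms by (simp add: tm_class_def)
    fix t' assume t': "t' \<in> {t' \<in> tm_class False t. in_P t'}"
    then have *: "geq False s t'" "in_P t'" using assms(3) by (auto simp: tm_class_def intro: geq.trans geq.sym)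
    then have "geq False (TH s) (TH t')" using assms(2) geq_wft[OF *(1)] by (intro geq.cong_H) auto
    then show "tm_class False (TH t') = tm_class False (TH s)" using tm_class_eq_iff geq_wft by blast
  qed
  then show ?thesis using d by (simp add: free_H_def tm_rel_Image arrow_of_def)
qed

text \<open>Each closure property of (R_C)_+ preserves null combinations, by linearity or by a rule
  of \<open>geq True\<close>. In \<open>closed_b\<close> and \<open>closed_H\<close> representing
  terms have to be recovered from the arrows before these can be applied.\<close>

lemma R_plus_imp:
  "x \<in> R \<Longrightarrow> \<exists>t. wft t \<and> x = ca t \<and> eqv True (cls t) 0"
proof (induction rule: R_plus.induct)
  case (base xs X Y d)
  have ne: "xs \<noteq> []" using base.hyps(2) by auto
  have p: "path X (map gen xs) Y" using base.hyps composable_path by simp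
  have b: "geq True (TB (map gen xs)) (gen (barrow C xs))" using geq.base[of True xs] base.hyps by simp
  let ?t = "TAdd (TB (map gen xs)) (tneg K (gen (barrow C xs)))"
  have st: "TB (map gen xs) \<in> tms X Y d" "gen (barrow C xs) \<in> tms X Y d"
    using geq_wft[OF b] wft_TB[OF p] base.hyps by (auto simp: in_terms_iff)
  have "bop E (map (free_incl K C B) xs) = tm_class False (TB (map gen xs))"
    using bop_free[OF p] ne base.hyps(2) by (simp add: map_free_incl Bt_TB)
  then have "bop E (map (free_incl K C B) xs) \<ominus>\<^bsub>sHom E X Y d\<^esub> el (free_incl K C B (barrow C xs)) = tm_class False ?t"
    using class_module_minus[OF st, of False] by (simp add: sHom_free free_incl_eq)
  moreover have "eqv True (cls ?t) (cls (TB (map gen xs)) - cls (gen (barrow C xs)))"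
    by (rule cls_sub) (use st in \<open>auto simp: in_terms_iff\<close>)
  moreover have "eqv True (cls (TB (map gen xs)) - cls (gen (barrow C xs))) 0"
    using cls_geq[OF b] by (simp add: eqv_def)
  ultimately show ?case using st eqv_trans
    by (intro exI[of _ ?t]) (auto simp: Arrow_eq_ca in_terms_iff)
next
  case (zero X Y d)
  then show ?case using cls_zero
    by (intro exI[of _ "TZero X Y d"]) (auto simp: Arrow_eq_ca sHom_free class_module_def)
next
  case (add X Y d x y)
  then obtain t u where tu: "wft t" "Arrow X Y d x = ca t" "eqv True (cls t) 0"
    "wft u" "Arrow X Y d y = ca u" "eqv True (cls u) 0" by blast
  then have st: "t \<in> tms X Y d" "u \<in> tms X Y d" by (auto simp: Arrow_eq_ca in_terms_iff)
  have "eqv True (cls (TAdd t u)) (cls t + cls u)" using st by (intro cls_add) (auto simp: in_terms_iff)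
  also have "eqv True \<dots> (0 + 0)" by (intro eqv_add tu)
  finally show ?case using st tu representsD(3)[OF represents_gmod st, of False]
    by (intro exI[of _ "TAdd t u"]) (auto simp: Arrow_eq_ca in_terms_iff sHom_free)
next
  case (smult r X Y d x)
  then obtain t where t: "wft t" "Arrow X Y d x = ca t" "eqv True (cls t) 0" by blast
  then have st: "t \<in> tms X Y d" by (auto simp: Arrow_eq_ca in_terms_iff)
  have "eqv True (scale r (cls t)) (scale r 0)" by (intro scale_eqv smult t)
  then show ?case using st t smult.hyps representsD(4)[OF represents_gmod _ st, of r False]
    by (intro exI[of _ "TSmult r t"]) (auto simp: Arrow_eq_ca in_terms_iff sHom_free scale_cls)
next
  case (closed_b us x vs)
  obtain ts X Y where ts: "us @ x # vs = map ca ts" "path X ts Y" "ts \<noteq> []"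
    using closed_b.hyps(1) unfolding composable_free by blast
  then obtain us' t vs' where ts': "ts = us' @ t # vs'" "us = map ca us'" "x = ca t" "vs = map ca vs'"
    by (auto simp: append_eq_map_conv Cons_eq_map_conv)
  obtain s where s: "wft s" "x = ca s" "eqv True (cls s) 0" using closed_b.IH by blast
  have t: "wft t" using ts(2) ts'(1) by auto
  have "geq True s t" using s ts'(3) ca_eq_iff[OF s(1) t] geq_mono by auto
  then have "eqv True (cls t) 0" using cls_geq eqv_sym eqv_trans s(3) by blast
  then have "eqv True (slot us' vs' (cls t)) (slot us' vs' 0)" by (rule slot_eqv)
  moreover have l: "length (us' @ t # vs') \<ge> 2" using closed_b.hyps(2) ts' by simp
  ultimately have "eqv True (cls (TB ts)) 0" using cls_TB_slot[OF t l] ts'(1) by (simp add: slot_simps)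
  moreover have "barrow E (us @ x # vs) = ca (TB ts)"
    using barrow_free[OF ts(2,3)] l ts(1) ts'(1) by (simp add: Bt_TB)
  ultimately show ?case using wft_TB[OF ts(2)] l ts'(1) by auto
next
  case (closed_H x)
  obtain s where s: "wft s" "x = ca s" "eqv True (cls s) 0" using closed_H.IH by blast
  obtain t where t: "geq False s t" "in_P t" using closed_H.hyps(2) s by (auto simp: free_P_def tm_class_def)
  note d = geq_wft[OF t(1)]
  have "eqv True (cls t) 0" using cls_geq[OF geq_mono[OF t(1)]] eqv_sym eqv_trans s(3) by blast
  moreover have w: "wft (TH t)" using d t closed_H.hyps(3) s by auto
  ultimately have "eqv True (cls (TH t)) 0" by (rule cls_H_eqv_0)
  moreover have "free_H K C B x = ca (TH t)" using free_H_ca[OF s(1) w t(1)] s(2) by simp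
  ultimately show ?case using w by blast
qed

text \<open>Congruence modulo (R_C)_+ expressed by differences of terms. \<open>geq_imp_Rd\<close>
  shows that it contains \<open>geq True\<close>, which is the direction opposite to
  \<open>R_plus_imp\<close>.\<close>

definition R_related :: "('o, 'k, 'm) tm \<Rightarrow> ('o, 'k, 'm) tm \<Rightarrow> bool" where
  "R_related t u \<longleftrightarrow> ca (TAdd t (tneg K u)) \<in> R"

lemma R_zero:
  assumes "wft t" "eqv False (cls t) 0"
  shows "ca t \<in> R"
proof -
  let ?Z = "TZero (tm_src t) (tm_tgt t) (tm_deg t)"
  have "ca t = ca ?Z"
    by (rule ca_eqI) (use assms wft_Ob[OF assms(1)] eqv_trans[OF assms(2) eqv_sym[OF cls_zero]] in auto)
  also have "ca ?Z = Arrow (tm_src t) (tm_tgt t) (tm_deg t) \<zero>\<^bsub>sHom E (tm_src t) (tm_tgt t) (tm_deg t)\<^esub>"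
    by (simp add: arrow_of_def sHom_free class_module_def)
  also have "\<dots> \<in> R" by (rule R_plus.zero) (use wft_Ob[OF assms(1)] in auto)
  finally show ?thesis .
qed

lemma R_add:
  assumes "ca t \<in> R" "ca u \<in> R" "wft (TAdd t u)"
  shows "ca (TAdd t u) \<in> R"
proof -
  have "Arrow (tm_src t) (tm_tgt t) (tm_deg t) (tm_class False t) \<in> R" "Arrow (tm_src t) (tm_tgt t) (tm_deg t) (tm_class False u) \<in> R"
    using assms by (simp_all add: arrow_of_def)
  from R_plus.add[OF this] show ?thesis
    using assms(3) representsD(3)[OF represents_gmod, of t "tm_src t" "tm_tgt t" "tm_deg t" u False]
    by (simp add: arrow_of_def sHom_free in_terms_iff)
qed

lemma R_smult:
  assumes "ca t \<in> R" "r \<in> carrier K" "wft t"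
  shows "ca (TSmult r t) \<in> R"
  using R_plus.smult[of r K "tm_src t" "tm_tgt t" "tm_deg t" "tm_class False t" C B] assms
    representsD(4)[OF represents_gmod, of r t "tm_src t" "tm_tgt t" "tm_deg t" False]
  by (simp add: arrow_of_def sHom_free in_terms_iff)

lemma R_related_False:
  assumes "geq False t u"
  shows "R_related t u"
  unfolding R_related_def
proof (rule R_zero)
  note d = geq_wft[OF assms]
  show w: "wft (TAdd t (tneg K u))" using d by simp
  have "eqv False (cls (TAdd t (tneg K u))) (cls t - cls u)" by (rule cls_sub) (use w in simp)
  also have "eqv False \<dots> 0" using cls_geq[OF assms] by (simp add: eqv_def)
  finally show "eqv False (cls (TAdd t (tneg K u))) 0" .
qed

lemma ca_sub_eq:
  assumes "eqv False (cls s) (cls t - cls u)" "wft s" "wft (TAdd t u)" "tm_src s = tm_src t" "tm_tgt s = tm_tgt t"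
    "tm_deg s = tm_deg t"
  shows "ca s = ca (TAdd t (tneg K u))"
  by (rule ca_eqI) (use assms eqv_trans[OF assms(1) eqv_sym[OF cls_sub]] in auto)

text \<open>Symmetry, transitivity, sums and multiples hold because (R_C)_+ consists of submodules,
  the rules for arguments of \<open>TB\<close> and \<open>TH\<close> because it is closed under
  these operations, and \<open>base\<close> because it contains R_C. All other rules hold already
  for \<open>geq False\<close>, where the difference is 0.\<close>

lemma geq_imp_Rd: "geq True t u \<Longrightarrow> R_related t u"
proof (induction rule: geq.induct)
  case (sym t u)
  note d = geq_wft[OF sym.hyps]
  let ?s = "TAdd t (tneg K u)"
  have "ca (TSmult (\<ominus>\<^bsub>K\<^esub> \<one>\<^bsub>K\<^esub>) ?s) \<in> R" by (rule R_smult) (use sym d in \<open>auto simp: R_related_def\<close>)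
  moreover have "ca (TSmult (\<ominus>\<^bsub>K\<^esub> \<one>\<^bsub>K\<^esub>) ?s) = ca (TAdd u (tneg K t))"
    unfolding tneg_def[symmetric]
  proof (rule ca_sub_eq)
    show "eqv False (cls (tneg K ?s)) (cls u - cls t)"
      using eqv_trans[OF cls_neg eqv_minus[OF cls_sub[of t u False]]] d by simp
  qed (use d in auto)
  ultimately show ?case by (simp add: R_related_def)
next
  case (trans t u v)
  note d = geq_wft[OF trans.hyps(1)] geq_wft[OF trans.hyps(2)]
  have "ca (TAdd (TAdd t (tneg K u)) (TAdd u (tneg K v))) \<in> R"
    by (rule R_add) (use trans d in \<open>auto simp: R_related_def\<close>)
  moreover have "ca (TAdd (TAdd t (tneg K u)) (TAdd u (tneg K v))) = ca (TAdd t (tneg K v))"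
  proof (rule ca_sub_eq)
    have "eqv False (cls (TAdd (TAdd t (tneg K u)) (TAdd u (tneg K v)))) (cls (TAdd t (tneg K u)) + cls (TAdd u (tneg K v)))"
      by (rule cls_add) (use d in auto)
    also have "eqv False \<dots> ((cls t - cls u) + (cls u - cls v))" by (intro eqv_add cls_sub) (use d in auto)
    finally show "eqv False (cls (TAdd (TAdd t (tneg K u)) (TAdd u (tneg K v)))) (cls t - cls v)" by simp
  qed (use d in auto)
  ultimately show ?case by (simp add: R_related_def)
next
  case (cong_add t t' u u')
  note d = geq_wft[OF cong_add.hyps(1)] geq_wft[OF cong_add.hyps(2)] cong_add.hyps(3)
  have "ca (TAdd (TAdd t (tneg K t')) (TAdd u (tneg K u'))) \<in> R"
    by (rule R_add) (use cong_add.IH d in \<open>auto simp: R_related_def\<close>)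
  moreover have "ca (TAdd (TAdd t (tneg K t')) (TAdd u (tneg K u'))) = ca (TAdd (TAdd t u) (tneg K (TAdd t' u')))"
  proof (rule ca_sub_eq)
    have "eqv False (cls (TAdd (TAdd t (tneg K t')) (TAdd u (tneg K u')))) (cls (TAdd t (tneg K t')) + cls (TAdd u (tneg K u')))"
      by (rule cls_add) (use d in auto)
    also have "eqv False \<dots> ((cls t - cls t') + (cls u - cls u'))" by (intro eqv_add cls_sub) (use d in auto)
    also have "\<dots> = (cls t + cls u) - (cls t' + cls u')" by simp
    also have "eqv False \<dots> (cls (TAdd t u) - cls (TAdd t' u'))"
      by (intro eqv_diff eqv_sym[OF cls_add]) (use d in auto)
    finally show "eqv False (cls (TAdd (TAdd t (tneg K t')) (TAdd u (tneg K u')))) (cls (TAdd t u) - cls (TAdd t' u'))" .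
  qed (use d in auto)
  ultimately show ?case by (simp add: R_related_def)
next
  case (cong_smult t t' r)
  note d = geq_wft[OF cong_smult.hyps(1)] and r = cong_smult.hyps(2)
  let ?s = "TAdd t (tneg K t')"
  have "ca (TSmult r ?s) \<in> R" by (rule R_smult) (use cong_smult d in \<open>auto simp: R_related_def\<close>)
  moreover have "ca (TSmult r ?s) = ca (TAdd (TSmult r t) (tneg K (TSmult r t')))"
  proof (rule ca_sub_eq)
    show "eqv False (cls (TSmult r ?s)) (cls (TSmult r t) - cls (TSmult r t'))"
      using scale_eqv[OF r cls_sub[of t t' False]] d r by (simp add: scale_cls)
  qed (use d r in auto)
  ultimately show ?case by (simp add: R_related_def)
next
  case (cong_b t t' us vs)
  note d = geq_wft[OF cong_b.hyps(1)]
  let ?s = "TAdd t (tneg K t')"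
  note w = cong_b.hyps(2) wft_TB_replace[OF cong_b.hyps(2), of t'] wft_TB_replace[OF cong_b.hyps(2), of ?s]
  have ws: "wft (TB (us @ ?s # vs))" using w d by auto
  then obtain X Y where p: "length (us @ ?s # vs) \<ge> 2" "path X (us @ ?s # vs) Y" by (elim wft_TBE)
  have "barrow E (map ca us @ ca ?s # map ca vs) \<in> R"
  proof (rule R_plus.closed_b)
    have "map ca us @ ca ?s # map ca vs = map ca (us @ ?s # vs)" by simp
    then show "composable E (map ca us @ ca ?s # map ca vs)" unfolding composable_free using p(2) by blast
  qed (use p cong_b.IH in \<open>auto simp: R_related_def\<close>)
  also have "barrow E (map ca us @ ca ?s # map ca vs) = ca (TB (us @ ?s # vs))"
    using barrow_free[OF p(2)] p(1) by (simp add: Bt_TB)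
  also have "\<dots> = ca (TAdd (TB (us @ t # vs)) (tneg K (TB (us @ t' # vs))))"
  proof (rule ca_sub_eq)
    have "eqv False (slot us vs (cls ?s)) (slot us vs (cls t - cls t'))"
      by (intro slot_eqv cls_sub) (use d in simp)
    then show "eqv False (cls (TB (us @ ?s # vs))) (cls (TB (us @ t # vs)) - cls (TB (us @ t' # vs)))"
      using cls_TB_slot[of ?s us vs] cls_TB_slot[of t us vs] cls_TB_slot[of t' us vs] d p(1)
      by (simp add: slot_diff)
  qed (use w d in auto)
  finally show ?case by (simp add: R_related_def)
next
  case (cong_H t t')
  note d = geq_wft[OF cong_H.hyps(1)] and w = cong_H.hyps(2,3)
  let ?s = "TAdd t (tneg K t')"
  have ws: "wft (TH ?s)" using d w by auto
  have "free_H K C B (ca ?s) \<in> R"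
  proof (rule R_plus.closed_H)
    show "ca ?s \<in> free_P K C B"
      using ws geq.refl[of ?s False] unfolding free_P_def arrows_free by (auto simp: tm_class_def intro!: exI[of _ ?s])
  qed (use w cong_H.IH in \<open>auto simp: R_related_def\<close>)
  also have "free_H K C B (ca ?s) = ca (TH ?s)" by (rule free_H_ca) (use ws in \<open>auto intro: geq.refl\<close>)
  also have "\<dots> = ca (TAdd (TH t) (tneg K (TH t')))"
  proof (rule ca_sub_eq)
    have n: "wft (TH (tneg K t'))" using w by simp
    have "eqv False (cls (TH (tneg K t'))) (scale (\<ominus>\<^bsub>K\<^esub> \<one>\<^bsub>K\<^esub>) (cls (TH t')))"
      using n unfolding tneg_def by (rule cls_H_smult)
    also have "scale (\<ominus>\<^bsub>K\<^esub> \<one>\<^bsub>K\<^esub>) (cls (TH t')) = cls (tneg K (TH t'))" by (simp add: scale_cls tneg_def)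
    also have "eqv False \<dots> (- cls (TH t'))" by (rule cls_neg)
    finally have "eqv False (cls (TH t) + cls (TH (tneg K t'))) (cls (TH t) + - cls (TH t'))" by (intro eqv_add eqv_refl)
    then show "eqv False (cls (TH ?s)) (cls (TH t) - cls (TH t'))"
      using eqv_trans[OF cls_H_add[OF ws]] by simp
  qed (use w ws d in auto)
  finally show ?case by (simp add: R_related_def)
next
  case (base xs)
  have ne: "xs \<noteq> []" using base.hyps(3) by auto
  have p: "path (src (hd xs)) (map gen xs) (tgt (last xs))" using base.hyps composable_path by simp
  have b: "geq True (TB (map gen xs)) (gen (barrow C xs))" using geq.base[of True xs] base.hyps by simp
  let ?t = "TAdd (TB (map gen xs)) (tneg K (gen (barrow C xs)))"
  let ?X = "src (hd xs)" and ?Y = "tgt (last xs)" and ?d = "total_deg xs + 1"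
  have st: "TB (map gen xs) \<in> tms ?X ?Y ?d" "gen (barrow C xs) \<in> tms ?X ?Y ?d"
    using geq_wft[OF b] wft_TB[OF p] base.hyps by (auto simp: in_terms_iff)
  have "bop E (map (free_incl K C B) xs) = tm_class False (TB (map gen xs))"
    using bop_free[OF p] ne base.hyps(3) by (simp add: map_free_incl Bt_TB)
  then have "bop E (map (free_incl K C B) xs) \<ominus>\<^bsub>sHom E ?X ?Y ?d\<^esub> el (free_incl K C B (barrow C xs)) = tm_class False ?t"
    using class_module_minus[OF st, of False] by (simp add: sHom_free free_incl_eq)
  with R_plus.base[OF base.hyps(2,3) HOL.refl HOL.refl HOL.refl, of K B] st
  show ?case by (simp add: R_related_def arrow_of_def in_terms_iff)
qed (rule R_related_False, rule geq.intros; assumption)+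

lemma R_plus_iff:
  assumes "wft t"
  shows "ca t \<in> R \<longleftrightarrow> eqv True (cls t) 0"
proof
  assume "ca t \<in> R"
  then obtain s where s: "wft s" "ca t = ca s" "eqv True (cls s) 0" using R_plus_imp by blast
  then have "geq True t s" using ca_eq_iff assms geq_mono by blast
  then show "eqv True (cls t) 0" using s(3) cls_geq eqv_trans by blast
next
  assume *: "eqv True (cls t) 0"
  let ?Z = "TZero (tm_src t) (tm_tgt t) (tm_deg t)"
  have Z: "wft ?Z" using assms wft_Ob by simp
  have "geq True t ?Z"
    by (rule geqI') (use assms Z eqv_trans[OF * eqv_sym[OF cls_zero]] in auto)
  then have "ca (TAdd t (tneg K ?Z)) \<in> R" using geq_imp_Rd R_related_def by blast
  moreover have "ca t = ca (TAdd t (tneg K ?Z))"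
    by (rule ca_sub_eq) (use assms Z eqv_diff[OF eqv_refl eqv_sym[OF cls_zero], of False "cls t"] in auto)
  ultimately show "ca t \<in> R" by simp
qed

section \<open>The quotient category\<close>

abbreviation "Q \<equiv> Q_cat K C B"

text \<open>The coset of \<open>t\<close> modulo (R_C)_+, a set of classes of the free category: it
  collects the classes of all terms congruent to \<open>t\<close> under \<open>geq True\<close>.
  That this is the coset is \<open>coset_R\<close>.\<close>

definition Q_class :: "('o, 'k, 'm) tm \<Rightarrow> ('o, 'k, 'm) tm set set" where
  "Q_class t = tm_class False ` tm_class True t"

abbreviation "qa \<equiv> arrow_of Q_class"

lemma Q_class_eq_iff:
  assumes "wft t" "wft u"
  shows "Q_class t = Q_class u \<longleftrightarrow> geq True t u"
proof
  assume "Q_class t = Q_class u"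
  moreover have "t \<in> tm_class True t" using geq.refl[OF assms(1)] by (simp add: tm_class_def)
  ultimately have "tm_class False t \<in> Q_class u" unfolding Q_class_def by blast
  then obtain v where v: "geq True u v" "tm_class False t = tm_class False v" by (auto simp: Q_class_def tm_class_def)
  then have "geq False t v" using tm_class_eq_iff[OF assms(1)] by simp
  then show "geq True t u" using v(1) geq_mono geq.sym geq.trans by blast
next
  assume "geq True t u"
  then have "tm_class True t = tm_class True u" using tm_class_eq_iff[OF assms(1)] by blast
  then show "Q_class t = Q_class u" by (simp only: Q_class_def)
qed

lemma Q_class_UN:
  assumes "wft t" "\<And>u. geq True t u \<Longrightarrow> F (tm_class False u) = c"
  shows "(\<Union>x\<in>Q_class t. F x) = c"
  by (rule UN_const[of "tm_class False t"]) (use assms geq.refl[OF assms(1)] in \<open>auto simp: Q_class_def tm_class_def\<close>)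

lemma component_R: "component R X Y d = {tm_class False n | n. n \<in> tms X Y d \<and> eqv True (cls n) 0}"
proof (intro equalityI subsetI)
  fix c assume "c \<in> component R X Y d"
  then have "Arrow X Y d c \<in> R" by (simp add: component_def)
  with R_plus_imp obtain n where "wft n" "Arrow X Y d c = ca n" "eqv True (cls n) 0" by blast
  then show "c \<in> {tm_class False n | n. n \<in> tms X Y d \<and> eqv True (cls n) 0}"
    by (auto simp: Arrow_eq_ca in_terms_iff)
next
  fix c assume "c \<in> {tm_class False n | n. n \<in> tms X Y d \<and> eqv True (cls n) 0}"
  then obtain n where n: "c = tm_class False n" "n \<in> tms X Y d" "eqv True (cls n) 0" by blast
  then show "c \<in> component R X Y d"
    using R_plus_iff[of n] by (auto simp: component_def arrow_of_def in_terms_iff)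
qed

text \<open>A term \<open>u\<close> of the type of \<open>t\<close> is congruent to \<open>t\<close>
  exactly if \<open>u - t\<close> is null, that is, if its class belongs to the relations.
  Translating the relations by \<open>t\<close> therefore yields all congruent classes.\<close>

lemma coset_R:
  assumes t: "t \<in> tms X Y d"
  shows "component R X Y d +>\<^bsub>class_module False X Y d\<^esub> tm_class False t = Q_class t"
proof -
  note add = representsD(3)[OF represents_gmod, of _ X Y d _ False]
  have "component R X Y d +>\<^bsub>class_module False X Y d\<^esub> tm_class False t
      = {tm_class False (TAdd n t) | n. n \<in> tms X Y d \<and> eqv True (cls n) 0}"
    unfolding a_r_coset_def' component_R using add[OF _ t] by auto
  also have "\<dots> = Q_class t"
  proof (intro equalityI subsetI)
    fix c assume "c \<in> {tm_class False (TAdd n t) | n. n \<in> tms X Y d \<and> eqv True (cls n) 0}"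
    then obtain n where n: "c = tm_class False (TAdd n t)" "n \<in> tms X Y d" "eqv True (cls n) 0" by blast
    have "eqv True (cls (TAdd n t)) (cls n + cls t)" using n t by (intro cls_add) (auto simp: in_terms_iff)
    also have "eqv True \<dots> (0 + cls t)" by (intro eqv_add n eqv_refl)
    finally have "geq True t (TAdd n t)" using n(2) t by (intro geqI[OF eqv_sym]) auto
    then show "c \<in> Q_class t" using n(1) by (auto simp: Q_class_def tm_class_def)
  next
    fix c assume "c \<in> Q_class t"
    then obtain u where u: "geq True t u" "c = tm_class False u" by (auto simp: Q_class_def tm_class_def)
    have ut: "u \<in> tms X Y d" using geq_terms[OF u(1)] t by simp
    let ?n = "TAdd u (tneg K t)"
    have n: "?n \<in> tms X Y d" using ut t by simp
    have sub: "eqv f (cls ?n) (cls u - cls t)" for f using ut t by (intro cls_sub) (auto simp: in_terms_iff)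
    have "eqv True (cls u - cls t) (cls t - cls t)" by (intro eqv_diff eqv_sym[OF cls_geq[OF u(1)]] eqv_refl)
    then have n0: "eqv True (cls ?n) 0" using eqv_trans[OF sub] by simp
    have "eqv False (cls (TAdd ?n t)) (cls ?n + cls t)" using n t by (intro cls_add) (auto simp: in_terms_iff)
    also have "eqv False \<dots> ((cls u - cls t) + cls t)" by (intro eqv_add sub eqv_refl)
    finally have "geq False (TAdd ?n t) u" using n t ut by (intro geqI) auto
    then have "c = tm_class False (TAdd ?n t)" using u(2) tm_class_eq_iff geq_wft by blast
    then show "c \<in> {tm_class False (TAdd n t) | n. n \<in> tms X Y d \<and> eqv True (cls n) 0}" using n n0 by blast
  qed
  finally show ?thesis .
qed

lemma sHom_Q: "sHom Q X Y d = quotient_module (class_module False X Y d) (component R X Y d)"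
  by (simp add: sHom_def Q_cat_def quotient_ainf_def free_ainf_def free_module_eq)

lemma represents_Q:
  assumes XY: "X \<in> Ob C" "Y \<in> Ob C"
  shows "represents True X Y d (sHom Q X Y d) Q_class"
proof -
  note add = representsD(3)[OF represents_gmod, of _ X Y d _ False]
  note smult = representsD(4)[OF represents_gmod, of _ _ X Y d False]
  let ?N = "component R X Y d" and ?M = "class_module False X Y d"
  have "a_rcosets\<^bsub>?M\<^esub> ?N = Q_class ` tms X Y d"
    unfolding A_RCOSETS_def' representsD(1)[OF represents_gmod] using coset_R by auto
  moreover have "?N = Q_class (TZero X Y d)"
  proof (intro equalityI subsetI)
    fix c assume "c \<in> ?N"
    then obtain n where n: "c = tm_class False n" "n \<in> tms X Y d" "eqv True (cls n) 0" unfolding component_R by blast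
    then have "geq True (TZero X Y d) n"
      using XY by (intro geqI[OF eqv_trans[OF cls_zero eqv_sym]]) auto
    then show "c \<in> Q_class (TZero X Y d)" using n(1) by (auto simp: Q_class_def tm_class_def)
  next
    fix c assume "c \<in> Q_class (TZero X Y d)"
    then obtain u where u: "geq True (TZero X Y d) u" "c = tm_class False u" by (auto simp: Q_class_def tm_class_def)
    have "u \<in> tms X Y d" using geq_terms[OF u(1), of X Y d] XY by simp
    moreover have "eqv True (cls u) 0" using cls_geq[OF geq.sym[OF u(1)]] cls_zero eqv_trans by blast
    ultimately show "c \<in> ?N" using u(2) unfolding component_R by blast
  qed
  moreover have "Q_class t <+>\<^bsub>?M\<^esub> Q_class u = Q_class (TAdd t u)" if tu: "t \<in> tms X Y d" "u \<in> tms X Y d" for t u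
  proof (intro equalityI subsetI)
    fix c assume "c \<in> Q_class t <+>\<^bsub>?M\<^esub> Q_class u"
    then obtain t' u' where *: "geq True t t'" "geq True u u'" "c = tm_class False t' \<oplus>\<^bsub>?M\<^esub> tm_class False u'"
      unfolding set_add_def' by (auto simp: Q_class_def tm_class_def)
    then have "c = tm_class False (TAdd t' u')" using add geq_terms[OF *(1)] geq_terms[OF *(2)] tu by simp
    moreover have "geq True (TAdd t u) (TAdd t' u')" by (rule geq_TAdd[OF *(1,2) tu])
    ultimately show "c \<in> Q_class (TAdd t u)" by (auto simp: Q_class_def tm_class_def)
  next
    fix c assume "c \<in> Q_class (TAdd t u)"
    then obtain s where s: "geq True (TAdd t u) s" "c = tm_class False s" by (auto simp: Q_class_def tm_class_def)
    have st: "s \<in> tms X Y d" using geq_terms[OF s(1)] tu by (meson TAdd_in_terms)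
    \<comment> \<open>The element \<open>s\<close> of the class of the sum is written as
      \<open>(s - u) + u\<close>, whose first summand is congruent to \<open>t\<close>. This shows
      that the setwise sum of two cosets is the full coset of the sum.\<close>
    let ?t = "TAdd s (tneg K u)"
    have t: "?t \<in> tms X Y d" using st tu by simp
    have sub: "eqv f (cls ?t) (cls s - cls u)" for f using st tu by (intro cls_sub) (auto simp: in_terms_iff)
    have "eqv True (cls s) (cls t + cls u)"
      by (rule eqv_trans[OF cls_geq[OF geq.sym[OF s(1)]] cls_add]) (use tu in \<open>auto simp: in_terms_iff\<close>)
    then have "eqv True (cls s - cls u) ((cls t + cls u) - cls u)" by (rule eqv_diff[OF _ eqv_refl])
    then have "eqv True (cls ?t) (cls t)" using eqv_trans[OF sub] by simp
    then have g: "geq True t ?t" using t tu by (intro geqI[OF eqv_sym]) auto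
    have "eqv False (cls (TAdd ?t u)) (cls ?t + cls u)" using t tu by (intro cls_add) (auto simp: in_terms_iff)
    also have "eqv False \<dots> ((cls s - cls u) + cls u)" by (intro eqv_add sub eqv_refl)
    finally have "geq False (TAdd ?t u) s" using t tu st by (intro geqI) auto
    then have "c = tm_class False (TAdd ?t u)" using s(2) tm_class_eq_iff geq_wft by blast
    also have "\<dots> = tm_class False ?t \<oplus>\<^bsub>?M\<^esub> tm_class False u" using add[OF t tu(2)] by simp
    finally show "c \<in> Q_class t <+>\<^bsub>?M\<^esub> Q_class u"
      unfolding set_add_def' using g geq.refl[of u True] tu(2) by (auto simp: Q_class_def tm_class_def in_terms_iff)
  qed
  moreover have "(\<Union>x\<in>Q_class t. ?N +>\<^bsub>?M\<^esub> (r \<odot>\<^bsub>?M\<^esub> x)) = Q_class (TSmult r t)"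
    if rt: "r \<in> carrier K" "t \<in> tms X Y d" for r t
  proof (rule Q_class_UN)
    fix u assume u: "geq True t u"
    then have ut: "u \<in> tms X Y d" using geq_terms rt by blast
    have "geq True (TSmult r t) (TSmult r u)" by (rule geq.cong_smult[OF u rt(1)])
    then have "Q_class (TSmult r u) = Q_class (TSmult r t)" using Q_class_eq_iff geq_wft by metis
    then show "?N +>\<^bsub>?M\<^esub> (r \<odot>\<^bsub>?M\<^esub> tm_class False u) = Q_class (TSmult r t)"
      using smult[OF rt(1) ut] coset_R[of "TSmult r u" X Y d] ut rt by simp
  qed (use rt in \<open>simp add: in_terms_iff\<close>)
  ultimately show ?thesis
    unfolding represents_def sHom_Q quotient_module_def using Q_class_eq_iff by (auto simp: in_terms_iff)
qed

lemma Ob_Q [simp]: "Ob Q = Ob C"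
  by (simp add: Q_cat_def quotient_ainf_def)

lemma arrows_Q: "arrows Q = qa ` {t. wft t}"
  by (rule arrows_represented[where f = True]) (simp_all add: represents_Q)

lemmas composable_Q = composable_arw[OF arrows_Q]

lemma listset_qc: "ys \<in> listset (map Q_class ts) \<longleftrightarrow> (\<exists>us. list_all2 (geq True) ts us \<and> ys = map (tm_class False) us)"
proof (induction ts arbitrary: ys)
  case (Cons t ts)
  show ?case
  proof
    assume "ys \<in> listset (map Q_class (t # ts))"
    then obtain y ys' where ys: "ys = y # ys'" "y \<in> Q_class t" "ys' \<in> listset (map Q_class ts)"
      by (auto simp: set_Cons_def)
    obtain us where us: "list_all2 (geq True) ts us" "ys' = map (tm_class False) us" using Cons.IH ys(3) by blast
    obtain u where "geq True t u" "y = tm_class False u" using ys(2) by (auto simp: Q_class_def tm_class_def)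
    then show "\<exists>us. list_all2 (geq True) (t # ts) us \<and> ys = map (tm_class False) us"
      using us ys(1) by (intro exI[of _ "u # us"]) simp
  next
    assume "\<exists>us. list_all2 (geq True) (t # ts) us \<and> ys = map (tm_class False) us"
    then obtain u us where u: "geq True t u" "list_all2 (geq True) ts us" "ys = tm_class False u # map (tm_class False) us"
      by (auto simp: list_all2_Cons1)
    have "tm_class False u \<in> Q_class t" using u(1) by (simp add: Q_class_def tm_class_def)
    moreover have "map (tm_class False) us \<in> listset (map Q_class ts)" using Cons.IH u(2) by blast
    ultimately show "ys \<in> listset (map Q_class (t # ts))" using u(3) by (auto simp: set_Cons_def)
  qed
qed simp

lemma bop_Q:
  assumes p: "path X ts Y" "ts \<noteq> []"
  shows "bop Q (map qa ts) = Q_class (Bt ts)"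
proof -
  let ?d = "ldeg ts + 1"
  have "bop Q (map qa ts) = (\<Union>ys\<in>listset (map Q_class ts). component R X Y ?d +>\<^bsub>sHom E X Y ?d\<^esub>
      bop E (map2 (\<lambda>x y. Arrow (src x) (tgt x) (deg x) y) (map qa ts) ys))"
    using map_arw_ends[OF p, of Q_class] by (simp add: Q_cat_def quotient_ainf_def Let_def o_def)
  also have "\<dots> = Q_class (Bt ts)"
  proof (rule UN_const)
    show "map (tm_class False) ts \<in> listset (map Q_class ts)"
      using path_geq_refl[OF p(1)] unfolding listset_qc by blast
    fix ys assume "ys \<in> listset (map Q_class ts)"
    then obtain us where us: "list_all2 (geq True) ts us" "ys = map (tm_class False) us" unfolding listset_qc by blast
    have "map2 (\<lambda>x y. Arrow (src x) (tgt x) (deg x) y) (map qa ts) ys = map ca us"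
      using us(1) unfolding us(2)
    proof (induction rule: list_all2_induct)
      case (Cons t ts u us)
      then show ?case using geq_wft[OF Cons.hyps(1)] by (simp add: arrow_of_def)
    qed simp
    moreover note g = geq_Bt_list[OF us(1) p]
    moreover have "Bt us \<in> tms X Y ?d" using path_Bt[OF g(2,3)] geq_wft[OF g(1)] path_Bt[OF p] by (simp add: in_terms_iff)
    ultimately show "component R X Y ?d +>\<^bsub>sHom E X Y ?d\<^esub>
      bop E (map2 (\<lambda>x y. Arrow (src x) (tgt x) (deg x) y) (map qa ts) ys) = Q_class (Bt ts)"
      using bop_free[OF g(2,3)] coset_R Q_class_eq_iff geq_wft[OF g(1)] geq.sym[OF g(1)] by (simp add: sHom_free)
  qed
  finally show ?thesis .
qed

lemma barrow_Q: "path X ts Y \<Longrightarrow> ts \<noteq> [] \<Longrightarrow> barrow Q (map qa ts) = qa (Bt ts)"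
  by (rule arrow_of_Bt[OF _ _ bop_Q])

text \<open>The way back from signed sums to a module: the evaluation homomorphism sends the null
  combination to 0 and turns the integer signs into \<open>ksign\<close>.\<close>

lemma finsum_ev:
  assumes M: "represents f X Y d M \<pi>" and XY: "X \<in> Ob C" "Y \<in> Ob C"
    and J: "finite J" and t: "\<And>j. j \<in> J \<Longrightarrow> t j \<in> tms X Y d"
    and zero: "eqv f (\<Sum>j\<in>J. frag_cmul (sg (s j)) (cls (t j))) 0"
  shows "finsum M (\<lambda>j. ksign M (s j) (\<pi> (t j))) J = \<zero>\<^bsub>M\<^esub>"
proof -
  interpret M: abelian_group M by (rule represents_abelian_group[OF M XY])
  obtain ev where ev: "\<forall>x. ev x \<in> carrier M" "\<forall>x y. ev (x + y) = ev x \<oplus>\<^bsub>M\<^esub> ev y"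
    "\<forall>x. ev (- x) = \<ominus>\<^bsub>M\<^esub> ev x" "ev 0 = \<zero>\<^bsub>M\<^esub>"
    "\<forall>t\<in>tms X Y d. ev (frag_of t) = \<pi> t" "\<forall>x\<in>null_combs f. ev x = \<zero>\<^bsub>M\<^esub>"
    using represents_ev[OF M XY] by (elim exE conjE)
  have "finsum M (\<lambda>j. ksign M (s j) (\<pi> (t j))) J = ev (\<Sum>j\<in>J. frag_cmul (sg (s j)) (cls (t j)))"
    using J t
  proof (induction J)
    case (insert j J)
    have k: "ksign M (s i) (\<pi> (t i)) = ev (frag_cmul (sg (s i)) (cls (t i)))" if "i \<in> insert j J" for i
      using insert.prems[OF that] ev(3,5) by (auto simp: ksign_def sg_def cls_def in_terms_iff)
    then have "finsum M (\<lambda>j. ksign M (s j) (\<pi> (t j))) (insert j J)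
        = ksign M (s j) (\<pi> (t j)) \<oplus>\<^bsub>M\<^esub> finsum M (\<lambda>j. ksign M (s j) (\<pi> (t j))) J"
      using insert.hyps ev(1) by (intro M.finsum_insert) auto
    then show ?case using k insert ev(2) by simp
  qed (simp add: ev(4))
  then show ?thesis using ev(6) zero by (simp add: eqv_def)
qed

section \<open>Linearity of the operations and the A-infinity relations in the quotient\<close>

lemma map_arw_decomp:
  assumes "map (arrow_of \<pi>) ts = us @ x # vs"
  obtains us' t vs' where "ts = us' @ t # vs'" "us = map (arrow_of \<pi>) us'" "x = arrow_of \<pi> t" "vs = map (arrow_of \<pi>) vs'"
  using assms by (auto simp: map_eq_append_conv map_eq_Cons_conv)

lemma multilinear_Bt: "multilinear f (\<lambda>t. if us = [] \<and> vs = [] then if wft t then cls (b1 t) else 0 else cls (TB (us @ t # vs)))"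
  using multilinear_b1 cls_slot by (cases "us = [] \<and> vs = []") auto

lemma Bt_slot_add:
  assumes "path X (us @ TAdd t u # vs) Y"
  shows "geq f (Bt (us @ TAdd t u # vs)) (TAdd (Bt (us @ t # vs)) (Bt (us @ u # vs)))"
proof -
  have tu: "wft (TAdd t u)" using assms by auto
  have p: "path X (us @ t # vs) Y" "path X (us @ u # vs) Y" using assms by auto
  note B = path_Bt[OF p(1)] path_Bt[OF p(2)] path_Bt[OF assms]
  have w: "wft (TAdd (Bt (us @ t # vs)) (Bt (us @ u # vs)))" using B tu by simp
  have "eqv f (cls (Bt (us @ TAdd t u # vs))) (cls (Bt (us @ t # vs)) + cls (Bt (us @ u # vs)))"
    using multilinearD(3)[OF multilinear_Bt tu, of f us vs] tu by (auto simp: Bt_slot split: if_splits)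
  also have "eqv f \<dots> (cls (TAdd (Bt (us @ t # vs)) (Bt (us @ u # vs))))" by (rule eqv_sym[OF cls_add[OF w]])
  finally show ?thesis by (rule geqI') (use B w in auto)
qed

lemma Bt_slot_smult:
  assumes "path X (us @ TSmult r t # vs) Y"
  shows "geq f (Bt (us @ TSmult r t # vs)) (TSmult r (Bt (us @ t # vs)))"
proof -
  have rt: "wft (TSmult r t)" using assms by auto
  have p: "path X (us @ t # vs) Y" using assms by auto
  note B = path_Bt[OF p(1)] path_Bt[OF assms]
  have "eqv f (cls (Bt (us @ TSmult r t # vs))) (scale r (cls (Bt (us @ t # vs))))"
    using multilinearD(4)[OF multilinear_Bt rt, of f us vs] rt by (auto simp: Bt_slot split: if_splits)
  also have "\<dots> = cls (TSmult r (Bt (us @ t # vs)))" using rt by (simp add: scale_cls)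
  finally show ?thesis by (rule geqI') (use B rt in auto)
qed

lemma Q_class_Bt:
  assumes "path X ts Y" "ts \<noteq> []" "geq True (Bt ts) u"
  shows "Q_class (Bt ts) = Q_class u" "u \<in> tms X Y (ldeg ts + 1)"
  using assms(3) path_Bt[OF assms(1,2)] geq_wft[OF assms(3)] Q_class_eq_iff by (auto simp: in_terms_iff)

text \<open>Each axiom is lifted to terms by \<open>composable_Q\<close> and \<open>bop_Q\<close>.
  There \<open>path_Bt\<close> gives closure, \<open>Bt_slot_add\<close> and
  \<open>Bt_slot_smult\<close> give linearity, and \<open>bb_relation\<close> gives the
  relations.\<close>

theorem ainf_category_Q: "ainf_category K Q"
proof (rule ainf_category.intro)
  show "cring K" by (rule base_ring)
  show "module K (Hom Q X Y d)" if "X \<in> Ob Q" "Y \<in> Ob Q" for X Y d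
    using represents_module[OF represents_Q[of X Y "d - 1"]] that by (simp add: sHom_def)
next
  fix xs assume "composable Q xs"
  then obtain ts X Y where ts: "xs = map qa ts" "path X ts Y" "ts \<noteq> []" unfolding composable_Q by blast
  have XY: "X \<in> Ob C" "Y \<in> Ob C" using path_Ob ts by blast+
  show "bop Q xs \<in> carrier (sHom Q (src (hd xs)) (tgt (last xs)) (total_deg xs + 1))"
    using bop_Q[OF ts(2,3)] map_arw_ends[OF ts(2,3), of Q_class] ts(1) path_Bt[OF ts(2,3)]
      representsD(1)[OF represents_Q[OF XY]] by (simp add: in_terms_iff)
next
  fix zs us X Y d x y vs
  assume zs: "zs = us @ Arrow X Y d (x \<oplus>\<^bsub>sHom Q X Y d\<^esub> y) # vs"
    and c: "composable Q (us @ Arrow X Y d x # vs)" "composable Q (us @ Arrow X Y d y # vs)"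
  obtain ts X' Y' where ts: "us @ Arrow X Y d x # vs = map qa ts" "path X' ts Y'" "ts \<noteq> []"
    using c(1) unfolding composable_Q by blast
  obtain us' t vs' where d: "ts = us' @ t # vs'" "us = map qa us'" "Arrow X Y d x = qa t" "vs = map qa vs'"
    using map_arw_decomp[OF ts(1)[symmetric]] .
  have "Arrow X Y d y \<in> arrows Q" using c(2) by (simp add: composable_def)
  then obtain u where u: "wft u" "Arrow X Y d y = qa u" unfolding arrows_Q by blast
  have tw: "wft t" using ts(2) d(1) by auto
  have tu: "t \<in> tms X Y d" "u \<in> tms X Y d" "x = Q_class t" "y = Q_class u"
    using d(3) u tw by (auto simp: arrow_of_def in_terms_iff)
  have XY: "X \<in> Ob C" "Y \<in> Ob C" using wft_Ob[OF tw] tu(1) by (auto simp: in_terms_iff)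
  have "x \<oplus>\<^bsub>sHom Q X Y d\<^esub> y = Q_class (TAdd t u)"
    using representsD(3)[OF represents_Q[OF XY] tu(1,2)] tu by simp
  then have zs': "zs = map qa (us' @ TAdd t u # vs')" using zs d tu by (simp add: arrow_of_def in_terms_iff)
  have p: "path X' (us' @ TAdd t u # vs') Y'" "path X' (us' @ t # vs') Y'" "path X' (us' @ u # vs') Y'"
    using ts(2) d(1) tu by (auto simp: in_terms_iff)
  have XY': "X' \<in> Ob C" "Y' \<in> Ob C" using path_Ob[OF p(1)] by auto
  have deg: "ldeg (us' @ t # vs') = ldeg (us' @ TAdd t u # vs')" "ldeg (us' @ u # vs') = ldeg (us' @ TAdd t u # vs')"
    using tu by (simp_all add: in_terms_iff)
  have B: "Bt (us' @ t # vs') \<in> tms X' Y' (ldeg (us' @ TAdd t u # vs') + 1)"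
    "Bt (us' @ u # vs') \<in> tms X' Y' (ldeg (us' @ TAdd t u # vs') + 1)"
    using path_Bt[OF p(2)] path_Bt[OF p(3)] unfolding deg by (simp_all add: in_terms_iff)
  have "bop Q zs = Q_class (TAdd (Bt (us' @ t # vs')) (Bt (us' @ u # vs')))"
    using bop_Q[OF p(1)] Q_class_Bt(1)[OF p(1) _ Bt_slot_add[OF p(1)]] unfolding zs' by simp
  also have "\<dots> = Q_class (Bt (us' @ t # vs')) \<oplus>\<^bsub>sHom Q X' Y' (ldeg (us' @ TAdd t u # vs') + 1)\<^esub> Q_class (Bt (us' @ u # vs'))"
    using representsD(3)[OF represents_Q[OF XY'] B] by simp
  also have "Q_class (Bt (us' @ t # vs')) = bop Q (us @ Arrow X Y d x # vs)"
    using bop_Q[OF p(2)] d by simp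
  also have "Q_class (Bt (us' @ u # vs')) = bop Q (us @ Arrow X Y d y # vs)"
    using bop_Q[OF p(3)] d u by simp
  finally show "bop Q zs = bop Q (us @ Arrow X Y d x # vs)
      \<oplus>\<^bsub>sHom Q (src (hd zs)) (tgt (last zs)) (total_deg zs + 1)\<^esub> bop Q (us @ Arrow X Y d y # vs)"
    using map_arw_ends[OF p(1), of Q_class] unfolding zs' arrow_of_simps(5) by simp
next
  fix zs us X Y d r x vs
  assume zs: "zs = us @ Arrow X Y d (r \<odot>\<^bsub>sHom Q X Y d\<^esub> x) # vs" and r: "r \<in> carrier K"
    and c: "composable Q (us @ Arrow X Y d x # vs)"
  obtain ts X' Y' where ts: "us @ Arrow X Y d x # vs = map qa ts" "path X' ts Y'" "ts \<noteq> []"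
    using c unfolding composable_Q by blast
  obtain us' t vs' where d: "ts = us' @ t # vs'" "us = map qa us'" "Arrow X Y d x = qa t" "vs = map qa vs'"
    using map_arw_decomp[OF ts(1)[symmetric]] .
  have tw: "wft t" using ts(2) d(1) by auto
  have t: "t \<in> tms X Y d" "x = Q_class t" using d(3) tw by (auto simp: arrow_of_def in_terms_iff)
  have XY: "X \<in> Ob C" "Y \<in> Ob C" using wft_Ob[OF tw] t(1) by (auto simp: in_terms_iff)
  have "r \<odot>\<^bsub>sHom Q X Y d\<^esub> x = Q_class (TSmult r t)"
    using representsD(4)[OF represents_Q[OF XY] r t(1)] t by simp
  then have zs': "zs = map qa (us' @ TSmult r t # vs')" using zs d t by (simp add: arrow_of_def in_terms_iff)
  have p: "path X' (us' @ TSmult r t # vs') Y'" "path X' (us' @ t # vs') Y'"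
    using ts(2) d(1) r by auto
  have XY': "X' \<in> Ob C" "Y' \<in> Ob C" using path_Ob[OF p(1)] by auto
  have deg: "ldeg (us' @ t # vs') = ldeg (us' @ TSmult r t # vs')" by simp
  have B: "Bt (us' @ t # vs') \<in> tms X' Y' (ldeg (us' @ TSmult r t # vs') + 1)"
    using path_Bt[OF p(2)] unfolding deg by (simp add: in_terms_iff)
  have "bop Q zs = Q_class (TSmult r (Bt (us' @ t # vs')))"
    using bop_Q[OF p(1)] Q_class_Bt(1)[OF p(1) _ Bt_slot_smult[OF p(1)]] unfolding zs' by simp
  also have "\<dots> = r \<odot>\<^bsub>sHom Q X' Y' (ldeg (us' @ TSmult r t # vs') + 1)\<^esub> Q_class (Bt (us' @ t # vs'))"
    using representsD(4)[OF represents_Q[OF XY'] r B] by simp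
  also have "Q_class (Bt (us' @ t # vs')) = bop Q (us @ Arrow X Y d x # vs)"
    using bop_Q[OF p(2)] d by simp
  finally show "bop Q zs = r \<odot>\<^bsub>sHom Q (src (hd zs)) (tgt (last zs)) (total_deg zs + 1)\<^esub> bop Q (us @ Arrow X Y d x # vs)"
    using map_arw_ends[OF p(1), of Q_class] unfolding zs' arrow_of_simps(5) by simp
next
  fix xs M assume c: "composable Q xs" and M: "M = sHom Q (src (hd xs)) (tgt (last xs)) (total_deg xs + 2)"
  obtain ts X Y where ts: "xs = map qa ts" "path X ts Y" "ts \<noteq> []" using c unfolding composable_Q by blast
  have XY: "X \<in> Ob C" "Y \<in> Ob C" using path_Ob ts by blast+
  have M': "M = sHom Q X Y (ldeg ts + 2)" using M map_arw_ends[OF ts(2,3), of Q_class] ts(1) by simp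
  let ?J = "{(r, n). 1 \<le> n \<and> r + n \<le> length ts}"
  let ?w = "\<lambda>x. take (fst x) ts @ Bt (take (snd x) (drop (fst x) ts)) # drop (fst x + snd x) ts"
  have decomps: "(take (fst x) ts, take (snd x) (drop (fst x) ts), drop (fst x + snd x) ts) \<in> decomps ts" if "x \<in> ?J" for x
    using that take_take_drop[of "fst x" ts "snd x"] by (auto simp: decomps_def)
  have tmx: "bop Q (take (fst x) xs @ barrow Q (take (snd x) (drop (fst x) xs)) # drop (fst x + snd x) xs) = Q_class (Bt (?w x))"
    "Bt (?w x) \<in> tms X Y (ldeg ts + 2)" if x: "x \<in> ?J" for x
  proof -
    note p = path_dec[OF ts(2) decomps[OF x]]
    obtain Z Z' where v: "path Z (take (snd x) (drop (fst x) ts)) Z'" using p(5) by blast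
    have "take (fst x) xs @ barrow Q (take (snd x) (drop (fst x) xs)) # drop (fst x + snd x) xs = map qa (?w x)"
      using barrow_Q[OF v p(4)] by (simp add: ts(1) take_map drop_map)
    then show "bop Q (take (fst x) xs @ barrow Q (take (snd x) (drop (fst x) xs)) # drop (fst x + snd x) xs) = Q_class (Bt (?w x))"
      using bop_Q[OF p(1)] by simp
    have "ldeg ts = ldeg (take (fst x) ts @ take (snd x) (drop (fst x) ts) @ drop (fst x + snd x) ts)"
      by (simp only: take_take_drop)
    then have "ldeg (?w x) + 1 = ldeg ts + 2" using p(3) by simp
    then show "Bt (?w x) \<in> tms X Y (ldeg ts + 2)" using path_Bt[OF p(1)] by (simp add: in_terms_iff)
  qed
  have "(\<Sum>x\<in>?J. frag_cmul (sg (ldeg (drop (fst x + snd x) ts))) (cls (Bt (?w x)))) = bb ts"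
    unfolding bb_def sum_dec_index by (simp add: split_def)
  then have "eqv True (\<Sum>x\<in>?J. frag_cmul (sg (ldeg (drop (fst x + snd x) ts))) (cls (Bt (?w x)))) 0"
    using bb_relation[OF ts(2,3)] by simp
  from finsum_ev[OF represents_Q[OF XY] XY finite_index tmx(2) this]
  have *: "finsum M (\<lambda>x. ksign M (ldeg (drop (fst x + snd x) ts)) (Q_class (Bt (?w x)))) ?J = \<zero>\<^bsub>M\<^esub>"
    unfolding M' by blast
  interpret M: abelian_group M unfolding M' by (rule represents_abelian_group[OF represents_Q[OF XY] XY])
  have "Q_class (Bt (?w x)) \<in> carrier M" if "x \<in> ?J" for x
    using tmx(2)[OF that] representsD(1)[OF represents_Q[OF XY]] unfolding M' by auto
  then have "finsum M (\<lambda>(r, n). ksign M (total_deg (drop (r + n) xs))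
           (bop Q (take r xs @ barrow Q (take n (drop r xs)) # drop (r + n) xs))) ?J
      = finsum M (\<lambda>x. ksign M (ldeg (drop (fst x + snd x) ts)) (Q_class (Bt (?w x)))) ?J"
    using tmx(1) by (intro M.finsum_cong') (auto simp: ksign_def ts(1) drop_map)
  with * show "finsum M (\<lambda>(r, n). ksign M (total_deg (drop (r + n) xs))
           (bop Q (take r xs @ barrow Q (take n (drop r xs)) # drop (r + n) xs)))
         {(r, n). 1 \<le> n \<and> r + n \<le> length xs} = \<zero>\<^bsub>M\<^esub>"
    by (simp add: ts(1))
qed

section \<open>Homotopies defined on terms\<close>

lemma multilinear_zero:
  assumes "multilinear f g"
  shows "eqv f (g (TZero X Y d)) 0"
proof (cases "wft (TZero X Y d)")
  case True
  let ?Z = "TZero X Y d :: ('o, 'k, 'm) tm"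
  have "eqv f (g ?Z + g ?Z) (g (TAdd ?Z ?Z))"
    by (rule eqv_sym, rule multilinearD(3)[OF assms]) (use True in simp)
  also have "eqv f \<dots> (g ?Z)"
    using geq.add_zero[OF True, of f] by (intro multilinearD(2)[OF assms]) simp
  finally show ?thesis by (simp add: eqv_def)
next
  case False
  then show ?thesis using multilinearD(1)[OF assms False] by simp
qed

lemma multilinear_plus:
  assumes "multilinear f g" "multilinear f g'"
  shows "multilinear f (\<lambda>t. g t + g' t)"
  unfolding multilinear_def
proof (intro conjI allI impI)
  fix t u assume tu: "wft (TAdd t u)"
  have "eqv f (g (TAdd t u) + g' (TAdd t u)) ((g t + g u) + (g' t + g' u))"
    by (intro eqv_add multilinearD(3)[OF assms(1)] multilinearD(3)[OF assms(2)] tu)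
  then show "eqv f (g (TAdd t u) + g' (TAdd t u)) (g t + g' t + (g u + g' u))" by (simp add: algebra_simps)
qed (auto simp: multilinearD(1)[OF assms(1)] multilinearD(1)[OF assms(2)]
      intro!: eqv_add multilinearD(2,4)[OF assms(1)] multilinearD(2,4)[OF assms(2)])

lemma multilinear_cmul:
  assumes "multilinear f g"
  shows "multilinear f (\<lambda>t. frag_cmul c (g t))"
  unfolding multilinear_def
proof (intro conjI allI impI)
  fix t u assume tu: "wft (TAdd t u)"
  show "eqv f (frag_cmul c (g (TAdd t u))) (frag_cmul c (g t) + frag_cmul c (g u))"
    using eqv_cmul[OF multilinearD(3)[OF assms tu], of c] by (simp add: frag_cmul_distrib2)
next
  fix r t assume rt: "wft (TSmult r t)"
  show "eqv f (frag_cmul c (g (TSmult r t))) (scale r (frag_cmul c (g t)))"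
    using eqv_cmul[OF multilinearD(4)[OF assms rt], of c] by simp
qed (auto simp: multilinearD(1)[OF assms] intro!: eqv_cmul multilinearD(2)[OF assms])

lemma multilinear_minus: "multilinear f g \<Longrightarrow> multilinear f (\<lambda>t. - g t)"
  using multilinear_cmul[of f g "-1"] by simp

definition same_type :: "('o, 'k, 'm) tm \<Rightarrow> ('o, 'k, 'm) tm \<Rightarrow> bool" where
  "same_type t u \<longleftrightarrow> wft t \<and> wft u \<and> tm_src t = tm_src u \<and> tm_tgt t = tm_tgt u \<and> tm_deg t = tm_deg u"

text \<open>The type of a homotopy at a term. Preservation of \<open>P\<close> is included because
  \<open>H\<close> is applied to the homotopy of a term in the formula \<open>h_H\<close>.\<close>

definition lowers :: "(('o, 'k, 'm) tm \<Rightarrow> ('o, 'k, 'm) tm) \<Rightarrow> ('o, 'k, 'm) tm \<Rightarrow> bool" where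
  "lowers h t \<longleftrightarrow> wft (h t) \<and> tm_src (h t) = tm_src t \<and> tm_tgt (h t) = tm_tgt t
     \<and> tm_deg (h t) = tm_deg t - 1 \<and> (in_P t \<longrightarrow> in_P (h t))"

end

text \<open>
  \<open>F\<close> is the multiplication by a unit element and \<open>h\<close> the candidate for a homotopy from the identity
  to \<open>F\<close>. With \<open>\<phi> = H (F - 1) - h\<close>, which anticommutes with \<open>b\<^sub>1\<close> on \<open>P\<close>, the homotopy equation on \<open>P H\<close>
  is solved by \<open>H h = \<phi> k\<close>, where \<open>k\<close> is the contracting homotopy \<open>y + z H \<mapsto> y H\<close> of \<open>P \<oplus> P H\<close>; this is
  \<open>h_H\<close>.
\<close>

locale unit_homotopy = quotient_construction K C B
  for K :: "'k ring" and C :: "('o, 'k, 'm) ainf" and B :: "('o, 'k, 'm) ainf" +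
  fixes F h :: "('o, 'k, 'm) tm \<Rightarrow> ('o, 'k, 'm) tm"
  assumes F_type: "wft t \<Longrightarrow> same_type (F t) t \<and> in_P (F t)"
    and F_linear: "multilinear True (\<lambda>t. if wft t then cls (F t) else 0)"
    and F_b1: "wft t \<Longrightarrow> eqv True (cls (b1 (F t))) (cls (F (b1 t)))"
    and F_gen: "wft (TGen X Y d m) \<Longrightarrow> eqv True (cls (F (TGen X Y d m))) (cls (TGen X Y d m))"
    and h_gen: "h (TGen X Y d m) = TZero X Y (d - 1)"
    and h_zero: "h (TZero X Y d) = TZero X Y (d - 1)"
    and h_add: "h (TAdd t u) = TAdd (h t) (h u)"
    and h_smult: "h (TSmult r t) = TSmult r (h t)"
    and h_H: "h (TH t) = TAdd (TH (F (TH t))) (tneg K (TH (h t)))"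
    and h_TB_lowers: "wft (TB ts) \<Longrightarrow> (\<And>t. t \<in> set ts \<Longrightarrow> lowers h t) \<Longrightarrow> lowers h (TB ts)"
    and h_TB_slot: "(\<And>t. wft t \<Longrightarrow> lowers h t) \<Longrightarrow> wft (TB (us @ t # vs)) \<Longrightarrow>
      \<exists>g g'. multilinear True g \<and> multilinear True g' \<and>
        (\<forall>t'. same_type t' t \<longrightarrow> eqv True (cls (h (TB (us @ t' # vs)))) (g t' + g' (h t')))"
    and h_base: "(\<And>t. wft t \<Longrightarrow> lowers h t) \<Longrightarrow> composable C xs \<Longrightarrow> length xs \<ge> 2 \<Longrightarrow>
      eqv True (cls (h (TB (map gen xs)))) 0"
begin

lemma wft_F [simp]: "wft t \<Longrightarrow> wft (F t)"
  and src_F [simp]: "wft t \<Longrightarrow> tm_src (F t) = tm_src t"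
  and tgt_F [simp]: "wft t \<Longrightarrow> tm_tgt (F t) = tm_tgt t"
  and deg_F [simp]: "wft t \<Longrightarrow> tm_deg (F t) = tm_deg t"
  and in_P_F [simp]: "wft t \<Longrightarrow> in_P (F t)"
  using F_type by (auto simp: same_type_def)

lemma lowers: "wft t \<Longrightarrow> lowers h t"
proof (induction t)
  case (TB ts)
  then obtain X Y where "path X ts Y" by (elim wft_TBE)
  then have "lowers h t" if "t \<in> set ts" for t using TB.IH that path_wft by blast
  then show ?case using h_TB_lowers TB.prems by blast
qed (auto simp: lowers_def h_gen h_zero h_add h_smult h_H)

lemma wft_h [simp]: "wft t \<Longrightarrow> wft (h t)"
  and src_h [simp]: "wft t \<Longrightarrow> tm_src (h t) = tm_src t"
  and tgt_h [simp]: "wft t \<Longrightarrow> tm_tgt (h t) = tm_tgt t"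
  and deg_h [simp]: "wft t \<Longrightarrow> tm_deg (h t) = tm_deg t - 1"
  and in_P_h [simp]: "wft t \<Longrightarrow> in_P t \<Longrightarrow> in_P (h t)"
  using lowers by (auto simp: lowers_def)

lemma F_cong: "geq True t u \<Longrightarrow> geq True (F t) (F u)"
  using multilinearD(2)[OF F_linear, of t u] geq_wft[of True t u] by (intro geqI') auto

lemma F_add: "wft (TAdd t u) \<Longrightarrow> eqv True (cls (F (TAdd t u))) (cls (F t) + cls (F u))"
  using multilinearD(3)[OF F_linear, of t u] by simp

lemma F_smult: "wft (TSmult r t) \<Longrightarrow> eqv True (cls (F (TSmult r t))) (scale r (cls (F t)))"
  using multilinearD(4)[OF F_linear, of r t] by simp

lemma geq_F_H_add:
  assumes "wft (TH (TAdd t u))"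
  shows "geq True (F (TH (TAdd t u))) (TAdd (F (TH t)) (F (TH u)))"
proof -
  have w: "wft (TH t)" "wft (TH u)" "wft (TAdd (TH t) (TH u))" using assms by auto
  have "eqv True (cls (F (TH (TAdd t u)))) (cls (F (TAdd (TH t) (TH u))))"
    by (rule cls_geq[OF F_cong[OF geq.H_add[OF assms]]])
  also have "eqv True \<dots> (cls (F (TH t)) + cls (F (TH u)))" by (rule F_add[OF w(3)])
  also have "eqv True \<dots> (cls (TAdd (F (TH t)) (F (TH u))))" by (rule eqv_sym[OF cls_add]) (use w in auto)
  finally show ?thesis by (rule geqI') (use assms w in auto)
qed

lemma geq_F_H_smult:
  assumes "wft (TH (TSmult r t))"
  shows "geq True (F (TH (TSmult r t))) (TSmult r (F (TH t)))"
proof -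
  have w: "wft (TH t)" "wft (TSmult r (TH t))" "r \<in> carrier K" using assms by auto
  have "eqv True (cls (F (TH (TSmult r t)))) (cls (F (TSmult r (TH t))))"
    by (rule cls_geq[OF F_cong[OF geq.H_smult[OF assms]]])
  also have "eqv True \<dots> (scale r (cls (F (TH t))))" by (rule F_smult[OF w(2)])
  also have "\<dots> = cls (TSmult r (F (TH t)))" by (rule scale_cls[OF w(3)])
  finally show ?thesis by (rule geqI') (use assms w in auto)
qed

lemma h_H_cls:
  assumes "wft (TH t)"
  shows "eqv True (cls (h (TH t))) (cls (TH (F (TH t))) - cls (TH (h t)))"
  unfolding h_H by (rule cls_sub) (use assms in auto)

text \<open>By \<open>h_TB_slot\<close> a letter of a \<open>TB\<close> term enters the homotopy
  linearly, directly and through the homotopy of the letter, so the rules for \<open>TB\<close>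
  carry over. The rule \<open>base\<close> is respected because \<open>h\<close> vanishes on both of
  its sides.\<close>

theorem geq_h:
  assumes "geq True t u"
  shows "geq True (h t) (h u)"
proof (rule linear_preserves[where F = h and \<delta> = "-1", OF _ _ _ _ _ _ _ _ _ _ _ _ _ assms])
  fix us t t' vs assume *: "geq True t t'" "geq True (h t) (h t')" "wft (TB (us @ t # vs))"
  note d = geq_wft[OF *(1)] and D = geq_wft[OF geq.cong_b[OF *(1,3)]]
  obtain g g' where g: "multilinear True g" "multilinear True g'"
    "\<forall>t'. same_type t' t \<longrightarrow> eqv True (cls (h (TB (us @ t' # vs)))) (g t' + g' (h t'))"
    using h_TB_slot[OF lowers *(3)] by blast
  have "eqv True (cls (h (TB (us @ t # vs)))) (g t + g' (h t))" using g(3) d by (simp add: same_type_def)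
  also have "eqv True \<dots> (g t' + g' (h t'))"
    by (intro eqv_add multilinearD(2)[OF g(1) *(1)] multilinearD(2)[OF g(2) *(2)])
  also have "eqv True \<dots> (cls (h (TB (us @ t' # vs))))" using eqv_sym g(3) d by (simp add: same_type_def)
  finally show "geq True (h (TB (us @ t # vs))) (h (TB (us @ t' # vs)))"
    by (rule geqI') (use D in auto)
next
  fix us t u vs assume w: "wft (TB (us @ TAdd t u # vs))"
  have tu: "wft (TAdd t u)" using w wft_TB_slot by blast
  note D = geq_wft[OF geq.b_add[OF w]]
  obtain g g' where g: "multilinear True g" "multilinear True g'"
    "\<forall>t'. same_type t' (TAdd t u) \<longrightarrow> eqv True (cls (h (TB (us @ t' # vs)))) (g t' + g' (h t'))"
    using h_TB_slot[OF lowers w] by blast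
  have s: "same_type (TAdd t u) (TAdd t u)" "same_type t (TAdd t u)" "same_type u (TAdd t u)"
    using tu by (auto simp: same_type_def)
  have wh: "wft (TAdd (h t) (h u))" using tu by auto
  have "eqv True (cls (h (TB (us @ TAdd t u # vs)))) (g (TAdd t u) + g' (TAdd (h t) (h u)))"
    using g(3)[rule_format, OF s(1)] by (simp add: h_add)
  also have "eqv True \<dots> ((g t + g u) + (g' (h t) + g' (h u)))"
    by (intro eqv_add multilinearD(3)[OF g(1) tu] multilinearD(3)[OF g(2) wh])
  also have "\<dots> = (g t + g' (h t)) + (g u + g' (h u))" by simp
  also have "eqv True \<dots> (cls (h (TB (us @ t # vs))) + cls (h (TB (us @ u # vs))))"
    by (intro eqv_add eqv_sym[OF g(3)[rule_format, OF s(2)]] eqv_sym[OF g(3)[rule_format, OF s(3)]])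
  also have "eqv True \<dots> (cls (TAdd (h (TB (us @ t # vs))) (h (TB (us @ u # vs)))))"
    by (rule eqv_sym[OF cls_add]) (use D in auto)
  finally show "geq True (h (TB (us @ TAdd t u # vs))) (TAdd (h (TB (us @ t # vs))) (h (TB (us @ u # vs))))"
    by (rule geqI') (use D in auto)
next
  fix us r t vs assume w: "wft (TB (us @ TSmult r t # vs))"
  have rt: "wft (TSmult r t)" and r: "r \<in> carrier K" using w wft_TB_slot[OF w] by auto
  note D = geq_wft[OF geq.b_smult[OF w]]
  obtain g g' where g: "multilinear True g" "multilinear True g'"
    "\<forall>t'. same_type t' (TSmult r t) \<longrightarrow> eqv True (cls (h (TB (us @ t' # vs)))) (g t' + g' (h t'))"
    using h_TB_slot[OF lowers w] by blast
  have s: "same_type (TSmult r t) (TSmult r t)" "same_type t (TSmult r t)"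
    using rt by (auto simp: same_type_def)
  have wh: "wft (TSmult r (h t))" using rt by auto
  have "eqv True (cls (h (TB (us @ TSmult r t # vs)))) (g (TSmult r t) + g' (TSmult r (h t)))"
    using g(3)[rule_format, OF s(1)] by (simp add: h_smult)
  also have "eqv True \<dots> (scale r (g t) + scale r (g' (h t)))"
    by (intro eqv_add multilinearD(4)[OF g(1) rt] multilinearD(4)[OF g(2) wh])
  also have "\<dots> = scale r (g t + g' (h t))" by simp
  also have "eqv True \<dots> (scale r (cls (h (TB (us @ t # vs)))))"
    by (intro scale_eqv[OF r] eqv_sym[OF g(3)[rule_format, OF s(2)]])
  also have "\<dots> = cls (TSmult r (h (TB (us @ t # vs))))" by (rule scale_cls[OF r])
  finally show "geq True (h (TB (us @ TSmult r t # vs))) (TSmult r (h (TB (us @ t # vs))))"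
    by (rule geqI') (use D in auto)
next
  fix t t' assume *: "geq True t t'" "geq True (h t) (h t')" "wft (TH t)" "wft (TH t')"
  have "geq True (TH (F (TH t))) (TH (F (TH t')))"
    by (intro geq.cong_H F_cong *) (use * in auto)
  moreover have "geq True (TH (h t)) (TH (h t'))" by (intro geq.cong_H *) (use * in auto)
  ultimately show "geq True (h (TH t)) (h (TH t'))"
    unfolding h_H tneg_def using * by (intro geq.cong_add geq.cong_smult) auto
next
  fix t u assume w: "wft (TH (TAdd t u))"
  have w': "wft (TH t)" "wft (TH u)" "wft (TH (TAdd (F (TH t)) (F (TH u))))" "wft (TH (TAdd (h t) (h u)))"
    "wft (TH (F (TH (TAdd t u))))"
    using w by auto
  have "eqv True (cls (h (TH (TAdd t u)))) (cls (TH (F (TH (TAdd t u)))) - cls (TH (TAdd (h t) (h u))))"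
    using h_H_cls[OF w] by (simp add: h_add)
  also have "eqv True \<dots> (cls (TH (TAdd (F (TH t)) (F (TH u)))) - (cls (TH (h t)) + cls (TH (h u))))"
    by (intro eqv_diff cls_H_cong[OF geq_F_H_add[OF w]] cls_H_add w')
  also have "eqv True \<dots> ((cls (TH (F (TH t))) + cls (TH (F (TH u)))) - (cls (TH (h t)) + cls (TH (h u))))"
    by (intro eqv_diff cls_H_add w' eqv_refl)
  also have "\<dots> = (cls (TH (F (TH t))) - cls (TH (h t))) + (cls (TH (F (TH u))) - cls (TH (h u)))" by simp
  also have "eqv True \<dots> (cls (h (TH t)) + cls (h (TH u)))"
    by (intro eqv_add eqv_sym[OF h_H_cls] w')
  also have "eqv True \<dots> (cls (TAdd (h (TH t)) (h (TH u))))"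
    by (rule eqv_sym[OF cls_add]) (use w w' wft_h[OF w'(1)] wft_h[OF w'(2)] in auto)
  finally show "geq True (h (TH (TAdd t u))) (TAdd (h (TH t)) (h (TH u)))"
    by (rule geqI') (use w w' wft_h[OF w'(1)] wft_h[OF w'(2)] wft_h[OF w] in auto)
next
  fix r t assume w: "wft (TH (TSmult r t))"
  have w': "wft (TH t)" "wft (TH (TSmult r (F (TH t))))" "wft (TH (TSmult r (h t)))"
    "wft (TH (F (TH (TSmult r t))))" and r: "r \<in> carrier K"
    using w by auto
  have "eqv True (cls (h (TH (TSmult r t)))) (cls (TH (F (TH (TSmult r t)))) - cls (TH (TSmult r (h t))))"
    using h_H_cls[OF w] by (simp add: h_smult)
  also have "eqv True \<dots> (cls (TH (TSmult r (F (TH t)))) - scale r (cls (TH (h t))))"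
    by (intro eqv_diff cls_H_cong[OF geq_F_H_smult[OF w]] cls_H_smult w')
  also have "eqv True \<dots> (scale r (cls (TH (F (TH t)))) - scale r (cls (TH (h t))))"
    by (intro eqv_diff cls_H_smult w' eqv_refl)
  also have "\<dots> = scale r (cls (TH (F (TH t))) - cls (TH (h t)))" by simp
  also have "eqv True \<dots> (scale r (cls (h (TH t))))"
    by (intro scale_eqv[OF r] eqv_sym[OF h_H_cls] w')
  also have "\<dots> = cls (TSmult r (h (TH t)))" by (rule scale_cls[OF r])
  finally show "geq True (h (TH (TSmult r t))) (TSmult r (h (TH t)))"
    by (rule geqI') (use w w' r wft_h[OF w'(1)] wft_h[OF w] in auto)
next
  fix xs assume *: "composable C xs" "length xs \<ge> 2"
  have b: "geq True (TB (map gen xs)) (gen (barrow C xs))" using geq.base * by simp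
  have "eqv True (cls (h (TB (map gen xs)))) (cls (h (gen (barrow C xs))))"
    by (rule eqv_trans[OF h_base[OF lowers *]]) (simp_all add: gen_def h_gen eqv_sym[OF cls_zero])
  then show "geq True (h (TB (map gen xs))) (h (gen (barrow C xs)))"
    by (rule geqI') (use geq_wft[OF b] in auto)
next
  fix X Y d m m' assume "wft (TGen X Y d m)" "wft (TGen X Y d m')"
  then show "geq True (h (TGen X Y d (m \<oplus>\<^bsub>sHom C X Y d\<^esub> m'))) (TAdd (h (TGen X Y d m)) (h (TGen X Y d m')))"
    using geq.sym[OF geq.add_zero[of "TZero X Y (d - 1)" True]] by (simp add: h_gen)
next
  fix X Y d r m assume *: "r \<in> carrier K" "wft (TGen X Y d m)"
  have "eqv True (scale r (cls (TZero X Y (d - 1)))) (scale r 0)" by (intro scale_eqv * cls_zero)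
  then have "eqv True (cls (TZero X Y (d - 1))) (cls (TSmult r (TZero X Y (d - 1))))"
    using eqv_trans[OF cls_zero eqv_sym] * by (simp add: scale_cls)
  then show "geq True (h (TGen X Y d (r \<odot>\<^bsub>sHom C X Y d\<^esub> m))) (TSmult r (h (TGen X Y d m)))"
    unfolding h_gen by (rule geqI') (use * in auto)
qed (simp_all add: h_zero h_add h_smult)

lemma multilinear_h: "multilinear True (\<lambda>t. if wft t then cls (h t) else 0)"
  unfolding multilinear_def
proof (intro conjI allI impI)
  fix t u assume "geq True t u"
  then show "eqv True (if wft t then cls (h t) else 0) (if wft u then cls (h u) else 0)"
    using cls_geq[OF geq_h] geq_wft by auto
next
  fix t u assume "wft (TAdd t u)"
  then show "eqv True (if wft (TAdd t u) then cls (h (TAdd t u)) else 0)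
     ((if wft t then cls (h t) else 0) + (if wft u then cls (h u) else 0))"
    by (auto simp: h_add intro!: cls_add)
qed (auto simp: scale_cls h_smult)

section \<open>The homotopy equation by induction on terms\<close>

definition is_homotopy_at :: "('o, 'k, 'm) tm \<Rightarrow> bool" where
  "is_homotopy_at t \<longleftrightarrow> eqv True (cls (F t)) (cls t + cls (b1 (h t)) + cls (h (b1 t)))"

text \<open>Only \<open>TB\<close> is left to the two concrete homotopies. For \<open>TH t\<close>,
  since \<open>F\<close> commutes with the differential and \<open>H b_1 = 1 - b_1 H\<close>, the
  term \<open>F t\<close> is equivalent to the sum of \<open>b1 (F (TH t))\<close> and
  \<open>F (TH (b1 t))\<close>. In this form \<open>H\<close> is applied to the homotopy equation of
  \<open>t\<close>.\<close>

lemma homotopy_at: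
  assumes TB: "\<And>ts. wft (TB ts) \<Longrightarrow> (\<And>t. t \<in> set ts \<Longrightarrow> is_homotopy_at t) \<Longrightarrow> is_homotopy_at (TB ts)"
  shows "wft t \<Longrightarrow> is_homotopy_at t"
proof (induction t)
  case (TGen X Y d m)
  have "eqv True (cls (F (TGen X Y d m))) (cls (TGen X Y d m) + 0 + 0)" using F_gen TGen by simp
  also have "eqv True \<dots> (cls (TGen X Y d m) + cls (b1 (h (TGen X Y d m))) + cls (h (b1 (TGen X Y d m))))"
    by (intro eqv_add eqv_refl) (auto simp: h_gen intro: eqv_sym[OF cls_zero])
  finally show ?case by (simp add: is_homotopy_at_def)
next
  case (TZero X Y d)
  have "eqv True (cls (F (TZero X Y d))) (0 + 0 + 0)"
    using multilinear_zero[OF F_linear, of X Y d] TZero by simp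
  also have "eqv True \<dots> (cls (TZero X Y d) + cls (b1 (h (TZero X Y d))) + cls (h (b1 (TZero X Y d))))"
    by (intro eqv_add) (auto simp: h_zero intro: eqv_sym[OF cls_zero])
  finally show ?case by (simp add: is_homotopy_at_def)
next
  case (TAdd t u)
  then have tu: "wft t" "wft u" "wft (TAdd t u)" by auto
  have "eqv True (cls (F (TAdd t u))) (cls (F t) + cls (F u))" by (rule F_add[OF tu(3)])
  also have "eqv True \<dots> ((cls t + cls (b1 (h t)) + cls (h (b1 t))) + (cls u + cls (b1 (h u)) + cls (h (b1 u))))"
    using TAdd.IH tu by (intro eqv_add) (auto simp: is_homotopy_at_def)
  also have "\<dots> = (cls t + cls u) + (cls (b1 (h t)) + cls (b1 (h u))) + (cls (h (b1 t)) + cls (h (b1 u)))" by simp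
  also have "eqv True \<dots> (cls (TAdd t u) + cls (b1 (h (TAdd t u))) + cls (h (b1 (TAdd t u))))"
    unfolding h_add tm_b1.simps by (intro eqv_add eqv_sym[OF cls_add]) (use tu in auto)
  finally show ?case by (simp add: is_homotopy_at_def)
next
  case (TSmult r t)
  then have t: "wft t" "wft (TSmult r t)" and r: "r \<in> carrier K" by auto
  have "eqv True (cls (F (TSmult r t))) (scale r (cls (F t)))" by (rule F_smult[OF t(2)])
  also have "eqv True \<dots> (scale r (cls t + cls (b1 (h t)) + cls (h (b1 t))))"
    using TSmult.IH t by (intro scale_eqv[OF r]) (simp add: is_homotopy_at_def)
  also have "\<dots> = cls (TSmult r t) + cls (b1 (h (TSmult r t))) + cls (h (b1 (TSmult r t)))"
    using r by (simp add: h_smult scale_cls)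
  finally show ?case by (simp add: is_homotopy_at_def)
next
  case (TB ts)
  then obtain X Y where "path X ts Y" by (elim wft_TBE)
  then show ?case using TB.IH TB.prems path_wft by (intro assms) auto
next
  case (TH t)
  then have t: "wft t" "wft (TH t)" "in_P t" by auto
  let ?a = "F (TH t)" and ?c = "F (TH (b1 t))"
  have wc: "wft (TH (b1 t))" "wft ?c" "wft ?a" "in_P ?c" using t by auto
  have types: "TAdd (b1 ?a) ?c \<in> tms (tm_src t) (tm_tgt t) (tm_deg t)"
    "TAdd (TAdd t (b1 (h t))) (h (b1 t)) \<in> tms (tm_src t) (tm_tgt t) (tm_deg t)"
    using t wc by (auto simp: in_terms_iff)
  have wt: "wft (TH (TAdd (b1 ?a) ?c))" "wft (TH (TAdd (TAdd t (b1 (h t))) (h (b1 t))))"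
    "wft (TH (TAdd t (b1 (h t))))"
    using t wc by auto
  have wac: "wft (TAdd (b1 ?a) ?c)" using types(1) unfolding in_terms_iff by blast
  have "eqv True (cls (TAdd (b1 ?a) ?c)) (cls (b1 ?a) + cls ?c)" by (rule cls_add[OF wac])
  also have "eqv True \<dots> (cls (F (b1 (TH t))) + cls ?c)" by (intro eqv_add eqv_refl F_b1 t)
  also have "eqv True \<dots> ((cls (F t) - cls ?c) + cls ?c)"
  proof (intro eqv_add eqv_refl)
    have "eqv True (cls (F (tneg K (TH (b1 t))))) (scale (\<ominus>\<^bsub>K\<^esub> \<one>\<^bsub>K\<^esub>) (cls ?c))"
      unfolding tneg_def by (rule F_smult) (use wc in simp)
    also have "\<dots> = cls (tneg K ?c)" by (simp add: scale_cls tneg_def)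
    also have "eqv True \<dots> (- cls ?c)" by (rule cls_neg)
    finally have n: "eqv True (cls (F (tneg K (TH (b1 t))))) (- cls ?c)" .
    have "eqv True (cls (F (b1 (TH t)))) (cls (F t) + cls (F (tneg K (TH (b1 t)))))"
      unfolding tm_b1.simps by (rule F_add) (use t wc in auto)
    also have "eqv True \<dots> (cls (F t) + - cls ?c)" by (intro eqv_add eqv_refl n)
    finally show "eqv True (cls (F (b1 (TH t)))) (cls (F t) - cls ?c)" by simp
  qed
  also have "(cls (F t) - cls ?c) + cls ?c = cls (F t)" by simp
  also have "eqv True \<dots> (cls t + cls (b1 (h t)) + cls (h (b1 t)))" using TH t by (simp add: is_homotopy_at_def)
  also have "eqv True \<dots> (cls (TAdd t (b1 (h t))) + cls (h (b1 t)))"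
    by (intro eqv_add eqv_refl eqv_sym[OF cls_add]) (use t in auto)
  also have "eqv True \<dots> (cls (TAdd (TAdd t (b1 (h t))) (h (b1 t))))"
    by (rule eqv_sym[OF cls_add]) (use t in auto)
  finally have "geq True (TAdd (b1 ?a) ?c) (TAdd (TAdd t (b1 (h t))) (h (b1 t)))"
    using geqI types by blast
  then have m0: "eqv True (cls (TH (TAdd (b1 ?a) ?c))) (cls (TH (TAdd (TAdd t (b1 (h t))) (h (b1 t)))))"
    by (intro cls_H_cong wt)
  have a: "eqv True (cls (TH (TAdd (b1 ?a) ?c))) (cls (TH (b1 ?a)) + cls (TH ?c))"
    by (rule cls_H_add[OF wt(1)])
  have b: "eqv True (cls (TH (TAdd (TAdd t (b1 (h t))) (h (b1 t))))) (cls (TH t) + cls (TH (b1 (h t))) + cls (TH (h (b1 t))))"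
    by (rule eqv_trans[OF cls_H_add[OF wt(2)] eqv_add[OF cls_H_add[OF wt(3)] eqv_refl]])
  \<comment> \<open>The homotopy equation of \<open>t\<close> with \<open>H\<close> applied to each
    summand. In the final sum these terms cancel and leave \<open>F (TH t)\<close>.\<close>
  have main: "eqv True (cls (TH (b1 ?a)) + cls (TH ?c)) (cls (TH t) + cls (TH (b1 (h t))) + cls (TH (h (b1 t))))"
    by (rule eqv_trans[OF eqv_trans[OF eqv_sym[OF a] m0] b])
  have "eqv True (cls (b1 (h (TH t)))) (cls (b1 (TH ?a)) - cls (b1 (TH (h t))))"
    unfolding h_H tm_b1.simps(3) tneg_def tm_b1.simps(4) unfolding tneg_def[symmetric]
    by (rule cls_sub) (use t wc wft_b1[of "TH ?a"] wft_b1[of "TH (h t)"] in \<open>auto simp del: tm_b1.simps\<close>)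
  also have "eqv True \<dots> ((cls ?a - cls (TH (b1 ?a))) - (cls (h t) - cls (TH (b1 (h t)))))"
    unfolding tm_b1.simps by (intro eqv_diff cls_sub) (use t wc in auto)
  finally have p1: "eqv True (cls (b1 (h (TH t)))) ((cls ?a - cls (TH (b1 ?a))) - (cls (h t) - cls (TH (b1 (h t)))))" .
  have "eqv True (cls (h (b1 (TH t)))) (cls (h t) - cls (h (TH (b1 t))))"
    unfolding tm_b1.simps h_add tneg_def h_smult unfolding tneg_def[symmetric]
    by (rule cls_sub) (use t wc wft_h[OF wc(1)] in auto)
  also have "eqv True \<dots> (cls (h t) - (cls (TH ?c) - cls (TH (h (b1 t)))))"
    by (intro eqv_diff eqv_refl h_H_cls wc)
  finally have p2: "eqv True (cls (h (b1 (TH t)))) (cls (h t) - (cls (TH ?c) - cls (TH (h (b1 t)))))" .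
  have "eqv True (cls (TH t) + cls (b1 (h (TH t))) + cls (h (b1 (TH t))))
     (cls (TH t) + ((cls ?a - cls (TH (b1 ?a))) - (cls (h t) - cls (TH (b1 (h t)))))
       + (cls (h t) - (cls (TH ?c) - cls (TH (h (b1 t))))))"
    by (intro eqv_add eqv_refl p1 p2)
  also have "\<dots> = cls ?a - ((cls (TH (b1 ?a)) + cls (TH ?c)) - (cls (TH t) + cls (TH (b1 (h t))) + cls (TH (h (b1 t)))))"
    by (simp add: algebra_simps)
  also have "eqv True \<dots> (cls ?a - 0)"
    using main by (intro eqv_diff eqv_refl) (simp add: eqv_def)
  finally show ?case using eqv_sym by (simp add: is_homotopy_at_def)
qed

lemma homotopic_maps_Q:
  assumes XY: "X \<in> Ob C" "Y \<in> Ob C"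
    and hom: "\<And>t. wft t \<Longrightarrow> is_homotopy_at t"
    and f: "\<And>d t. t \<in> tms X Y d \<Longrightarrow> f d (Q_class t) = Q_class (F t)"
  shows "homotopic_maps K Q X Y f (\<lambda>d x. x)"
proof -
  let ?M = "\<lambda>d. sHom Q X Y d"
  note R = representsD[OF represents_Q[OF XY]]
  \<comment> \<open>The map on cosets goes through a chosen representative; \<open>geq_h\<close>
    makes the choice immaterial.\<close>
  define h' where "h' d c = Q_class (h (SOME t. t \<in> tms X Y d \<and> Q_class t = c))" for d c
  have h': "h' d (Q_class t) = Q_class (h t)" if t: "t \<in> tms X Y d" for d t
  proof -
    let ?s = "SOME s. s \<in> tms X Y d \<and> Q_class s = Q_class t"
    have s: "?s \<in> tms X Y d \<and> Q_class ?s = Q_class t" by (rule someI[of _ t]) (use t in simp)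
    have "wft ?s" "wft t" using s t by (simp_all only: in_terms_iff)
    then have "geq True ?s t" using Q_class_eq_iff s by blast
    then have "geq True (h ?s) (h t)" by (rule geq_h)
    then have "Q_class (h ?s) = Q_class (h t)" using Q_class_eq_iff[of "h ?s" "h t"] geq_wft[of True "h ?s" "h t"] by blast
    then show ?thesis by (simp add: h'_def)
  qed
  have ht: "h t \<in> tms X Y (d - 1)" if "t \<in> tms X Y d" for d t using that by (auto simp: in_terms_iff)
  have bt: "b1 t \<in> tms X Y (d + 1)" if "t \<in> tms X Y d" for d t using that by (rule b1_terms)
  have bop1: "bop Q [Arrow X Y d (Q_class t)] = Q_class (b1 t)" if "t \<in> tms X Y d" for d t
    using bop_Q[of X "[t]" Y] that by (simp add: arrow_of_def in_terms_iff)
  have "linear_map K (?M d) (?M (d - 1)) (h' d)" for d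
    unfolding linear_map_def
  proof (intro conjI ballI funcsetI)
    fix x assume "x \<in> carrier (?M d)"
    then show "h' d x \<in> carrier (?M (d - 1))" using R(1) h' ht by auto
  next
    fix x y assume "x \<in> carrier (?M d)" "y \<in> carrier (?M d)"
    then obtain t u where *: "t \<in> tms X Y d" "u \<in> tms X Y d" "x = Q_class t" "y = Q_class u" using R(1) by auto
    then show "h' d (x \<oplus>\<^bsub>?M d\<^esub> y) = h' d x \<oplus>\<^bsub>?M (d - 1)\<^esub> h' d y"
      using R(3)[OF *(1,2)] R(3)[OF ht[OF *(1)] ht[OF *(2)]] h'[OF *(1)] h'[OF *(2)] h'[of "TAdd t u" d]
      by (simp add: h_add)
  next
    fix r x assume r: "r \<in> carrier K" and "x \<in> carrier (?M d)"
    then obtain t where *: "t \<in> tms X Y d" "x = Q_class t" using R(1) by auto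
    then show "h' d (r \<odot>\<^bsub>?M d\<^esub> x) = r \<odot>\<^bsub>?M (d - 1)\<^esub> h' d x"
      using R(4)[OF r *(1)] R(4)[OF r ht[OF *(1)]] h'[OF *(1)] h'[of "TSmult r t" d] r
      by (simp add: h_smult)
  qed
  moreover have "f d x = x \<oplus>\<^bsub>?M d\<^esub> bop Q [Arrow X Y (d - 1) (h' d x)] \<oplus>\<^bsub>?M d\<^esub> h' (d + 1) (bop Q [Arrow X Y d x])"
    if "x \<in> carrier (?M d)" for d x
  proof -
    obtain t where t: "t \<in> tms X Y d" "x = Q_class t" using R(1) \<open>x \<in> carrier (?M d)\<close> by auto
    have b: "b1 (h t) \<in> tms X Y d" using bt[OF ht[OF t(1)]] by simp
    have c: "h (b1 t) \<in> tms X Y d" using ht[OF bt[OF t(1)]] by simp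
    have tw: "wft t" using t by (simp add: in_terms_iff)
    have "eqv True (cls (F t)) (cls t + cls (b1 (h t)) + cls (h (b1 t)))"
      using hom[OF tw] by (simp add: is_homotopy_at_def)
    also have "eqv True \<dots> (cls (TAdd t (b1 (h t))) + cls (h (b1 t)))"
      by (intro eqv_add eqv_refl eqv_sym[OF cls_add]) (use tw in auto)
    also have "eqv True \<dots> (cls (TAdd (TAdd t (b1 (h t))) (h (b1 t))))"
      by (rule eqv_sym[OF cls_add]) (use tw in auto)
    finally have "geq True (F t) (TAdd (TAdd t (b1 (h t))) (h (b1 t)))"
      by (rule geqI') (use tw in auto)
    then have "Q_class (F t) = Q_class (TAdd (TAdd t (b1 (h t))) (h (b1 t)))" using Q_class_eq_iff geq_wft by blast
    also have "\<dots> = Q_class t \<oplus>\<^bsub>?M d\<^esub> Q_class (b1 (h t)) \<oplus>\<^bsub>?M d\<^esub> Q_class (h (b1 t))"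
      using R(3)[OF t(1) b] R(3)[OF TAdd_in_terms[OF t(1) b] c] by simp
    finally show ?thesis
      using f[OF t(1)] t(2) h'[OF t(1)] bop1[OF t(1)] bop1[OF ht[OF t(1)]] h'[OF bt[OF t(1)]] by simp
  qed
  ultimately show ?thesis unfolding homotopic_maps_def by blast
qed

definition hb1_summand :: "('o, 'k, 'm) tm list \<Rightarrow> ('o, 'k, 'm) tm list \<Rightarrow> ('o, 'k, 'm) tm list
    \<Rightarrow> (('o, 'k, 'm) tm \<Rightarrow>\<^sub>0 int)" where
  "hb1_summand u v z = (if u = [] \<and> z = [] then 0 else frag_cmul (sg (ldeg z)) (cls (h (TB (u @ Bt v # z)))))"

text \<open>By \<open>multilinear_h\<close> the homotopy may be applied summand by summand to the
  signed sum that represents \<open>b1 (TB w)\<close>. The contraction of the whole word again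
  counts as 0.\<close>

lemma h_b1_TB:
  assumes p: "path X w Y" "length w \<ge> 2"
  shows "eqv True (cls (h (b1 (TB w)))) (- (\<Sum>(u, v, z)\<in>decomps w. hb1_summand u v z))"
proof -
  let ?L = "frag_extend (\<lambda>t. if wft t then cls (h t) else 0)"
  have w: "wft (TB w)" using wft_TB[OF p] by simp
  have "cls (h (b1 (TB w))) = ?L (cls (b1 (TB w)))"
    using wft_b1[OF w] by (simp add: frag_extend_cls del: tm_b1.simps)
  also have "eqv True \<dots> (?L (- b1_sum w))" by (rule multilinear_extend[OF multilinear_h b1_TB_GS[OF w]])
  also have "?L (- b1_sum w) = - (\<Sum>x\<in>decomps w. ?L (case x of (u, v, z) \<Rightarrow> b1_summand u v z))"
    by (simp add: b1_sum_def frag_extend_minus frag_extend_sum o_def)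
  also have "(\<Sum>x\<in>decomps w. ?L (case x of (u, v, z) \<Rightarrow> b1_summand u v z)) = (\<Sum>(u, v, z)\<in>decomps w. hb1_summand u v z)"
  proof (rule sum.cong)
    fix x assume "x \<in> decomps w"
    then obtain u v z where x: "x = (u, v, z)" "(u, v, z) \<in> decomps w" by (cases x) auto
    have "wft (TB (u @ Bt v # z))" if "u \<noteq> [] \<or> z \<noteq> []"
      using wft_TB[OF path_dec(1)[OF p(1) x(2)]] length_slot[OF that] by blast
    then show "?L (case x of (u, v, z) \<Rightarrow> b1_summand u v z) = (case x of (u, v, z) \<Rightarrow> hb1_summand u v z)"
      by (auto simp: x(1) b1_summand_def hb1_summand_def frag_extend_cmul frag_extend_cls)
  qed simp
  finally show ?thesis .
qed

end

locale strictly_unital = quotient_construction K C B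
  for K :: "'k ring" and C :: "('o, 'k, 'm) ainf" and B :: "('o, 'k, 'm) ainf" +
  fixes i :: "'o \<Rightarrow> 'm"
  assumes i_closed: "X \<in> Ob C \<Longrightarrow> i X \<in> carrier (sHom C X X (-1))"
    and i_cycle: "X \<in> Ob C \<Longrightarrow> bop C [Arrow X X (-1) (i X)] = \<zero>\<^bsub>sHom C X X 0\<^esub>"
    and strict: "strict_unit_equations C i"
begin

definition unit_arrow :: "'o \<Rightarrow> ('o, 'm) arrow" where
  "unit_arrow X = Arrow X X (-1) (i X)"

definition iota :: "'o \<Rightarrow> ('o, 'k, 'm) tm" where
  "iota X = gen (unit_arrow X)"

lemma iota_simps [simp]: "tm_src (iota X) = X" "tm_tgt (iota X) = X" "tm_deg (iota X) = -1"
    "wft (iota X) \<longleftrightarrow> X \<in> Ob C" "in_P (iota X)"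
  using i_closed by (auto simp: iota_def gen_def unit_arrow_def)

lemma b1_iota: "eqv f (cls (b1 (iota X))) 0"
proof (cases "X \<in> Ob C")
  case True
  have "b1 (iota X) = TGen X X 0 \<zero>\<^bsub>sHom C X X 0\<^esub>"
    using i_cycle[OF True] by (simp add: iota_def gen_def unit_arrow_def)
  then show ?thesis using cls_gen_zero[OF True True] by simp
next
  case False
  then show ?thesis by (simp add: iota_def gen_def unit_arrow_def cls_def)
qed

lemma slot_b1_iota: "X \<in> Ob C \<Longrightarrow> eqv f (slot u z (cls (b1 (iota X)))) 0"
  using slot_eqv[OF b1_iota, of f u z X] by (simp add: slot_simps)

lemma Bt_slot_cls: "wft t \<Longrightarrow> u \<noteq> [] \<or> z \<noteq> [] \<Longrightarrow> cls (TB (u @ t # z)) = slot u z (cls t)"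
  by (simp add: slot_simps Bt_slot)

lemma Bt_ge2: "u \<noteq> [] \<Longrightarrow> Bt (u @ [t]) = TB (u @ [t])" "u \<noteq> [] \<Longrightarrow> Bt (t # u) = TB (t # u)"
  using Bt_slot[of u "[]" t] Bt_slot[of "[]" u t] by auto

section \<open>Right units\<close>

definition right_mult :: "('o, 'k, 'm) tm \<Rightarrow> ('o, 'k, 'm) tm" where
  "right_mult t = TB [t, iota (tm_tgt t)]"

text \<open>No Koszul signs occur, since the unit and the homotopy act at the right end of a word
  and have nothing to move past. The expression \<open>last (map right_htpy ts)\<close> is the
  homotopy of the last letter in primitive recursive form.\<close>

primrec right_htpy :: "('o, 'k, 'm) tm \<Rightarrow> ('o, 'k, 'm) tm" where
  "right_htpy (TGen X Y d m) = TZero X Y (d - 1)"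
| "right_htpy (TZero X Y d) = TZero X Y (d - 1)"
| "right_htpy (TAdd t u) = TAdd (right_htpy t) (right_htpy u)"
| "right_htpy (TSmult r t) = TSmult r (right_htpy t)"
| "right_htpy (TB ts) = TAdd (TB (ts @ [iota (tm_tgt (last ts))])) (tneg K (TB (butlast ts @ [last (map right_htpy ts)])))"
| "right_htpy (TH t) = TAdd (TH (right_mult (TH t))) (tneg K (TH (right_htpy t)))"

lemma right_htpy_TB: "right_htpy (TB (w @ [x])) = TAdd (TB (w @ [x, iota (tm_tgt x)])) (tneg K (TB (w @ [right_htpy x])))"
  by simp

lemma right_htpy_TB_wft:
  assumes p: "path X (w @ [x]) Y" and w: "w \<noteq> []" and x: "lowers right_htpy x"
  shows "same_type (TB (w @ [x, iota Y])) (TB (w @ [right_htpy x]))" "tm_src (TB (w @ [x, iota Y])) = X"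
    "tm_tgt (TB (w @ [x, iota Y])) = Y" "tm_deg (TB (w @ [x, iota Y])) = ldeg (w @ [x])"
proof -
  have Y: "Y \<in> Ob C" using path_Ob[OF p] by simp
  have "path X (w @ [x, iota Y]) Y" "path X (w @ [right_htpy x]) Y" using p x Y by (auto simp: lowers_def)
  from wft_TB[OF this(1)] wft_TB[OF this(2)]
  show "same_type (TB (w @ [x, iota Y])) (TB (w @ [right_htpy x]))" "tm_src (TB (w @ [x, iota Y])) = X"
    "tm_tgt (TB (w @ [x, iota Y])) = Y" "tm_deg (TB (w @ [x, iota Y])) = ldeg (w @ [x])"
    using w x by (cases w; auto simp: same_type_def lowers_def)+
qed

lemma right_htpy_cls:
  assumes p: "path X (w @ [x]) Y" and w: "w \<noteq> []" and x: "lowers right_htpy x"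
  shows "eqv f (cls (right_htpy (TB (w @ [x])))) (cls (TB (w @ [x, iota Y])) - cls (TB (w @ [right_htpy x])))"
proof -
  have "tm_tgt x = Y" using p by auto
  then show ?thesis unfolding right_htpy_TB using right_htpy_TB_wft[OF assms] by (intro eqv_trans[OF cls_sub]) (auto simp: same_type_def)
qed

lemma right_mult_terms: "t \<in> tms X Y d \<Longrightarrow> right_mult t \<in> tms X Y d"
proof -
  assume t: "t \<in> tms X Y d"
  then have "Y \<in> Ob C" using wft_Ob by (auto simp: in_terms_iff)
  then have "path X [t, iota Y] Y" using t by (auto simp: in_terms_iff)
  from wft_TB[OF this] show ?thesis using t by (simp add: right_mult_def in_terms_iff)
qed

lemma multilinear_Fr: "multilinear True (\<lambda>t. if wft t then cls (right_mult t) else 0)"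
  unfolding multilinear_def
proof (intro conjI allI impI)
  fix t u assume tu: "geq True t u"
  then show "eqv True (if wft t then cls (right_mult t) else 0) (if wft u then cls (right_mult u) else 0)"
    using multilinearD(2)[OF cls_slot[where us = "[]"] tu] geq_wft[OF tu] by (simp add: right_mult_def)
next
  fix t u assume tu: "wft (TAdd t u)"
  then show "eqv True (if wft (TAdd t u) then cls (right_mult (TAdd t u)) else 0)
      ((if wft t then cls (right_mult t) else 0) + (if wft u then cls (right_mult u) else 0))"
    using multilinearD(3)[OF cls_slot[where us = "[]"] tu] by (simp add: right_mult_def)
next
  fix r t assume rt: "wft (TSmult r t)"
  then show "eqv True (if wft (TSmult r t) then cls (right_mult (TSmult r t)) else 0) (scale r (if wft t then cls (right_mult t) else 0))"
    using multilinearD(4)[OF cls_slot[where us = "[]"] rt] by (simp add: right_mult_def)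
qed simp

lemma bb_pair: "bb [s, t] = frag_cmul (sg (tm_deg t)) (cls (TB [b1 s, t])) + cls (TB [s, b1 t]) + cls (b1 (TB [s, t]))"
proof -
  have "bb ([s] @ [t]) = frag_cmul (sg (tm_deg t)) (cls (TB [b1 s, t])) + (cls (b1 (TB [s, t])) + cls (TB [s, b1 t]))"
    unfolding bb_def sum_dec_snoc sum_spl_snoc[of _ "[]" s, simplified]
    using Bt_slot[of "[]" "[t]"] Bt_slot[of "[s]" "[]"] Bt_TB[of "[s, t]"] sum_spl_Cons[of _ s "[]"] by simp
  then show ?thesis by (simp add: algebra_simps)
qed

text \<open>The A-infinity relation for \<open>t\<close> followed by the unit. The differential of
  the unit is null, and the odd degree of the unit gives \<open>TB [b1 t, ?j]\<close> a minus sign,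
  so the other two summands have to agree.\<close>

lemma right_mult_b1:
  assumes t: "wft t"
  shows "eqv True (cls (b1 (right_mult t))) (cls (right_mult (b1 t)))"
proof -
  let ?j = "iota (tm_tgt t)"
  have Y: "tm_tgt t \<in> Ob C" using wft_Ob[OF t] by simp
  have p: "path (tm_src t) [t, ?j] (tm_tgt t)" using t Y by simp
  have "cls (TB [t, b1 ?j]) = slot [t] [] (cls (b1 ?j))"
    using Bt_slot_cls[of "b1 ?j" "[t]" "[]"] Y by simp
  then have "eqv True (cls (TB [t, b1 ?j])) 0" using slot_b1_iota[OF Y] by simp
  then have "eqv True (bb [t, ?j]) (- cls (TB [b1 t, ?j]) + 0 + cls (b1 (TB [t, ?j])))"
    unfolding bb_pair by (intro eqv_add) auto
  then have "eqv True (- cls (TB [b1 t, ?j]) + 0 + cls (b1 (TB [t, ?j]))) 0"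
    using eqv_trans[OF eqv_sym bb_relation[OF p]] by simp
  then show ?thesis using t by (simp add: eqv_def right_mult_def)
qed

lemma composable_unit:
  assumes "composable C xs"
  shows "composable C (xs @ [unit_arrow (tgt (last xs))])" "composable C (unit_arrow (src (hd xs)) # xs)"
proof -
  have ne: "xs \<noteq> []" and p: "path (src (hd xs)) (map gen xs) (tgt (last xs))"
    using assms composable_path by auto
  have Ob: "src (hd xs) \<in> Ob C" "tgt (last xs) \<in> Ob C" using path_Ob[OF p] ne by auto
  have "path (src (hd xs)) (map gen (xs @ [unit_arrow (tgt (last xs))])) (tgt (last xs))"
    using p Ob iota_simps[of "tgt (last xs)"] by (auto simp: iota_def)
  then show "composable C (xs @ [unit_arrow (tgt (last xs))])" by (rule path_gen) simp
  have "path (src (hd xs)) (map gen (unit_arrow (src (hd xs)) # xs)) (tgt (last xs))"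
    using p Ob iota_simps[of "src (hd xs)"] by (auto simp: iota_def)
  then show "composable C (unit_arrow (src (hd xs)) # xs)" by (rule path_gen) simp
qed

text \<open>\<open>base\<close> evaluates a word of generators followed by the unit inside
  \<open>C\<close>, where the strict unit equations apply.\<close>

lemma gen_unit_right:
  assumes "composable C xs"
  shows "eqv True (cls (TB (map gen xs @ [iota (tgt (last xs))])))
    (cls (TGen (src (hd xs)) (tgt (last xs)) (total_deg xs) (right_unit_op C i xs)))"
proof -
  let ?ys = "xs @ [unit_arrow (tgt (last xs))]"
  have ne: "xs \<noteq> []" using assms by (simp add: composable_def)
  have "geq True (TB (map gen ?ys)) (gen (barrow C ?ys))"
    by (rule geq.base) (use composable_unit[OF assms] ne in \<open>auto simp: Suc_le_eq\<close>)
  moreover have "gen (barrow C ?ys) = TGen (src (hd xs)) (tgt (last xs)) (total_deg xs) (right_unit_op C i xs)"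
    using ne by (simp add: gen_def barrow_def total_deg_def unit_arrow_def right_unit_op_def Let_def)
  ultimately show ?thesis using cls_geq by (fastforce simp: iota_def)
qed

text \<open>The strict equations enter twice: \<open>(1 \<otimes> i) b_2 = 1\<close> makes right
  multiplication the identity on generators, and the vanishing of the higher operations on the unit
  gives \<open>h_base\<close>. For \<open>h_TB_slot\<close> the last letter enters directly and
  through its homotopy, every other letter directly only.\<close>

lemma right_homotopy: "unit_homotopy K C B right_mult right_htpy"
proof (intro unit_homotopy.intro unit_homotopy_axioms.intro)
  show "quotient_construction K C" by (rule quotient_construction_axioms)
  show "same_type (right_mult t) t \<and> in_P (right_mult t)" if "wft t" for t
    using right_mult_terms[of t "tm_src t" "tm_tgt t" "tm_deg t"] that by (simp add: same_type_def in_terms_iff) (simp add: right_mult_def)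
  show "multilinear True (\<lambda>t. if wft t then cls (right_mult t) else 0)" by (rule multilinear_Fr)
  show "eqv True (cls (b1 (right_mult t))) (cls (right_mult (b1 t)))" if "wft t" for t using that by (rule right_mult_b1)
  show "eqv True (cls (right_mult (TGen X Y d m))) (cls (TGen X Y d m))" if "wft (TGen X Y d m)" for X Y d m
  proof -
    let ?x = "Arrow X Y d m"
    have c: "composable C [?x]" using that by (simp add: composable_def arrows_def)
    have "?x \<in> arrows C" using that by (simp add: arrows_def)
    then have "right_unit_op C i [?x] = m" using strict by (auto simp: strict_unit_equations_def)
    then show ?thesis using gen_unit_right[OF c] by (simp add: right_mult_def gen_def total_deg_def)
  qed
  show "lowers right_htpy (TB ts)" if ts: "wft (TB ts)" and IH: "\<And>t. t \<in> set ts \<Longrightarrow> lowers right_htpy t" for ts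
  proof -
    obtain X Y where p: "length ts \<ge> 2" "path X ts Y" "tm_src (TB ts) = X" "tm_tgt (TB ts) = Y"
      using ts by (elim wft_TBE)
    obtain w x where w: "ts = w @ [x]" using p(1) by (cases ts rule: rev_cases) auto
    have ne: "w \<noteq> []" using p(1) w by auto
    have "tm_tgt x = Y" using p(2) w by auto
    then show ?thesis
      unfolding lowers_def unfolding w right_htpy_TB
      using right_htpy_TB_wft[of X w x Y] p(2-4) w ne IH[of x] by (auto simp: same_type_def)
  qed
  show "\<exists>g g'. multilinear True g \<and> multilinear True g' \<and>
        (\<forall>t'. same_type t' t \<longrightarrow> eqv True (cls (right_htpy (TB (us @ t' # vs)))) (g t' + g' (right_htpy t')))"
    if low: "\<And>t. wft t \<Longrightarrow> lowers right_htpy t" and ts: "wft (TB (us @ t # vs))" for us t vs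
  proof -
    obtain X Y where p: "length (us @ t # vs) \<ge> 2" "path X (us @ t # vs) Y"
      using ts by (elim wft_TBE)
    show ?thesis
    proof (cases vs rule: rev_cases)
      case Nil
      then have ne: "us \<noteq> []" using p(1) by auto
      have "eqv True (cls (right_htpy (TB (us @ t' # vs)))) (cls (TB (us @ t' # [iota Y])) + - cls (TB (us @ right_htpy t' # [])))"
        if "same_type t' t" for t'
        using right_htpy_cls[of X us t' Y True] that low[of t'] p(2) ne Nil by (auto simp: same_type_def)
      then show ?thesis
        using cls_slot[of True us "[iota Y]"] multilinear_minus[OF cls_slot[of True us "[]"]] by blast
    next
      case (snoc vs' x)
      have x: "wft x" using p(2) snoc by auto
      have "eqv True (cls (right_htpy (TB (us @ t' # vs)))) ((cls (TB (us @ t' # (vs' @ [x, iota Y]))) + - cls (TB (us @ t' # (vs' @ [right_htpy x])))) + 0)"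
        if "same_type t' t" for t'
        using right_htpy_cls[of X "us @ t' # vs'" x Y True] that low[OF x] p(2) snoc by (auto simp: same_type_def)
      then show ?thesis
        using multilinear_plus[OF cls_slot[of True us "vs' @ [x, iota Y]"] multilinear_minus[OF cls_slot[of True us "vs' @ [right_htpy x]"]]]
          multilinear_cmul[OF multilinear_cls, of True 0]
        by (intro exI[of _ "\<lambda>t'. cls (TB (us @ t' # (vs' @ [x, iota Y]))) + - cls (TB (us @ t' # (vs' @ [right_htpy x])))"] exI[of _ "\<lambda>t. 0"]) simp
    qed
  qed
  show "eqv True (cls (right_htpy (TB (map gen xs)))) 0"
    if low: "\<And>t. wft t \<Longrightarrow> lowers right_htpy t" and xs: "composable C xs" "length xs \<ge> 2" for xs
  proof -
    let ?X = "src (hd xs)" and ?Y = "tgt (last xs)"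
    obtain ys x where ys: "xs = ys @ [x]" using xs(2) by (cases xs rule: rev_cases) auto
    have ne: "ys \<noteq> []" using ys xs(2) by auto
    have p: "path ?X (map gen ys @ [gen x]) ?Y" using xs(1) composable_path[of xs] ys by simp
    have Ob: "?X \<in> Ob C" "?Y \<in> Ob C" using path_Ob[OF p] by auto
    have x: "wft (gen x)" using p by auto
    have hx: "right_htpy (gen x) = TZero (src x) (tgt x) (deg x - 1)" by (simp add: gen_def)
    have "eqv True (cls (TB (map gen ys @ [gen x, iota ?Y]))) 0"
    proof -
      have "right_unit_op C i xs = \<zero>\<^bsub>sHom C ?X ?Y (total_deg xs)\<^esub>"
        using strict xs by (auto simp: strict_unit_equations_def)
      then have "eqv True (cls (TB (map gen xs @ [iota ?Y]))) (cls (TGen ?X ?Y (total_deg xs) \<zero>\<^bsub>sHom C ?X ?Y (total_deg xs)\<^esub>))"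
        using gen_unit_right[OF xs(1)] by simp
      then show ?thesis using eqv_trans[OF _ cls_gen_zero[OF Ob]] by (simp add: ys)
    qed
    moreover have "eqv True (cls (TB (map gen ys @ [right_htpy (gen x)]))) 0"
      unfolding hx using multilinear_zero[OF cls_slot[of True "map gen ys" "[]"]] by simp
    ultimately have "eqv True (cls (TB (map gen ys @ [gen x, iota ?Y])) - cls (TB (map gen ys @ [right_htpy (gen x)]))) (0 - 0)"
      by (rule eqv_diff)
    then show ?thesis using eqv_trans[OF right_htpy_cls[OF p _ low[OF x]]] ne by (simp add: ys)
  qed
qed simp_all

text \<open>The summands of \<open>right_htpy (b1 (TB ts))\<close> are matched with those of two
  relations that are null. Two things stay unmatched: \<open>TB ts\<close>, which the homotopy
  equation of the last letter contributes, and the contraction of the whole word.\<close>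

lemma right_homotopy_at:
  assumes t: "wft t"
  shows "unit_homotopy.is_homotopy_at K C B right_mult right_htpy t"
proof -
  interpret right: unit_homotopy K C B right_mult right_htpy by (rule right_homotopy)
  show ?thesis
  proof (rule right.homotopy_at[OF _ t])
    fix ts assume ts: "wft (TB ts)" and IH: "\<And>t. t \<in> set ts \<Longrightarrow> right.is_homotopy_at t"
    obtain X Y where p: "length ts \<ge> 2" "path X ts Y" "tm_src (TB ts) = X" "tm_tgt (TB ts) = Y"
      using ts by (elim wft_TBE)
    obtain w x where w: "ts = w @ [x]" using p(1) by (cases ts rule: rev_cases) auto
    have ne: "w \<noteq> []" using p(1) w by auto
    obtain Z where Z: "path X w Z" "wft x" "tm_src x = Z" "tm_tgt x = Y" using p(2) w by auto
    have Y: "Y \<in> Ob C" using wft_Ob[OF Z(2)] Z by simp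
    have px: "path X (w @ [x, iota Y]) Y" "path X (w @ [right_htpy x]) Y" using Z Y by auto
    have hid: "eqv True (cls (right_mult x)) (cls x + cls (b1 (right_htpy x)) + cls (right_htpy (b1 x)))"
      using IH[of x] w by (simp add: right.is_homotopy_at_def)
    let ?j = "iota Y"
    \<comment> \<open>\<open>?A1\<close>, \<open>?A2\<close>, \<open>?A3\<close> are the
      contractions of \<open>w @ [x, ?j]\<close> inside \<open>w\<close>, ending at \<open>x\<close>
      and ending at the unit; \<open>?B1\<close> and \<open>?B3\<close> are those of
      \<open>w @ [right_htpy x]\<close> inside \<open>w\<close> and ending at the last letter. The
      degree -1 of the unit or of the homotopy is not part of the signs here; it becomes the minus
      sign in front of the sums below.\<close>
    let ?A1 = "\<lambda>u v z. frag_cmul (sg (ldeg z + tm_deg x)) (cls (TB (u @ Bt v # z @ [x, ?j])))"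
    let ?A2 = "\<lambda>a b. cls (TB (a @ [Bt (b @ [x]), ?j]))"
    let ?A3 = "\<lambda>a b. cls (Bt (a @ [TB (b @ [x, ?j])]))"
    let ?B1 = "\<lambda>u v z. frag_cmul (sg (ldeg z + tm_deg x)) (cls (TB (u @ Bt v # z @ [right_htpy x])))"
    let ?B3 = "\<lambda>a b. cls (Bt (a @ [Bt (b @ [right_htpy x])]))"
    \<comment> \<open>\<open>?e\<close> is \<open>b1\<close> of the homotopy of
      \<open>TB ts\<close>. For the whole word \<open>?A2\<close> is
      \<open>right_mult (TB ts)\<close> and \<open>?A3 - ?B3\<close> is \<open>?e\<close>, so
      \<open>?c\<close> is what must be added to \<open>?A2 - ?A3 + ?B3\<close> to obtain 0, the
      value that \<open>hb1_summand\<close> has there.\<close>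
    let ?e = "cls (b1 (TB (w @ [x, ?j]))) - cls (b1 (TB (w @ [right_htpy x])))"
    let ?c = "?e - cls (right_mult (TB ts))"
    have "bb ((w @ [x]) @ [?j]) = - (\<Sum>(u, v, z)\<in>decomps w. ?A1 u v z) - (\<Sum>(a, b)\<in>splits w. ?A2 a b)
        + (\<Sum>(a, b)\<in>splits w. ?A3 a b) + slot (w @ [x]) [] (cls (b1 ?j))"
      unfolding bb_def sum_dec_snoc sum_spl_snoc using Y
      by (simp add: Bt_slot Bt_TB sg_pred slot_simps sum_negf split_def Bt_slot[of _ "[_, _]"] flip: minus_frag_cmul)
    moreover have "eqv True (bb ((w @ [x]) @ [?j])) 0" using bb_relation[OF px(1)] by simp
    ultimately have "eqv True (- (\<Sum>(u, v, z)\<in>decomps w. ?A1 u v z) - (\<Sum>(a, b)\<in>splits w. ?A2 a b)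
        + (\<Sum>(a, b)\<in>splits w. ?A3 a b) + slot (w @ [x]) [] (cls (b1 ?j)) - slot (w @ [x]) [] (cls (b1 ?j))) (0 - 0)"
      by (intro eqv_diff slot_b1_iota[OF Y]) simp
    then have A: "eqv True (- (\<Sum>(u, v, z)\<in>decomps w. ?A1 u v z) - (\<Sum>(a, b)\<in>splits w. ?A2 a b)
        + (\<Sum>(a, b)\<in>splits w. ?A3 a b)) 0" by simp
    have "bb (w @ [right_htpy x]) = - (\<Sum>(u, v, z)\<in>decomps w. ?B1 u v z) + (\<Sum>(a, b)\<in>splits w. ?B3 a b)"
      unfolding bb_def sum_dec_snoc using Z(2)
      by (simp add: Bt_slot sg_pred sum_negf split_def flip: minus_frag_cmul)
    then have "eqv True (- (\<Sum>(u, v, z)\<in>decomps w. ?B1 u v z) + (\<Sum>(a, b)\<in>splits w. ?B3 a b)) 0"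
      using bb_relation[OF px(2), of True] by simp
    then have B: "eqv True ((\<Sum>(u, v, z)\<in>decomps w. ?B1 u v z) - (\<Sum>(a, b)\<in>splits w. ?B3 a b)) 0"
      using eqv_minus by fastforce
    have T1: "eqv True (right.hb1_summand u v (z @ [x])) (?A1 u v z - ?B1 u v z)" if d: "(u, v, z) \<in> decomps w" for u v z
    proof -
      have "path X ((u @ Bt v # z) @ [x]) Y" using path_dec(1)[OF Z(1) d] Z by auto
      from eqv_cmul[OF right_htpy_cls[OF this _ right.lowers[OF Z(2)], of True], of "sg (ldeg z + tm_deg x)"]
      show ?thesis by (simp add: right.hb1_summand_def frag_cmul_diff)
    qed
    \<comment> \<open>Contractions ending at \<open>x\<close>. In general the contracted factor is a
      \<open>TB\<close> term and its homotopy is expanded by definition. If \<open>x\<close> alone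
      is contracted, its homotopy equation is used instead and contributes
      \<open>TB ts\<close>.\<close>
    have T2: "eqv True (right.hb1_summand a (b @ [x]) []) (?A2 a b - ?A3 a b + ?B3 a b
        + (if b = [] then cls (TB ts) else 0) + (if a = [] then ?c else 0))" if ab: "(a, b) \<in> splits w" for a b
    proof (cases "a = []")
      case True
      then have "b = w" using ab by (auto simp: splits_def)
      then show ?thesis using True ne w Z(4) wft_TB[OF p(2,1)] p
        by (simp add: right.hb1_summand_def Bt_ge2 right_mult_def Bt_TB del: tm_b1.simps)
    next
      case False
      obtain Z' where Z': "path X a Z'" "path Z' (b @ [x]) Y" using ab Z by (auto simp: splits_def)
      let ?y = "Bt (b @ [x])"
      note y = path_Bt[OF Z'(2)]
      have "path X (a @ [?y]) Y" using Z' y by simp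
      from right_htpy_cls[OF this False right.lowers, of True]
      have 1: "eqv True (right.hb1_summand a (b @ [x]) []) (?A2 a b - slot a [] (cls (right_htpy ?y)))"
        using y False Bt_slot_cls[of "right_htpy ?y" a "[]"] by (simp add: right.hb1_summand_def del: right_htpy.simps)
      have 2: "eqv True (slot a [] (cls (right_htpy ?y))) (?A3 a b - ?B3 a b - (if b = [] then cls (TB ts) else 0))"
      proof (cases "b = []")
        case True
        then have a: "a = w" using ab by (auto simp: splits_def)
        have "eqv True (cls (right_htpy (b1 x))) (cls (right_mult x) - cls x - cls (b1 (right_htpy x)))"
          using eqv_diff[OF eqv_sym[OF hid] eqv_refl[of True "cls x + cls (b1 (right_htpy x))"]] by (simp add: algebra_simps)
        from slot_eqv[OF this, of a "[]"]
        have "eqv True (slot a [] (cls (right_htpy (b1 x)))) (slot a [] (cls (right_mult x)) - slot a [] (cls x) - slot a [] (cls (b1 (right_htpy x))))"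
          by (simp add: slot_diff)
        moreover have "slot a [] (cls (right_mult x)) = ?A3 a b" using True Z right.wft_F[OF Z(2)] by (simp add: slot_simps right_mult_def)
        moreover have "slot a [] (cls x) = cls (TB ts)" using Z(2) a ne w by (simp add: slot_simps Bt_ge2)
        moreover have "slot a [] (cls (b1 (right_htpy x))) = ?B3 a b" using True Z(2) by (simp add: slot_simps)
        ultimately show ?thesis using True by (simp add: algebra_simps)
      next
        case b: False
        have 3: "eqv True (cls (right_htpy (TB (b @ [x])))) (cls (TB (b @ [x, ?j])) - cls (TB (b @ [right_htpy x])))"
          by (rule right_htpy_cls[OF Z'(2) b right.lowers[OF Z(2)]])
        note st = right_htpy_TB_wft(1)[OF Z'(2) b right.lowers[OF Z(2)]]
        from slot_eqv[OF 3, of a "[]"] show ?thesis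
          using b st by (simp add: slot_diff slot_simps Bt_ge2 same_type_def del: right_htpy.simps)
      qed
      have "eqv True (?A2 a b - slot a [] (cls (right_htpy ?y))) (?A2 a b - (?A3 a b - ?B3 a b - (if b = [] then cls (TB ts) else 0)))"
        by (intro eqv_diff eqv_refl 2)
      with eqv_trans[OF 1] show ?thesis using False by (simp add: algebra_simps)
    qed
    have m1: "eqv True (\<Sum>(u, v, z)\<in>decomps ts. right.hb1_summand u v z)
      ((\<Sum>(u, v, z)\<in>decomps w. ?A1 u v z - ?B1 u v z) + (\<Sum>(a, b)\<in>splits w. ?A2 a b - ?A3 a b + ?B3 a b
        + (if b = [] then cls (TB ts) else 0) + (if a = [] then ?c else 0)))"
      unfolding w sum_dec_snoc by (intro eqv_add eqv_sum) (use T1 T2 w in auto)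
    \<comment> \<open>Each of the two corrections occurs for exactly one splitting; what remains is
      the difference of the null sums \<open>A\<close> and \<open>B\<close>.\<close>
    have m2: "(\<Sum>(u, v, z)\<in>decomps w. ?A1 u v z - ?B1 u v z) + (\<Sum>(a, b)\<in>splits w. ?A2 a b - ?A3 a b + ?B3 a b
        + (if b = [] then cls (TB ts) else 0) + (if a = [] then ?c else 0))
      = cls (TB ts) + ?c - (- (\<Sum>(u, v, z)\<in>decomps w. ?A1 u v z) - (\<Sum>(a, b)\<in>splits w. ?A2 a b) + (\<Sum>(a, b)\<in>splits w. ?A3 a b))
        - ((\<Sum>(u, v, z)\<in>decomps w. ?B1 u v z) - (\<Sum>(a, b)\<in>splits w. ?B3 a b))"
      using sum_spl_delta(2)[of "cls (TB ts)" w] sum_spl_delta(1)[of ?c w]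
      by (simp add: split_def sum.distrib sum_subtractf)
    have sumGH: "eqv True (\<Sum>(u, v, z)\<in>decomps ts. right.hb1_summand u v z) (cls (TB ts) + ?c - 0 - 0)"
      by (rule eqv_trans[OF m1[unfolded m2] eqv_diff[OF eqv_diff[OF eqv_refl A] B]])
    have hb: "eqv True (cls (right_htpy (b1 (TB ts)))) (- (cls (TB ts) + ?c))"
      using eqv_trans[OF right.h_b1_TB[OF p(2,1)] eqv_minus[OF sumGH]] by simp
    note st = right_htpy_TB_wft[OF p(2)[unfolded w] ne right.lowers[OF Z(2)]]
    have bh: "eqv True (cls (b1 (right_htpy (TB ts)))) ?e"
      unfolding w right_htpy_TB tm_b1.simps(3) tneg_def tm_b1.simps(4) Z(4) unfolding tneg_def[symmetric]
      using st(1) by (intro cls_sub) (auto simp: same_type_def simp del: tm_b1.simps)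
    have "eqv True (cls (TB ts) + cls (b1 (right_htpy (TB ts))) + cls (right_htpy (b1 (TB ts)))) (cls (TB ts) + ?e + - (cls (TB ts) + ?c))"
      by (intro eqv_add eqv_refl bh hb)
    also have "cls (TB ts) + ?e + - (cls (TB ts) + ?c) = cls (right_mult (TB ts))" by simp
    finally show "right.is_homotopy_at (TB ts)" unfolding right.is_homotopy_at_def by (rule eqv_sym)
  qed
qed

section \<open>Left units\<close>

text \<open>The inner sign is the Koszul sign of the unit, of degree -1, moving past
  \<open>t\<close>; the outer one belongs to the unit condition for
  \<open>-(i \<otimes> 1) b_2\<close>.\<close>

definition left_mult :: "('o, 'k, 'm) tm \<Rightarrow> ('o, 'k, 'm) tm" where
  "left_mult t = tneg K (tsign K (tm_deg t) (TB [iota (tm_src t), t]))"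

text \<open>In operator form \<open>b_n h = -(i \<otimes> 1^n) b_(n+1) - (h \<otimes> 1^(n-1))
  b_n\<close>. The unit and the homotopy have odd degree and act at the left end, so the unit moves
  past all letters and the homotopy past all but the first.\<close>

primrec left_htpy :: "('o, 'k, 'm) tm \<Rightarrow> ('o, 'k, 'm) tm" where
  "left_htpy (TGen X Y d m) = TZero X Y (d - 1)"
| "left_htpy (TZero X Y d) = TZero X Y (d - 1)"
| "left_htpy (TAdd t u) = TAdd (left_htpy t) (left_htpy u)"
| "left_htpy (TSmult r t) = TSmult r (left_htpy t)"
| "left_htpy (TB ts) = tneg K (TAdd (tsign K (ldeg ts) (TB (iota (tm_src (hd ts)) # ts)))
     (tsign K (ldeg (tl ts)) (TB (hd (map left_htpy ts) # tl ts))))"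
| "left_htpy (TH t) = TAdd (TH (left_mult (TH t))) (tneg K (TH (left_htpy t)))"

lemma left_htpy_TB: "left_htpy (TB (x # w)) = tneg K (TAdd (tsign K (ldeg (x # w)) (TB (iota (tm_src x) # x # w)))
    (tsign K (ldeg w) (TB (left_htpy x # w))))"
  by simp

lemma left_htpy_TB_wft:
  assumes p: "path X (x # w) Y" and w: "w \<noteq> []" and x: "lowers left_htpy x"
  shows "same_type (TB (iota X # x # w)) (TB (left_htpy x # w))" "tm_src (TB (iota X # x # w)) = X"
    "tm_tgt (TB (iota X # x # w)) = Y" "tm_deg (TB (iota X # x # w)) = ldeg (x # w)"
proof -
  have X: "X \<in> Ob C" using path_Ob[OF p] by simp
  have "path X (iota X # x # w) Y" "path X (left_htpy x # w) Y" using p x X by (auto simp: lowers_def)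
  from wft_TB[OF this(1)] wft_TB[OF this(2)]
  show "same_type (TB (iota X # x # w)) (TB (left_htpy x # w))" "tm_src (TB (iota X # x # w)) = X"
    "tm_tgt (TB (iota X # x # w)) = Y" "tm_deg (TB (iota X # x # w)) = ldeg (x # w)"
    using w x by (cases w; auto simp: same_type_def lowers_def)+
qed

lemma left_htpy_cls:
  assumes p: "path X (x # w) Y" and w: "w \<noteq> []" and x: "lowers left_htpy x"
  shows "eqv f (cls (left_htpy (TB (x # w)))) (- (frag_cmul (sg (ldeg (x # w))) (cls (TB (iota X # x # w)))
    + frag_cmul (sg (ldeg w)) (cls (TB (left_htpy x # w)))))"
proof -
  have sx: "tm_src x = X" using p by auto
  have "eqv f (cls (left_htpy (TB (x # w)))) (- cls (TAdd (tsign K (ldeg (x # w)) (TB (iota X # x # w))) (tsign K (ldeg w) (TB (left_htpy x # w)))))"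
    unfolding left_htpy_TB sx by (rule cls_neg)
  also have "eqv f \<dots> (- (cls (tsign K (ldeg (x # w)) (TB (iota X # x # w))) + cls (tsign K (ldeg w) (TB (left_htpy x # w)))))"
    using left_htpy_TB_wft[OF assms] by (intro eqv_minus cls_add) (auto simp: same_type_def)
  also have "eqv f \<dots> (- (frag_cmul (sg (ldeg (x # w))) (cls (TB (iota X # x # w)))
    + frag_cmul (sg (ldeg w)) (cls (TB (left_htpy x # w)))))"
    by (intro eqv_minus eqv_add cls_tsign)
  finally show ?thesis .
qed

lemma left_mult_terms: "t \<in> tms X Y d \<Longrightarrow> left_mult t \<in> tms X Y d"
proof -
  assume t: "t \<in> tms X Y d"
  then have "X \<in> Ob C" using wft_Ob by (auto simp: in_terms_iff)
  then have "path X [iota X, t] Y" using t by (auto simp: in_terms_iff)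
  from wft_TB[OF this] show ?thesis using t by (simp add: left_mult_def in_terms_iff)
qed

lemma left_mult_cls: "eqv f (cls (left_mult t)) (- frag_cmul (sg (tm_deg t)) (cls (TB [iota (tm_src t), t])))"
  unfolding left_mult_def by (rule eqv_trans[OF cls_neg eqv_minus[OF cls_tsign]])

text \<open>The sign and the unit letter in \<open>left_mult\<close> depend on the degree and source
  of the argument, so it is an insertion into a slot only after these are fixed. All terms in one
  linearity condition share their type, hence \<open>g\<close> may be compared with the map
  \<open>k\<close> frozen at that type.\<close>

lemma multilinear_by_type:
  assumes k: "\<And>X d. multilinear f (k X d)"
    and g: "\<And>t. wft t \<Longrightarrow> eqv f (g t) (k (tm_src t) (tm_deg t) t)" and g0: "\<And>t. \<not> wft t \<Longrightarrow> g t = 0"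
  shows "multilinear f g"
  unfolding multilinear_def
proof (intro conjI allI impI)
  fix t u assume tu: "geq f t u"
  note d = geq_wft[OF tu]
  have "eqv f (g t) (k (tm_src u) (tm_deg u) t)" using g[of t] d by simp
  also have "eqv f \<dots> (k (tm_src u) (tm_deg u) u)" by (rule multilinearD(2)[OF k tu])
  also have "eqv f \<dots> (g u)" using eqv_sym[OF g[of u]] d by simp
  finally show "eqv f (g t) (g u)" .
next
  fix t u assume tu: "wft (TAdd t u)"
  have "eqv f (g (TAdd t u)) (k (tm_src t) (tm_deg t) (TAdd t u))" using g[OF tu] by simp
  also have "eqv f \<dots> (k (tm_src t) (tm_deg t) t + k (tm_src t) (tm_deg t) u)" by (rule multilinearD(3)[OF k tu])
  also have "eqv f \<dots> (g t + g u)" using eqv_sym[OF g[of t]] eqv_sym[OF g[of u]] tu by (intro eqv_add) auto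
  finally show "eqv f (g (TAdd t u)) (g t + g u)" .
next
  fix r t assume rt: "wft (TSmult r t)"
  have "eqv f (g (TSmult r t)) (k (tm_src t) (tm_deg t) (TSmult r t))" using g[OF rt] by simp
  also have "eqv f \<dots> (scale r (k (tm_src t) (tm_deg t) t))" by (rule multilinearD(4)[OF k rt])
  also have "eqv f \<dots> (scale r (g t))" using rt by (intro scale_eqv eqv_sym[OF g]) auto
  finally show "eqv f (g (TSmult r t)) (scale r (g t))" .
qed (rule g0)

lemma multilinear_Fl: "multilinear True (\<lambda>t. if wft t then cls (left_mult t) else 0)"
proof (rule multilinear_by_type)
  show "multilinear True (\<lambda>t. - frag_cmul (sg d) (cls (TB ([iota X] @ t # []))))" for X d
    by (intro multilinear_minus multilinear_cmul cls_slot)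
qed (use left_mult_cls in auto)

lemma b1_tneg: "b1 (tneg K t) = tneg K (b1 t)" and b1_tsign: "b1 (tsign K e t) = tsign K e (b1 t)"
  by (simp_all add: tneg_def tsign_def)

text \<open>The relation for the unit followed by \<open>t\<close> leaves two summands of equal
  sign. Their opposite signs in the claim arise because \<open>b1\<close> raises the degree, which
  changes the sign in \<open>left_mult\<close>.\<close>

lemma left_mult_b1:
  assumes t: "wft t"
  shows "eqv True (cls (b1 (left_mult t))) (cls (left_mult (b1 t)))"
proof -
  let ?j = "iota (tm_src t)"
  have X: "tm_src t \<in> Ob C" using wft_Ob[OF t] by simp
  have p: "path (tm_src t) [?j, t] (tm_tgt t)" using t X by simp
  have "cls (TB [b1 ?j, t]) = slot [] [t] (cls (b1 ?j))"
    using Bt_slot_cls[of "b1 ?j" "[]" "[t]"] X by simp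
  then have "eqv True (frag_cmul (sg (tm_deg t)) (cls (TB [b1 ?j, t]))) (frag_cmul (sg (tm_deg t)) 0)"
    using slot_b1_iota[OF X] by (intro eqv_cmul) simp
  then have "eqv True (bb [?j, t]) (frag_cmul (sg (tm_deg t)) 0 + cls (TB [?j, b1 t]) + cls (b1 (TB [?j, t])))"
    unfolding bb_pair by (intro eqv_add) auto
  then have "eqv True (cls (TB [?j, b1 t]) + cls (b1 (TB [?j, t]))) 0"
    using eqv_trans[OF eqv_sym bb_relation[OF p]] by simp
  then have 1: "eqv True (cls (b1 (TB [?j, t]))) (- cls (TB [?j, b1 t]))" by (simp add: eqv_def add.commute)
  have "eqv True (cls (b1 (left_mult t))) (- frag_cmul (sg (tm_deg t)) (cls (b1 (TB [?j, t]))))"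
    unfolding left_mult_def b1_tneg b1_tsign by (rule eqv_trans[OF cls_neg eqv_minus[OF cls_tsign]])
  also have "eqv True \<dots> (- frag_cmul (sg (tm_deg t)) (- cls (TB [?j, b1 t])))"
    by (intro eqv_minus eqv_cmul 1)
  also have "\<dots> = - frag_cmul (sg (tm_deg (b1 t))) (cls (TB [iota (tm_src (b1 t)), b1 t]))"
    using t by (simp add: frag_cmul_minus sg_add)
  also have "eqv True \<dots> (cls (left_mult (b1 t)))" by (rule eqv_sym[OF left_mult_cls])
  finally show ?thesis .
qed

lemma gen_unit_left:
  assumes "composable C xs"
  shows "eqv True (frag_cmul (sg (total_deg xs)) (cls (TB (iota (src (hd xs)) # map gen xs))))
    (cls (TGen (src (hd xs)) (tgt (last xs)) (total_deg xs) (left_unit_op C i xs)))"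
proof -
  let ?X = "src (hd xs)" and ?Y = "tgt (last xs)"
  let ?ys = "unit_arrow ?X # xs" and ?M = "sHom C ?X ?Y (total_deg xs)"
  have ne: "xs \<noteq> []" using assms by (simp add: composable_def)
  have XY: "?X \<in> Ob C" "?Y \<in> Ob C"
    using assms composable_path[of xs] path_Ob[of ?X "map gen xs" ?Y] by auto
  have c: "composable C ?ys" by (rule composable_unit(2)[OF assms])
  have "geq True (TB (map gen ?ys)) (gen (barrow C ?ys))"
    by (rule geq.base) (use c ne in \<open>auto simp: Suc_le_eq\<close>)
  moreover have "gen (barrow C ?ys) = TGen ?X ?Y (total_deg xs) (bop C ?ys)"
    using ne by (simp add: gen_def barrow_def total_deg_def unit_arrow_def)
  ultimately have 1: "eqv True (cls (TB (iota ?X # map gen xs))) (cls (TGen ?X ?Y (total_deg xs) (bop C ?ys)))"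
    using cls_geq by (fastforce simp: iota_def)
  have "bop C ?ys \<in> carrier ?M" using bop_closed[OF c] ne by (simp add: unit_arrow_def total_deg_def)
  then have "eqv True (cls (TGen ?X ?Y (total_deg xs) (ksign ?M (total_deg xs) (bop C ?ys))))
     (frag_cmul (sg (total_deg xs)) (cls (TGen ?X ?Y (total_deg xs) (bop C ?ys))))"
    using cls_gen_neg[OF XY] by (simp add: ksign_def sg_def)
  then show ?thesis
    using eqv_trans[OF eqv_cmul[OF 1] eqv_sym] by (simp add: left_unit_op_def Let_def unit_arrow_def)
qed

lemma left_homotopy: "unit_homotopy K C B left_mult left_htpy"
proof (intro unit_homotopy.intro unit_homotopy_axioms.intro)
  show "quotient_construction K C" by (rule quotient_construction_axioms)
  show "same_type (left_mult t) t \<and> in_P (left_mult t)" if "wft t" for t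
    using left_mult_terms[of t "tm_src t" "tm_tgt t" "tm_deg t"] that by (simp add: same_type_def in_terms_iff) (simp add: left_mult_def)
  show "multilinear True (\<lambda>t. if wft t then cls (left_mult t) else 0)" by (rule multilinear_Fl)
  show "eqv True (cls (b1 (left_mult t))) (cls (left_mult (b1 t)))" if "wft t" for t using that by (rule left_mult_b1)
  show "eqv True (cls (left_mult (TGen X Y d m))) (cls (TGen X Y d m))" if "wft (TGen X Y d m)" for X Y d m
  proof -
    let ?x = "Arrow X Y d m"
    have c: "composable C [?x]" using that by (simp add: composable_def arrows_def)
    have "?x \<in> arrows C" using that by (simp add: arrows_def)
    \<comment> \<open>The equation \<open>(i \<otimes> 1) b_2 = -1\<close> of \<open>C\<close>; its
      minus sign cancels against the outer one of \<open>left_mult\<close>.\<close>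
    then have l: "left_unit_op C i [?x] = \<ominus>\<^bsub>sHom C X Y d\<^esub> m" using strict by (auto simp: strict_unit_equations_def)
    have "eqv True (cls (left_mult (TGen X Y d m))) (- frag_cmul (sg d) (cls (TB [iota X, TGen X Y d m])))"
      using left_mult_cls[of True "TGen X Y d m"] by simp
    also have "eqv True \<dots> (- cls (TGen X Y d (\<ominus>\<^bsub>sHom C X Y d\<^esub> m)))"
      using gen_unit_left[OF c] by (intro eqv_minus) (simp add: l gen_def total_deg_def)
    also have "eqv True \<dots> (- (- cls (TGen X Y d m)))" using that by (intro eqv_minus cls_gen_neg) auto
    finally show ?thesis by simp
  qed
  show "lowers left_htpy (TB ts)" if ts: "wft (TB ts)" and IH: "\<And>t. t \<in> set ts \<Longrightarrow> lowers left_htpy t" for ts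
  proof -
    obtain X Y where p: "length ts \<ge> 2" "path X ts Y" "tm_src (TB ts) = X" "tm_tgt (TB ts) = Y"
      using ts by (elim wft_TBE)
    obtain w x where w: "ts = x # w" using p(1) by (cases ts) auto
    have ne: "w \<noteq> []" using p(1) w by auto
    have "tm_src x = X" using p(2) w by auto
    then show ?thesis
      unfolding lowers_def unfolding w left_htpy_TB
      using left_htpy_TB_wft[of X x w Y] p(2-4) w ne IH[of x] by (auto simp: same_type_def)
  qed
  show "\<exists>g g'. multilinear True g \<and> multilinear True g' \<and>
        (\<forall>t'. same_type t' t \<longrightarrow> eqv True (cls (left_htpy (TB (us @ t' # vs)))) (g t' + g' (left_htpy t')))"
    if low: "\<And>t. wft t \<Longrightarrow> lowers left_htpy t" and ts: "wft (TB (us @ t # vs))" for us t vs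
  proof -
    obtain X Y where p: "length (us @ t # vs) \<ge> 2" "path X (us @ t # vs) Y"
      using ts by (elim wft_TBE)
    show ?thesis
    proof (cases us)
      case Nil
      then have ne: "vs \<noteq> []" using p(1) by auto
      have "eqv True (cls (left_htpy (TB (us @ t' # vs))))
         (- frag_cmul (sg (tm_deg t + ldeg vs)) (cls (TB ([iota X] @ t' # vs))) + - frag_cmul (sg (ldeg vs)) (cls (TB ([] @ left_htpy t' # vs))))"
        if "same_type t' t" for t'
        using left_htpy_cls[of X t' vs Y True] that low[of t'] p(2) ne Nil
        by (auto simp: same_type_def simp del: minus_frag_cmul)
      then show ?thesis
        using multilinear_minus[OF multilinear_cmul[OF cls_slot[of True "[iota X]" vs]]]
          multilinear_minus[OF multilinear_cmul[OF cls_slot[of True "[]" vs]]] by blast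
    next
      case (Cons x us')
      have x: "wft x" using p(2) Cons by auto
      let ?g = "\<lambda>t'. - (frag_cmul (sg (ldeg (x # us' @ t # vs))) (cls (TB ((iota X # x # us') @ t' # vs)))
           + frag_cmul (sg (ldeg (us' @ t # vs))) (cls (TB ((left_htpy x # us') @ t' # vs))))"
      have "eqv True (cls (left_htpy (TB (us @ t' # vs)))) (?g t' + 0)"
        if "same_type t' t" for t'
        using left_htpy_cls[of X x "us' @ t' # vs" Y True] that low[OF x] p(2) Cons by (auto simp: same_type_def)
      then show ?thesis
        using multilinear_minus[OF multilinear_plus[OF multilinear_cmul[OF cls_slot[of True "iota X # x # us'" vs]]
          multilinear_cmul[OF cls_slot[of True "left_htpy x # us'" vs]]]]
          multilinear_cmul[OF multilinear_cls, of True 0]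
        by (intro exI[of _ ?g] exI[of _ "\<lambda>t. 0"]) simp
    qed
  qed
  show "eqv True (cls (left_htpy (TB (map gen xs)))) 0"
    if low: "\<And>t. wft t \<Longrightarrow> lowers left_htpy t" and xs: "composable C xs" "length xs \<ge> 2" for xs
  proof -
    let ?X = "src (hd xs)" and ?Y = "tgt (last xs)"
    obtain ys x where ys: "xs = x # ys" using xs(2) by (cases xs) auto
    have ne: "ys \<noteq> []" using ys xs(2) by auto
    have p: "path ?X (gen x # map gen ys) ?Y" using xs(1) composable_path[of xs] ys by simp
    have Ob: "?X \<in> Ob C" "?Y \<in> Ob C" using path_Ob[OF p] by auto
    have x: "wft (gen x)" using p by auto
    have hx: "left_htpy (gen x) = TZero (src x) (tgt x) (deg x - 1)" by (simp add: gen_def)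
    have l: "left_unit_op C i xs = \<zero>\<^bsub>sHom C ?X ?Y (total_deg xs)\<^esub>"
      using strict xs by (auto simp: strict_unit_equations_def)
    have "eqv True (frag_cmul (sg (ldeg (map gen xs))) (cls (TB (iota ?X # map gen xs)))) 0"
      using eqv_trans[OF gen_unit_left[OF xs(1)] cls_gen_zero[OF Ob, of True "total_deg xs", folded l]] by simp
    moreover have "map gen xs = gen x # map gen ys" by (simp add: ys)
    ultimately have 1: "eqv True (frag_cmul (sg (ldeg (gen x # map gen ys))) (cls (TB (iota ?X # gen x # map gen ys)))) 0"
      by (simp only:)
    have "eqv True (cls (TB (left_htpy (gen x) # map gen ys))) 0"
      unfolding hx using multilinear_zero[OF cls_slot[of True "[]" "map gen ys"]] by simp
    then have 2: "eqv True (frag_cmul (sg (ldeg (map gen ys))) (cls (TB (left_htpy (gen x) # map gen ys)))) 0"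
      using eqv_cmul by fastforce
    have "eqv True (cls (left_htpy (TB (map gen xs)))) (- (0 + 0))"
      using eqv_trans[OF left_htpy_cls[OF p _ low[OF x]] eqv_minus[OF eqv_add[OF 1 2]]] ne
      by (simp add: ys)
    then show ?thesis by simp
  qed
qed simp_all

lemma left_homotopy_at:
  assumes t: "wft t"
  shows "unit_homotopy.is_homotopy_at K C B left_mult left_htpy t"
proof -
  interpret left: unit_homotopy K C B left_mult left_htpy by (rule left_homotopy)
  show ?thesis
  proof (rule left.homotopy_at[OF _ t])
    fix ts assume ts: "wft (TB ts)" and IH: "\<And>t. t \<in> set ts \<Longrightarrow> left.is_homotopy_at t"
    obtain X Y where p: "length ts \<ge> 2" "path X ts Y" "tm_src (TB ts) = X" "tm_tgt (TB ts) = Y"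
      using ts by (elim wft_TBE)
    obtain w x where w: "ts = x # w" using p(1) by (cases ts) auto
    have ne: "w \<noteq> []" using p(1) w by auto
    obtain Z where Z: "path Z w Y" "wft x" "tm_src x = X" "tm_tgt x = Z" using p(2) w by auto
    have X: "X \<in> Ob C" using wft_Ob[OF Z(2)] Z by simp
    have px: "path X (iota X # x # w) Y" "path X (left_htpy x # w) Y" using Z X by auto
    have hid: "eqv True (cls (left_mult x)) (cls x + cls (b1 (left_htpy x)) + cls (left_htpy (b1 x)))"
      using IH[of x] w by (simp add: left.is_homotopy_at_def)
    let ?j = "iota X"
    \<comment> \<open>\<open>?D\<close> and \<open>?D'\<close> are the Koszul signs of the two parts
      of the homotopy of \<open>TB ts\<close>. The relations for the two words are multiplied by
      them before they are added.\<close>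
    let ?D = "sg (tm_deg x + ldeg w)" and ?D' = "sg (ldeg w)"
    \<comment> \<open>\<open>?A1\<close>, \<open>?A2\<close>, \<open>?A3\<close> are the
      contractions of \<open>?j # x # w\<close> inside \<open>w\<close>, starting at
      \<open>x\<close> and starting at the unit; \<open>?B1\<close> and \<open>?B3\<close> are those
      of \<open>left_htpy x # w\<close> inside \<open>w\<close> and starting at its first
      letter.\<close>
    let ?A1 = "\<lambda>u v z. frag_cmul (sg (ldeg z)) (cls (TB (?j # x # u @ Bt v # z)))"
    let ?A2 = "\<lambda>a b. frag_cmul (sg (ldeg b)) (cls (TB (?j # Bt (x # a) # b)))"
    let ?A3 = "\<lambda>a b. frag_cmul (sg (ldeg b)) (cls (Bt (TB (?j # x # a) # b)))"
    let ?B1 = "\<lambda>u v z. frag_cmul (sg (ldeg z)) (cls (TB (left_htpy x # u @ Bt v # z)))"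
    let ?B3 = "\<lambda>a b. frag_cmul (sg (ldeg b)) (cls (Bt (Bt (left_htpy x # a) # b)))"
    let ?e = "- (frag_cmul ?D (cls (b1 (TB (?j # x # w)))) + frag_cmul ?D' (cls (b1 (TB (left_htpy x # w)))))"
    let ?c = "?e - cls (left_mult (TB ts))"
    have slot_Bt: "Bt (t # u @ y # z) = TB (t # u @ y # z)" "Bt (t # y # z) = TB (t # y # z)" for t u y z
      using Bt_slot[of "t # u" z y] Bt_slot[of "[t]" z y] by simp_all
    have "bb (?j # x # w) = (\<Sum>(u, v, z)\<in>decomps w. ?A1 u v z) + (\<Sum>(a, b)\<in>splits w. ?A2 a b)
        + (\<Sum>(a, b)\<in>splits w. ?A3 a b) + frag_cmul ?D (slot [] (x # w) (cls (b1 ?j)))"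
      unfolding bb_def sum_dec_Cons sum_spl_Cons using X
      by (simp add: slot_Bt Bt_TB slot_simps algebra_simps)
    moreover have "eqv True (bb (?j # x # w)) 0" using bb_relation[OF px(1)] by simp
    moreover have "eqv True (frag_cmul ?D (slot [] (x # w) (cls (b1 ?j)))) 0"
      using eqv_cmul[OF slot_b1_iota[OF X]] by (metis frag_cmul_zero2)
    ultimately have "eqv True ((\<Sum>(u, v, z)\<in>decomps w. ?A1 u v z) + (\<Sum>(a, b)\<in>splits w. ?A2 a b)
        + (\<Sum>(a, b)\<in>splits w. ?A3 a b) + frag_cmul ?D (slot [] (x # w) (cls (b1 ?j)))
        - frag_cmul ?D (slot [] (x # w) (cls (b1 ?j)))) (0 - 0)"
      by (intro eqv_diff) simp_all
    then have "eqv True ((\<Sum>(u, v, z)\<in>decomps w. ?A1 u v z) + (\<Sum>(a, b)\<in>splits w. ?A2 a b)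
        + (\<Sum>(a, b)\<in>splits w. ?A3 a b)) 0" by simp
    from eqv_cmul[OF this, of ?D]
    have A: "eqv True (frag_cmul ?D ((\<Sum>(u, v, z)\<in>decomps w. ?A1 u v z) + (\<Sum>(a, b)\<in>splits w. ?A2 a b)
        + (\<Sum>(a, b)\<in>splits w. ?A3 a b))) 0" by simp
    have "bb (left_htpy x # w) = (\<Sum>(u, v, z)\<in>decomps w. ?B1 u v z) + (\<Sum>(a, b)\<in>splits w. ?B3 a b)"
      unfolding bb_def sum_dec_Cons by (simp add: slot_Bt)
    then have "eqv True ((\<Sum>(u, v, z)\<in>decomps w. ?B1 u v z) + (\<Sum>(a, b)\<in>splits w. ?B3 a b)) 0"
      using bb_relation[OF px(2), of True] by simp
    from eqv_cmul[OF this, of ?D']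
    have B: "eqv True (frag_cmul ?D' ((\<Sum>(u, v, z)\<in>decomps w. ?B1 u v z) + (\<Sum>(a, b)\<in>splits w. ?B3 a b))) 0" by simp
    have T1: "eqv True (left.hb1_summand (x # u) v z) (frag_cmul ?D (?A1 u v z) + frag_cmul ?D' (?B1 u v z))"
      if d: "(u, v, z) \<in> decomps w" for u v z
    proof -
      have pp: "path X (x # (u @ Bt v # z)) Y" using path_dec(1)[OF Z(1) d] Z by auto
      have "ldeg w = ldeg u + ldeg v + ldeg z" using d by (simp add: decomps_def)
      \<comment> \<open>A contraction raises the degree by 1, so both signs in the homotopy of the
        contracted word are opposite to those for \<open>TB ts\<close>. This cancels the outer minus
        sign of \<open>left_htpy\<close>.\<close>
      then have dg: "sg (ldeg (x # u @ Bt v # z)) = - ?D" "sg (ldeg (u @ Bt v # z)) = - ?D'"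
        using path_dec(3)[OF Z(1) d] by (auto simp: sg_def)
      from eqv_cmul[OF left_htpy_cls[OF pp _ left.lowers[OF Z(2)], of True], of "sg (ldeg z)"]
      show ?thesis unfolding dg
        by (simp add: left.hb1_summand_def frag_cmul_distrib2 frag_cmul_minus mult_ac del: left_htpy.simps)
    qed
    \<comment> \<open>The degree of \<open>TB ts\<close> is one more than that of the word, so its
      Koszul sign is \<open>- ?D\<close> and cancels the outer minus sign.\<close>
    have FTB: "eqv True (cls (left_mult (TB ts))) (frag_cmul ?D (cls (TB [?j, TB ts])))"
      using left_mult_cls[of True "TB ts"] by (simp add: p(3)[unfolded w] w sg_add)
    \<comment> \<open>Contractions starting at \<open>x\<close>. Empty \<open>a\<close> means that
      \<open>x\<close> alone is contracted and its homotopy equation is used; empty \<open>b\<close>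
      means the whole word, where \<open>?c\<close> again makes the right-hand side null.\<close>
    have T2: "eqv True (left.hb1_summand [] (x # a) b) (frag_cmul ?D (?A2 a b) + frag_cmul ?D (?A3 a b) + frag_cmul ?D' (?B3 a b)
        + (if a = [] then cls (TB ts) else 0) + (if b = [] then ?c else 0))" if ab: "(a, b) \<in> splits w" for a b
    proof (cases "b = []")
      case True
      then have a: "a = w" using ab by (auto simp: splits_def)
      have "eqv True (cls (left_mult (TB ts)) + ?c - ?e) (frag_cmul ?D (cls (TB [?j, TB ts])) + ?c - ?e)"
        by (intro eqv_add eqv_diff eqv_refl FTB)
      then show ?thesis using True ne w a
        by (simp add: left.hb1_summand_def Bt_ge2 Bt_TB algebra_simps del: tm_b1.simps minus_frag_cmul)
    next
      case False
      obtain Z' where Z': "path X (x # a) Z'" "path Z' b Y" using ab Z by (auto simp: splits_def)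
      let ?y = "Bt (x # a)"
      note y = path_Bt[OF Z'(1)]
      have wab: "ldeg w = ldeg a + ldeg b" using ab by (auto simp: splits_def)
      have "path X (?y # b) Y" using Z' y by simp
      from eqv_cmul[OF left_htpy_cls[OF this False left.lowers, of True], of "sg (ldeg b)"]
      have "eqv True (left.hb1_summand [] (x # a) b) (frag_cmul (sg (ldeg b)) (- (frag_cmul (sg (ldeg (?y # b))) (cls (TB (?j # ?y # b)))
          + frag_cmul (sg (ldeg b)) (cls (TB (left_htpy ?y # b))))))"
        using y False by (simp add: left.hb1_summand_def del: left_htpy.simps)
      moreover have "sg (ldeg (?y # b)) = - ?D" using y wab by (auto simp: sg_def)
      moreover have "cls (TB (left_htpy ?y # b)) = slot [] b (cls (left_htpy ?y))"
        using y False Bt_slot_cls[of "left_htpy ?y" "[]" b] by (simp del: left_htpy.simps)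
      ultimately have 1: "eqv True (left.hb1_summand [] (x # a) b) (frag_cmul ?D (?A2 a b) - slot [] b (cls (left_htpy ?y)))"
        by (simp add: frag_cmul_distrib2 frag_cmul_minus frag_cmul_diff mult_ac del: left_htpy.simps)
      have 2: "eqv True (slot [] b (cls (left_htpy ?y))) (- (frag_cmul ?D (?A3 a b) + frag_cmul ?D' (?B3 a b) + (if a = [] then cls (TB ts) else 0)))"
      proof (cases "a = []")
        case True
        then have b: "b = w" using ab by (auto simp: splits_def)
        have "eqv True (cls (left_htpy (b1 x))) (cls (left_mult x) - cls x - cls (b1 (left_htpy x)))"
          using eqv_diff[OF eqv_sym[OF hid] eqv_refl[of True "cls x + cls (b1 (left_htpy x))"]] by (simp add: algebra_simps)
        also have "eqv True \<dots> (- frag_cmul (sg (tm_deg x)) (cls (TB [?j, x])) - cls x - cls (b1 (left_htpy x)))"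
          using left_mult_cls[of True x] Z(3) by (intro eqv_diff eqv_refl) simp
        finally have "eqv True (slot [] b (cls (left_htpy (b1 x)))) (slot [] b (- frag_cmul (sg (tm_deg x)) (cls (TB [?j, x])) - cls x - cls (b1 (left_htpy x))))"
          by (rule slot_eqv)
        then have "eqv True (slot [] b (cls (left_htpy (b1 x)))) (- frag_cmul (sg (tm_deg x)) (slot [] b (cls (TB [?j, x]))) - slot [] b (cls x) - slot [] b (cls (b1 (left_htpy x))))"
          by (simp add: slot_diff slot_simps)
        moreover have "frag_cmul (sg (tm_deg x)) (slot [] b (cls (TB [?j, x]))) = frag_cmul ?D (?A3 a b)"
        proof -
          have "wft (TB [?j, x])" using wft_TB[of X "[?j, x]" Z] X Z by simp
          then show ?thesis using True b by (simp add: slot_simps sg_add mult_ac)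
        qed
        moreover have "slot [] b (cls x) = cls (TB ts)" using Z(2) b ne w by (simp add: slot_simps Bt_ge2)
        moreover have "slot [] b (cls (b1 (left_htpy x))) = frag_cmul ?D' (?B3 a b)" using True Z(2) b by (simp add: slot_simps)
        ultimately have "eqv True (slot [] b (cls (left_htpy (b1 x)))) (- frag_cmul ?D (?A3 a b) - cls (TB ts) - frag_cmul ?D' (?B3 a b))"
          by (simp only:)
        also have "\<dots> = - (frag_cmul ?D (?A3 a b) + frag_cmul ?D' (?B3 a b) + cls (TB ts))" by (simp del: minus_frag_cmul)
        finally show ?thesis using True by (simp del: minus_frag_cmul)
      next
        case a: False
        have 3: "eqv True (cls (left_htpy (TB (x # a)))) (- (frag_cmul (sg (ldeg (x # a))) (cls (TB (?j # x # a)))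
            + frag_cmul (sg (ldeg a)) (cls (TB (left_htpy x # a)))))"
          by (rule left_htpy_cls[OF Z'(1) a left.lowers[OF Z(2)]])
        have sgs: "?D * sg (ldeg b) = sg (ldeg (x # a))" "?D' * sg (ldeg b) = sg (ldeg a)"
          unfolding wab by (auto simp: sg_def)
        note st = left_htpy_TB_wft(1)[OF Z'(1) a left.lowers[OF Z(2)]]
        have "slot [] b (- (frag_cmul (sg (ldeg (x # a))) (cls (TB (?j # x # a))) + frag_cmul (sg (ldeg a)) (cls (TB (left_htpy x # a)))))
          = - (frag_cmul ?D (?A3 a b) + frag_cmul ?D' (?B3 a b))"
          using a st unfolding frag_cmul_cmul sgs
          by (simp add: slot_def frag_extend_minus frag_extend_diff frag_extend_add frag_extend_cmul frag_extend_cls False Bt_ge2 same_type_def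
              del: left_htpy.simps minus_frag_cmul)
        with slot_eqv[OF 3, of "[]" b] show ?thesis using a by (simp add: Bt_ge2 del: left_htpy.simps)
      qed
      have "eqv True (frag_cmul ?D (?A2 a b) - slot [] b (cls (left_htpy ?y))) (frag_cmul ?D (?A2 a b)
          - (- (frag_cmul ?D (?A3 a b) + frag_cmul ?D' (?B3 a b) + (if a = [] then cls (TB ts) else 0))))"
        by (intro eqv_diff eqv_refl 2)
      also have "frag_cmul ?D (?A2 a b) - (- (frag_cmul ?D (?A3 a b) + frag_cmul ?D' (?B3 a b) + (if a = [] then cls (TB ts) else 0)))
        = frag_cmul ?D (?A2 a b) + frag_cmul ?D (?A3 a b) + frag_cmul ?D' (?B3 a b)
        + (if a = [] then cls (TB ts) else 0) + (if b = [] then ?c else 0)"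
        using False by (simp only: diff_minus_eq_add add.assoc if_False add_0_right)
      finally show ?thesis by (rule eqv_trans[OF 1])
    qed
    have m1: "eqv True (\<Sum>(u, v, z)\<in>decomps ts. left.hb1_summand u v z)
      ((\<Sum>(u, v, z)\<in>decomps w. frag_cmul ?D (?A1 u v z) + frag_cmul ?D' (?B1 u v z))
        + (\<Sum>(a, b)\<in>splits w. frag_cmul ?D (?A2 a b) + frag_cmul ?D (?A3 a b) + frag_cmul ?D' (?B3 a b)
        + (if a = [] then cls (TB ts) else 0) + (if b = [] then ?c else 0)))"
      unfolding w sum_dec_Cons by (intro eqv_add eqv_sum) (use T1 T2 w in auto)
    have m2: "(\<Sum>(u, v, z)\<in>decomps w. frag_cmul ?D (?A1 u v z) + frag_cmul ?D' (?B1 u v z))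
        + (\<Sum>(a, b)\<in>splits w. frag_cmul ?D (?A2 a b) + frag_cmul ?D (?A3 a b) + frag_cmul ?D' (?B3 a b)
        + (if a = [] then cls (TB ts) else 0) + (if b = [] then ?c else 0))
      = cls (TB ts) + ?c + frag_cmul ?D ((\<Sum>(u, v, z)\<in>decomps w. ?A1 u v z) + (\<Sum>(a, b)\<in>splits w. ?A2 a b) + (\<Sum>(a, b)\<in>splits w. ?A3 a b))
        + frag_cmul ?D' ((\<Sum>(u, v, z)\<in>decomps w. ?B1 u v z) + (\<Sum>(a, b)\<in>splits w. ?B3 a b))"
      using sum_spl_delta(1)[of "cls (TB ts)" w] sum_spl_delta(2)[of ?c w]
      by (simp only: split_def sum.distrib frag_cmul_distrib2 frag_cmul_sum ac_simps)
    have sumGH: "eqv True (\<Sum>(u, v, z)\<in>decomps ts. left.hb1_summand u v z) (cls (TB ts) + ?c + 0 + 0)"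
      by (rule eqv_trans[OF m1[unfolded m2] eqv_add[OF eqv_add[OF eqv_refl A] B]])
    have hb: "eqv True (cls (left_htpy (b1 (TB ts)))) (- (cls (TB ts) + ?c))"
      using eqv_trans[OF left.h_b1_TB[OF p(2,1)] eqv_minus[OF sumGH]] by simp
    note st = left_htpy_TB_wft[OF p(2)[unfolded w] ne left.lowers[OF Z(2)]]
    have bh: "eqv True (cls (b1 (left_htpy (TB ts)))) ?e"
    proof -
      let ?s = "b1 (tsign K (ldeg (x # w)) (TB (?j # x # w)))" and ?s' = "b1 (tsign K (ldeg w) (TB (left_htpy x # w)))"
      have wf: "wft (TAdd (tsign K (ldeg (x # w)) (TB (?j # x # w))) (tsign K (ldeg w) (TB (left_htpy x # w))))"
        using st by (auto simp: same_type_def)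
      have 0: "b1 (left_htpy (TB ts)) = tneg K (TAdd ?s ?s')"
        unfolding w left_htpy_TB b1_tneg Z(3) tm_b1.simps(3) ..
      have "eqv True (- cls (TAdd ?s ?s')) (- (cls ?s + cls ?s'))"
        using wft_b1[OF wf] by (intro eqv_minus cls_add) (simp del: tm_b1.simps add: tm_b1.simps(3))
      also have "eqv True \<dots> ?e"
        unfolding b1_tsign by (intro eqv_minus eqv_add eqv_trans[OF cls_tsign]) simp_all
      finally show ?thesis unfolding 0 by (rule eqv_trans[OF cls_neg])
    qed
    have "eqv True (cls (TB ts) + cls (b1 (left_htpy (TB ts))) + cls (left_htpy (b1 (TB ts)))) (cls (TB ts) + ?e + - (cls (TB ts) + ?c))"
      by (intro eqv_add eqv_refl bh hb)
    also have "cls (TB ts) + ?e + - (cls (TB ts) + ?c) = cls (left_mult (TB ts))" by simp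
    finally show "left.is_homotopy_at (TB ts)" unfolding left.is_homotopy_at_def by (rule eqv_sym)
  qed
qed

section \<open>Units of the quotient\<close>

lemma bop_Q_pair:
  assumes "path X [s, t] Y"
  shows "bop Q [qa s, qa t] = Q_class (TB [s, t])"
  using bop_Q[OF assms] by (simp add: Bt_TB)

text \<open>The unit elements are the images of those of \<open>C\<close>. The Koszul sign in
  \<open>left_unit_op\<close> is the one built into \<open>left_mult\<close>, so the unit maps and
  the multiplications on terms agree on representatives.\<close>

theorem unit_elements_Q: "unit_elements K Q (\<lambda>X. Q_class (iota X))"
  unfolding unit_elements_def
proof (intro conjI ballI)
  fix X assume "X \<in> Ob Q"
  then have X: "X \<in> Ob C" by simp
  show "Q_class (iota X) \<in> carrier (sHom Q X X (-1))"
    using representsD(1)[OF represents_Q[OF X X]] X by (auto simp: in_terms_iff)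
  have "path X [iota X] X" using X by simp
  then have "bop Q [qa (iota X)] = Q_class (b1 (iota X))" using bop_Q[of X "[iota X]" X] by simp
  also have "\<dots> = Q_class (TZero X X 0)"
  proof -
    have "geq True (b1 (iota X)) (TZero X X 0)"
      by (rule geqI'[OF eqv_trans[OF b1_iota eqv_sym[OF cls_zero]]]) (use X in auto)
    then show ?thesis using Q_class_eq_iff geq_wft by blast
  qed
  finally show "bop Q [Arrow X X (-1) (Q_class (iota X))] = \<zero>\<^bsub>sHom Q X X 0\<^esub>"
    using representsD(2)[OF represents_Q[OF X X]] by (simp add: arrow_of_def)
next
  fix X Y assume "X \<in> Ob Q" "Y \<in> Ob Q"
  then have XY: "X \<in> Ob C" "Y \<in> Ob C" by simp_all
  interpret right: unit_homotopy K C B right_mult right_htpy by (rule right_homotopy)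
  interpret left: unit_homotopy K C B left_mult left_htpy by (rule left_homotopy)
  show "homotopic_maps K Q X Y (\<lambda>d x. right_unit_op Q (\<lambda>X. Q_class (iota X)) [Arrow X Y d x]) (\<lambda>d x. x)"
  proof (rule right.homotopic_maps_Q[OF XY right_homotopy_at])
    fix d t assume t: "t \<in> tms X Y d"
    then have "path X [t, iota Y] Y" using XY by (simp add: in_terms_iff)
    from bop_Q_pair[OF this] t
    show "right_unit_op Q (\<lambda>X. Q_class (iota X)) [Arrow X Y d (Q_class t)] = Q_class (right_mult t)"
      by (simp add: right_unit_op_def Let_def arrow_of_def in_terms_iff right_mult_def)
  qed
  show "homotopic_maps K Q X Y
      (\<lambda>d x. \<ominus>\<^bsub>sHom Q X Y d\<^esub> left_unit_op Q (\<lambda>X. Q_class (iota X)) [Arrow X Y d x]) (\<lambda>d x. x)"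
  proof (rule left.homotopic_maps_Q[OF XY left_homotopy_at])
    fix d t assume t: "t \<in> tms X Y d"
    have p: "path X [iota X, t] Y" using t XY by (simp add: in_terms_iff)
    let ?u = "TB [iota X, t]"
    have u: "?u \<in> tms X Y d" using wft_TB[OF p] t by (simp add: in_terms_iff)
    have "bop Q [Arrow X X (-1) (Q_class (iota X)), Arrow X Y d (Q_class t)] = Q_class ?u"
      using bop_Q_pair[OF p] t by (simp add: arrow_of_def in_terms_iff)
    then have "left_unit_op Q (\<lambda>X. Q_class (iota X)) [Arrow X Y d (Q_class t)] = Q_class (tsign K d ?u)"
      using represents_neg[OF represents_Q[OF XY] u]
      by (simp add: left_unit_op_def Let_def total_deg_def ksign_def tsign_def)
    then show "\<ominus>\<^bsub>sHom Q X Y d\<^esub> left_unit_op Q (\<lambda>X. Q_class (iota X)) [Arrow X Y d (Q_class t)] = Q_class (left_mult t)"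
      using represents_neg[OF represents_Q[OF XY], of "tsign K d ?u" d] u t by (simp add: left_mult_def in_terms_iff)
  qed
qed

end

theorem theorem6p5:
  fixes K :: "'k ring" and C B :: "('o, 'k, 'm) ainf" and i :: "'o \<Rightarrow> 'm"
  assumes "ainf_category K C"
    and "unit_elements K C i"
    and "strict_unit_equations C i"
    and "full_ainf_subcategory B C"
  shows "unital_ainf_category K (Q_cat K C B)"
proof -
  interpret strictly_unital K C B i
  proof (intro strictly_unital.intro quotient_construction.intro strictly_unital_axioms.intro)
    show "ainf_category K C" by (rule assms(1))
  qed (use assms(2,3) in \<open>auto simp: unit_elements_def\<close>)
  show ?thesis
    unfolding unital_ainf_category_def using ainf_category_Q unit_elements_Q by blast
qed

end
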